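(* Let $F=(F_1,\dots,F_n)$ be a vector of independent random functionals, $F_i=F_i(\omega_i)$, let $$\beta_i=\sup_{y\in Y,\,y\ne0,\ \omega\in\Omega^X}\frac{|D_yF_i(\omega)|}{|y|_Y},\qquad i=1,\dots,n,$$ and assume that $$h(t)=8\max_{1\le i\le n}\beta_i\int_Y|y|_Y\big(e^{t\beta_i|y|_Y}-1\big)\nu_i(dy)+\frac{2n}{(E[|F|_2])^2}\max_{1\le i\le n}\beta_i^3\int_Y|y|_Y^3\big(e^{t\beta_i|y|_Y}-1\big)\nu_i(dy)$$ is finite for $t\in[0,t_0)$. Then $$P\big(|(F_1,\dots,F_n)|_2\ge 2E[|(F_1,\dots,F_n)|_2]+x\big)\le\exp\left(-\int_0^xh^{-1}(s)\,ds\right),\qquad 0<x<h(t_0^-).$$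
   Context: $Y$ is a normed linear space with norm $|\cdot|_Y$, $\nu_1,\dots,\nu_n$ are diffuse Radon measures on $Y$, $X=\{1,\dots,n\}\times Y$ with $d\nu(i,y)=d\nu_i(y)$. $\Omega^X\simeq\Omega^Y\times\cdots\times\Omega^Y$, $\omega=(\omega_1,\dots,\omega_n)$, is the configuration space (locally finite sets of distinct points), and $P$ is the Poisson measure with intensity $\nu$, so that $\omega_1,\dots,\omega_n$ are independent Poisson configurations on $Y$ with intensities $\nu_1,\dots,\nu_n$. Each $F_i$ depends only on $\omega_i$, and $D_yF_i(\omega)=F_i(\omega_i\cup\{y\})-F_i(\omega_i)$. $|\cdot|_2$ is the Euclidean norm on $\mathbb R^n$. Suprema over $\Omega^X$ may be taken as essential suprema. $h^{-1}(x)=\inf\{t>0:h(t)\ge x\}$ and $h(t_0^-)$ is the left limit of $h$ at $t_0$. *)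

theory Defs
  imports "HOL-Probability.Probability"
begin

text \<open>Radon measure on a Hausdorff space: a Borel measure that is locally finite and inner regular
  with respect to compact sets. On a \<open>\<sigma>\<close>-compact metric space this is the same as being locally
  finite, and there it also agrees with the other usual definitions.\<close>

definition radon_measure :: "'a::t2_space measure \<Rightarrow> bool" where
  "radon_measure M \<longleftrightarrow>
     sets M = sets borel \<and>
     (\<forall>x. \<exists>U. open U \<and> x \<in> U \<and> emeasure M U < \<infinity>) \<and>
     (\<forall>A\<in>sets M. emeasure M A = (SUP K\<in>{K. compact K \<and> K \<subseteq> A}. emeasure M K))"

definition diffuse_measure :: "'a measure \<Rightarrow> bool" where
  "diffuse_measure M \<longleftrightarrow> (\<forall>x\<in>space M. emeasure M {x} = 0)"

text \<open>A configuration is a set of points, so its points are automatically distinct.\<close>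

definition configurations :: "'a::topological_space set \<Rightarrow> 'a set set" where
  "configurations X =
     {\<omega>. \<omega> \<subseteq> X \<and> (\<forall>x\<in>X. \<exists>U. open U \<and> x \<in> U \<and> finite (\<omega> \<inter> U))}"

definition num_points :: "'a set \<Rightarrow> 'a set \<Rightarrow> ennreal" where
  "num_points A \<omega> = emeasure (count_space UNIV) (\<omega> \<inter> A)"

text \<open>Only \<open>space M\<close> and \<open>sets M\<close> matter here: the \<open>\<sigma>\<close>-algebra on configurations is the one
  generated by the counting maps \<open>\<omega> \<mapsto> \<omega>(A)\<close>, for measurable \<open>A\<close>.\<close>

definition config_space :: "'a::topological_space measure \<Rightarrow> 'a set measure" where
  "config_space M = sigma (configurations (space M))
     {{\<omega> \<in> configurations (space M). num_points A \<omega> \<in> B} | A B. A \<in> sets M \<and> B \<in> sets borel}"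

text \<open>\<open>P\<close> is the law of the Poisson point process with intensity \<open>M\<close>. The Poisson weights are
  written out because \<open>poisson_pmf\<close> is only specified for a positive rate, while here
  \<open>measure M A = 0\<close> must give the point mass at 0.\<close>

definition poisson_measure :: "'a::topological_space measure \<Rightarrow> 'a set measure \<Rightarrow> bool" where
  "poisson_measure M P \<longleftrightarrow>
     prob_space P \<and> sets P = sets (config_space M) \<and>
     (\<forall>A\<in>sets M. emeasure M A < \<infinity> \<longrightarrow>
        (\<forall>k::nat. measure P {\<omega> \<in> space P. num_points A \<omega> = of_nat k} =
           measure M A ^ k / fact k * exp (- measure M A))) \<and>
     (\<forall>\<A>. finite \<A> \<and> disjoint \<A> \<and> \<A> \<subseteq> {A \<in> sets M. emeasure M A < \<infinity>} \<longrightarrow>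
        prob_space.indep_vars P (\<lambda>_. borel) num_points \<A>)"

text \<open>The space \<open>X = {1..n} \<times> Y\<close> with \<open>d\<nu>(i, y) = d\<nu>\<^sub>i(y)\<close>; \<open>Y\<close> is the whole type.\<close>

definition intensity ::
    "nat \<Rightarrow> (nat \<Rightarrow> 'y::topological_space measure) \<Rightarrow> (nat \<times> 'y) measure" where
  "intensity n \<nu> = measure_of ({1..n} \<times> UNIV)
     (sets (count_space {1..n} \<Otimes>\<^sub>M (borel :: 'y measure)))
     (\<lambda>A. \<Sum>i=1..n. emeasure (\<nu> i) {y. (i, y) \<in> A})"

lemma space_intensity [simp]:
  "space (intensity n \<nu>) = {1..n} \<times> (UNIV :: 'y::topological_space set)"
  unfolding intensity_def
  by (rule space_measure_of)
    (use sets.space_closed[of "count_space {1..n} \<Otimes>\<^sub>M (borel :: 'y measure)"]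
      in \<open>simp add: space_pair_measure\<close>)

lemma sets_intensity [simp]:
  "sets (intensity n \<nu>) =
     sets (count_space {1..n} \<Otimes>\<^sub>M (borel :: 'y::topological_space measure))"
  unfolding intensity_def
  using sets.sets_measure_of_eq[of "count_space {1..n} \<Otimes>\<^sub>M (borel :: 'y measure)"]
  by (simp add: space_pair_measure)

lemma emeasure_intensity:
  fixes \<nu> :: "nat \<Rightarrow> 'y::topological_space measure"
  assumes \<nu>: "\<And>i. i \<in> {1..n} \<Longrightarrow> sets (\<nu> i) = sets borel"
    and A: "A \<in> sets (intensity n \<nu>)"
  shows "emeasure (intensity n \<nu>) A = (\<Sum>i=1..n. emeasure (\<nu> i) {y. (i, y) \<in> A})"
proof (rule emeasure_measure_of[OF intensity_def])
  have slice: "{y. (i, y) \<in> B} \<in> sets (\<nu> i)"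
    if "B \<in> sets (count_space {1..n} \<Otimes>\<^sub>M (borel :: 'y measure))" "i \<in> {1..n}" for B i
    using sets_Pair1[OF that(1), of i] \<nu>[OF that(2)] by (simp add: vimage_def)
  show "sets (count_space {1..n} \<Otimes>\<^sub>M borel) \<subseteq> Pow ({1..n} \<times> (UNIV :: 'y set))"
    using sets.space_closed[of "count_space {1..n} \<Otimes>\<^sub>M (borel :: 'y measure)"]
    by (simp add: space_pair_measure)
  show "A \<in> sets (intensity n \<nu>)" by (rule A)
  show "positive (sets (intensity n \<nu>)) (\<lambda>A. \<Sum>i=1..n. emeasure (\<nu> i) {y. (i, y) \<in> A})"
    by (simp add: positive_def)
  show "countably_additive (sets (intensity n \<nu>))
      (\<lambda>A. \<Sum>i=1..n. emeasure (\<nu> i) {y. (i, y) \<in> A})"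
  proof (rule countably_additiveI)
    fix B :: "nat \<Rightarrow> (nat \<times> 'y) set"
    assume B: "range B \<subseteq> sets (intensity n \<nu>)" "disjoint_family B"
    have "(\<Sum>j. \<Sum>i=1..n. emeasure (\<nu> i) {y. (i, y) \<in> B j}) =
        (\<Sum>i=1..n. \<Sum>j. emeasure (\<nu> i) {y. (i, y) \<in> B j})"
      by (rule suminf_sum) simp
    also have "\<dots> = (\<Sum>i=1..n. emeasure (\<nu> i) {y. (i, y) \<in> \<Union>(range B)})"
    proof (rule sum.cong[OF refl])
      fix i assume i: "i \<in> {1..n}"
      have "(\<Sum>j. emeasure (\<nu> i) {y. (i, y) \<in> B j}) =
          emeasure (\<nu> i) (\<Union>j. {y. (i, y) \<in> B j})"
        by (rule suminf_emeasure) (use B slice i in \<open>auto simp: disjoint_family_on_def\<close>)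
      also have "(\<Union>j. {y. (i, y) \<in> B j}) = {y. (i, y) \<in> \<Union>(range B)}" by auto
      finally show "(\<Sum>j. emeasure (\<nu> i) {y. (i, y) \<in> B j}) =
          emeasure (\<nu> i) {y. (i, y) \<in> \<Union>(range B)}" .
    qed
    finally show "(\<Sum>j. \<Sum>i=1..n. emeasure (\<nu> i) {y. (i, y) \<in> B j}) =
        (\<Sum>i=1..n. emeasure (\<nu> i) {y. (i, y) \<in> \<Union>(range B)})" .
  qed
qed

text \<open>The component \<open>\<omega>\<^sub>i\<close> under \<open>\<Omega>\<^sup>X \<simeq> \<Omega>\<^sup>Y \<times> \<dots> \<times> \<Omega>\<^sup>Y\<close>.\<close>

definition component :: "nat \<Rightarrow> (nat \<times> 'y) set \<Rightarrow> 'y set" where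
  "component i \<omega> = {y. (i, y) \<in> \<omega>}"

definition diff_op :: "'y \<Rightarrow> ('y set \<Rightarrow> real) \<Rightarrow> 'y set \<Rightarrow> real" where
  "diff_op y G \<omega> = G (\<omega> \<union> {y}) - G \<omega>"

text \<open>The two admissible readings of
  \<open>sup {\<bar>D\<^sub>y F\<^sub>i(\<omega>)\<bar> / \<bar>y\<bar> | y \<noteq> 0, \<omega> \<in> \<Omega>\<^sup>X}\<close>: with a true supremum over \<open>\<omega>\<close>, and with the essential
  supremum over \<open>\<omega>\<close> with respect to \<open>P\<close>. In \<open>ennreal\<close> the supremum over the empty set
  (\<open>Y = {0}\<close>) is 0.\<close>

definition lip_sup ::
    "nat \<Rightarrow> (nat \<Rightarrow> 'y::real_normed_vector set \<Rightarrow> real) \<Rightarrow> nat \<Rightarrow> ennreal" where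
  "lip_sup n F i = (SUP y\<in>{y. y \<noteq> 0}. SUP \<omega>\<in>configurations ({1..n} \<times> UNIV).
      ennreal (\<bar>diff_op y (F i) (component i \<omega>)\<bar> / norm y))"

definition lip_esssup ::
    "(nat \<times> 'y) set measure \<Rightarrow> (nat \<Rightarrow> 'y::real_normed_vector set \<Rightarrow> real) \<Rightarrow> nat \<Rightarrow> ennreal" where
  "lip_esssup P F i = (SUP y\<in>{y. y \<noteq> 0}.
      esssup P (\<lambda>\<omega>. ennreal (\<bar>diff_op y (F i) (component i \<omega>)\<bar> / norm y)))"

text \<open>The function \<open>h\<close>, with values in \<open>[0, \<infinity>]\<close>, for \<open>t \<ge> 0\<close>; the argument \<open>E\<close> is the mean
  \<open>E[\<bar>F\<bar>\<^sub>2] \<in> [0, \<infinity>]\<close>.\<close>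

definition dev_fun ::
    "nat \<Rightarrow> (nat \<Rightarrow> 'y::real_normed_vector measure) \<Rightarrow> (nat \<Rightarrow> real) \<Rightarrow> ennreal \<Rightarrow> real \<Rightarrow> ennreal" where
  "dev_fun n \<nu> \<beta> E t =
     8 * (MAX i\<in>{1..n}. ennreal (\<beta> i) *
            (\<integral>\<^sup>+ y. ennreal (norm y * (exp (t * \<beta> i * norm y) - 1)) \<partial>\<nu> i))
     + (2 * of_nat n / E\<^sup>2) *
       (MAX i\<in>{1..n}. ennreal (\<beta> i ^ 3) *
            (\<integral>\<^sup>+ y. ennreal (norm y ^ 3 * (exp (t * \<beta> i * norm y) - 1)) \<partial>\<nu> i))"

definition gen_inverse :: "(real \<Rightarrow> ennreal) \<Rightarrow> real \<Rightarrow> real" where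
  "gen_inverse h x = Inf {t. 0 < t \<and> ennreal x \<le> h t}"

text \<open>The left limit \<open>h(t\<^sub>0\<^sup>-)\<close>, where \<open>t\<^sub>0 = \<infinity>\<close> is allowed.\<close>

definition left_limit :: "(real \<Rightarrow> ennreal) \<Rightarrow> ereal \<Rightarrow> ennreal" where
  "left_limit h t\<^sub>0 = Lim (at_left t\<^sub>0) (\<lambda>t. h (real_of_ereal t))"

end

theory Submission
  imports Defs
begin

text \<open>
The Euclidean norm is replaced by its truncation \<open>Z = min (max \<bar>F\<bar> E[\<bar>F\<bar>]) c\<close>, whose mean is at most
\<open>2 E[\<bar>F\<bar>]\<close> (this is where the factor 2 comes from) and whose increments satisfy
\<open>(D Z)\<^sup>2 \<le> 8 K\<^sup>2 F\<^sub>i\<^sup>2 / \<bar>F\<bar>\<^sup>2 + 2 K\<^sup>4 / E[\<bar>F\<bar>]\<^sup>2\<close> with \<open>K = \<beta>\<^sub>i \<bar>y\<bar>\<close>. The sum of \<open>F\<^sub>i\<^sup>2 / \<bar>F\<bar>\<^sup>2\<close> over \<open>i\<close>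
is at most 1, so that a covariance inequality on Poisson space gives
\<open>Cov(Z, exp(t Z)) \<le> h(t) E[exp(t Z)]\<close>. Integrating this bound on the logarithmic derivative of the
Laplace transform and optimizing over \<open>t\<close> yields the tail estimate.

The covariance is computed by exchanging a Poisson configuration with an independent copy, cell by
cell, on a fine partition of a set of finite measure. In a small cell only the exchange of one
point against none matters, and it produces the product of two difference operators, evaluated
at two configurations that both have law \<open>P\<close>. The cells are exchanged in uniformly random
order: since the maximum over \<open>i\<close> stands outside of the integrals, the contributions of all the
components have to be compared at the same pair of configurations.
\<close>

section \<open>Counting points\<close>

text \<open>The truncation does two jobs. The upper cut makes \<open>Z\<close> and
  \<open>exp (t * Z)\<close> bounded, so every expectation exists. The lower cut guards a
  denominator: adding a point changes the squared norm by \<open>2 * f * d + d\<^sup>2\<close>, and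
  after division by the norm the first term is harmless because \<open>\<bar>f\<bar>\<close> is at
  most the norm, while the second needs a norm bounded away from 0.

  The random order is a finite form of the covariance identity with the Ornstein-Uhlenbeck
  semigroup. Exchanging each cell with probability \<open>u\<close> is Mehler's formula for a
  thinned configuration completed by an independent one, and the average over \<open>u\<close> in
  \<open>[0, 1]\<close> is the time integral. Working with finitely many cells avoids building the
  semigroup: only the invariance of the law under exchanges and the distribution of a single point
  in a small cell are used.

  The two difference operators sit at different configurations. The inequality between arithmetic
  and geometric mean turns their product into two squares, each at one configuration, and only there
  can the pointwise bound 1 for the sum over the components be applied.\<close>

lemma space_config_space [simp]: "space (config_space M) = configurations (space M)"
  unfolding config_space_def by (rule space_measure_of) auto

lemma sets_config_space:
  "sets (config_space M) = sigma_sets (configurations (space M))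
     {{\<omega> \<in> configurations (space M). num_points A \<omega> \<in> B} | A B. A \<in> sets M \<and> B \<in> sets borel}"
  unfolding config_space_def by (rule sets_measure_of) auto

lemma measurable_num_points:
  assumes "A \<in> sets M"
  shows "num_points A \<in> borel_measurable (config_space M)"
proof (rule measurableI)
  fix B :: "ennreal set" assume "B \<in> sets borel"
  have "{\<omega> \<in> configurations (space M). num_points A \<omega> \<in> B} \<in> sets (config_space M)"
    unfolding sets_config_space using assms \<open>B \<in> sets borel\<close> by (intro sigma_sets.Basic) blast
  also have "{\<omega> \<in> configurations (space M). num_points A \<omega> \<in> B} =
      num_points A -` B \<inter> space (config_space M)" by auto
  finally show "num_points A -` B \<inter> space (config_space M) \<in> sets (config_space M)" .
qed simp

lemma measurable_num_points' [measurable (raw)]: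
  assumes "f \<in> measurable N (config_space M)" "A \<in> sets M"
  shows "(\<lambda>x. num_points A (f x)) \<in> borel_measurable N"
  using measurable_compose[OF assms(1) measurable_num_points[OF assms(2)]] .

lemma measurable_config_spaceI:
  assumes f: "\<And>x. x \<in> space N \<Longrightarrow> f x \<in> configurations (space M)"
    and N: "\<And>A. A \<in> sets M \<Longrightarrow> (\<lambda>x. num_points A (f x)) \<in> borel_measurable N"
  shows "f \<in> measurable N (config_space M)"
  unfolding config_space_def
proof (rule measurable_measure_of)
  fix S assume "S \<in> {{\<omega> \<in> configurations (space M). num_points A \<omega> \<in> B} |
      A B. A \<in> sets M \<and> B \<in> sets borel}"
  then obtain A B where S: "S = {\<omega> \<in> configurations (space M). num_points A \<omega> \<in> B}"
    and AB: "A \<in> sets M" "B \<in> sets borel" by blast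
  have "f -` S \<inter> space N = (\<lambda>x. num_points A (f x)) -` B \<inter> space N"
    using f by (auto simp: S)
  then show "f -` S \<inter> space N \<in> sets N"
    using measurable_sets[OF N[OF AB(1)] AB(2)] by simp
qed (use f in auto)

lemma num_points_empty [simp]: "num_points {} \<omega> = 0"
  by (simp add: num_points_def)

lemma num_points_union:
  assumes "\<omega> \<inter> A \<inter> B = {}"
  shows "num_points (A \<union> B) \<omega> = num_points A \<omega> + num_points B \<omega>"
proof -
  have "emeasure (count_space UNIV) ((\<omega> \<inter> A) \<union> (\<omega> \<inter> B)) =
      emeasure (count_space UNIV) (\<omega> \<inter> A) + emeasure (count_space UNIV) (\<omega> \<inter> B)"
    using assms by (intro plus_emeasure[symmetric]) auto
  then show ?thesis by (simp add: num_points_def Int_Un_distrib)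
qed

lemma num_points_mono: "A \<subseteq> B \<Longrightarrow> num_points A \<omega> \<le> num_points B \<omega>"
  unfolding num_points_def by (intro emeasure_mono) auto

lemma num_points_cong: "\<omega> \<inter> A = \<omega>' \<inter> A' \<Longrightarrow> num_points A \<omega> = num_points A' \<omega>'"
  by (simp add: num_points_def)

lemma num_points_eq_0_iff: "num_points A \<omega> = 0 \<longleftrightarrow> \<omega> \<inter> A = {}"
  by (simp add: num_points_def emeasure_count_space_eq_0)

lemma num_points_cases:
  obtains k where "num_points A \<omega> = of_nat k" | "num_points A \<omega> = \<infinity>"
  by (cases "finite (\<omega> \<inter> A)") (simp_all add: num_points_def)

lemma num_points_eq_1D:
  assumes "num_points A \<omega> = 1"
  shows "\<exists>y. \<omega> \<inter> A = {y}"
proof -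
  have fin: "finite (\<omega> \<inter> A)"
    using assms by (rule_tac ccontr) (simp add: num_points_def)
  with assms have "ennreal (of_nat (card (\<omega> \<inter> A))) = 1"
    by (simp add: num_points_def ennreal_of_nat_eq_real_of_nat)
  then have "card (\<omega> \<inter> A) = 1" by simp
  then show ?thesis by (rule card_1_singletonE) blast
qed

lemma num_points_singleton: "num_points A {y} = indicator A y"
proof (cases "y \<in> A")
  case True
  then have "{y} \<inter> A = {y}" by auto
  with True show ?thesis by (simp add: num_points_def)
qed (simp add: num_points_def)

lemma num_points_insert:
  assumes "y \<notin> \<omega>"
  shows "num_points A (insert y \<omega>) = num_points A \<omega> + indicator A y"
proof -
  have "emeasure (count_space UNIV) ((\<omega> \<inter> A) \<union> ({y} \<inter> A)) =
      emeasure (count_space UNIV) (\<omega> \<inter> A) + emeasure (count_space UNIV) ({y} \<inter> A)"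
    using assms by (intro plus_emeasure[symmetric]) auto
  also have "(\<omega> \<inter> A) \<union> ({y} \<inter> A) = insert y \<omega> \<inter> A" by auto
  finally show ?thesis
    using num_points_singleton[of A y] by (simp add: num_points_def)
qed

lemma num_points_UN:
  assumes "finite I" "disjoint_family_on D I"
  shows "num_points (\<Union>i\<in>I. D i) \<omega> = (\<Sum>i\<in>I. num_points (D i) \<omega>)"
  using assms
proof (induction I rule: finite_induct)
  case (insert i I)
  have "D i \<inter> (\<Union>j\<in>I. D j) = {}"
    using insert.prems insert.hyps by (fastforce simp: disjoint_family_on_def)
  then have "num_points (D i \<union> (\<Union>j\<in>I. D j)) \<omega> =
      num_points (D i) \<omega> + num_points (\<Union>j\<in>I. D j) \<omega>"
    by (intro num_points_union) auto
  with insert show ?case by (auto simp: disjoint_family_on_def)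
qed simp

section \<open>Exchanging configurations inside a set\<close>

lemma configurations_subset: "\<omega> \<in> configurations X \<Longrightarrow> \<omega>' \<subseteq> \<omega> \<Longrightarrow> \<omega>' \<in> configurations X"
  unfolding configurations_def
  by (auto intro: finite_subset) (meson Int_mono finite_subset order_refl)

lemma configurations_union:
  assumes "\<omega> \<in> configurations X" "\<omega>' \<in> configurations X"
  shows "\<omega> \<union> \<omega>' \<in> configurations X"
  unfolding configurations_def
proof (safe)
  fix x assume "x \<in> X"
  obtain U where U: "open U" "x \<in> U" "finite (\<omega> \<inter> U)"
    using assms \<open>x \<in> X\<close> unfolding configurations_def by blast
  obtain V where V: "open V" "x \<in> V" "finite (\<omega>' \<inter> V)"
    using assms \<open>x \<in> X\<close> unfolding configurations_def by blast
  have "finite ((\<omega> \<union> \<omega>') \<inter> (U \<inter> V))"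
    by (rule finite_subset[of _ "(\<omega> \<inter> U) \<union> (\<omega>' \<inter> V)"]) (use U V in auto)
  with U V show "\<exists>U. open U \<and> x \<in> U \<and> finite ((\<omega> \<union> \<omega>') \<inter> U)"
    by (intro exI[of _ "U \<inter> V"]) auto
qed (use assms in \<open>auto simp: configurations_def\<close>)

lemma configurations_insert:
  fixes X :: "'a::topological_space set"
  assumes "\<omega> \<in> configurations X" "y \<in> X"
  shows "insert y \<omega> \<in> configurations X"
proof -
  have "{y} \<in> configurations X"
    using assms(2) unfolding configurations_def by (auto intro: exI[of _ UNIV])
  from configurations_union[OF this assms(1)] show ?thesis by simp
qed

text \<open>For independent arguments of law \<open>P\<close> this resamples the first configuration
  inside \<open>B\<close>. Applied in both directions it swaps two configurations on
  \<open>B\<close>, which is an involution on pairs.\<close>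

definition exchange :: "'a set \<Rightarrow> 'a set \<Rightarrow> 'a set \<Rightarrow> 'a set" where
  "exchange B \<omega> \<omega>' = (\<omega>' \<inter> B) \<union> (\<omega> - B)"

lemma exchange_in_configurations:
  "\<omega> \<in> configurations X \<Longrightarrow> \<omega>' \<in> configurations X \<Longrightarrow> exchange B \<omega> \<omega>' \<in> configurations X"
  unfolding exchange_def by (intro configurations_union) (auto elim: configurations_subset)

lemma num_points_exchange:
  "num_points A (exchange B \<omega> \<omega>') = num_points (A \<inter> B) \<omega>' + num_points (A - B) \<omega>"
proof -
  have "num_points A (exchange B \<omega> \<omega>') =
      num_points ((A \<inter> B) \<union> (A - B)) (exchange B \<omega> \<omega>')"
    by (rule arg_cong[where f = "\<lambda>A. num_points A _"]) auto
  also have "\<dots> = num_points (A \<inter> B) (exchange B \<omega> \<omega>') + num_points (A - B) (exchange B \<omega> \<omega>')"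
    by (rule num_points_union) auto
  also have "num_points (A \<inter> B) (exchange B \<omega> \<omega>') = num_points (A \<inter> B) \<omega>'"
    by (rule num_points_cong) (auto simp: exchange_def)
  also have "num_points (A - B) (exchange B \<omega> \<omega>') = num_points (A - B) \<omega>"
    by (rule num_points_cong) (auto simp: exchange_def)
  finally show ?thesis .
qed

lemma measurable_exchange:
  assumes "B \<in> sets M"
  shows "(\<lambda>(\<omega>, \<omega>'). exchange B \<omega> \<omega>') \<in>
    measurable (config_space M \<Otimes>\<^sub>M config_space M) (config_space M)"
proof (rule measurable_config_spaceI)
  fix A assume A: "A \<in> sets M"
  have [measurable]: "A \<inter> B \<in> sets M" "A - B \<in> sets M" using A assms by auto
  show "(\<lambda>x. num_points A (case x of (\<omega>, \<omega>') \<Rightarrow> exchange B \<omega> \<omega>'))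
      \<in> borel_measurable (config_space M \<Otimes>\<^sub>M config_space M)"
    by (simp add: case_prod_beta num_points_exchange)
qed (auto simp: space_pair_measure exchange_in_configurations)

text \<open>Emptying \<open>C\<close> first ensures that the inserted point is new, so that the
  count of every set changes by exactly the indicator at \<open>y\<close>.\<close>

lemma measurable_insert_config:
  assumes C: "C \<in> sets M"
  shows "(\<lambda>(y, \<omega>). insert y (\<omega> - C)) \<in>
    measurable (restrict_space M C \<Otimes>\<^sub>M config_space M) (config_space M)"
proof (rule measurable_config_spaceI)
  have CM: "C \<subseteq> space M" using sets.sets_into_space[OF C] .
  fix A assume A: "A \<in> sets M"
  have [measurable]: "A - C \<in> sets M" using A C by auto
  have "indicator A \<in> borel_measurable (restrict_space M C)"
    using A by (intro measurable_restrict_space1) simp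
  note [measurable] = measurable_compose[OF measurable_fst this]
  have *: "num_points A (insert y (\<omega> - C)) = num_points (A - C) \<omega> + indicator A y" if "y \<in> C" for y \<omega>
  proof -
    have "num_points A (\<omega> - C) = num_points (A - C) \<omega>"
      by (rule num_points_cong) auto
    with that show ?thesis by (subst num_points_insert) auto
  qed
  have "(\<lambda>x. num_points A (case x of (y, \<omega>) \<Rightarrow> insert y (\<omega> - C)))
      \<in> borel_measurable (restrict_space M C \<Otimes>\<^sub>M config_space M) \<longleftrightarrow>
     (\<lambda>x. num_points (A - C) (snd x) + indicator A (fst x))
      \<in> borel_measurable (restrict_space M C \<Otimes>\<^sub>M config_space M)"
    using CM by (intro measurable_cong) (auto simp: space_pair_measure space_restrict_space *)
  also have \<dots> by measurable
  finally show "(\<lambda>x. num_points A (case x of (y, \<omega>) \<Rightarrow> insert y (\<omega> - C)))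
      \<in> borel_measurable (restrict_space M C \<Otimes>\<^sub>M config_space M)" .
qed (use sets.sets_into_space[OF C] in \<open>auto simp: space_pair_measure space_restrict_space
      intro!: configurations_insert elim: configurations_subset\<close>)

lemma measurable_exchange' [measurable (raw)]:
  assumes "f \<in> measurable N (config_space M)" "g \<in> measurable N (config_space M)" "B \<in> sets M"
  shows "(\<lambda>x. exchange B (f x) (g x)) \<in> measurable N (config_space M)"
  using measurable_compose[OF measurable_Pair[OF assms(1,2)] measurable_exchange[OF assms(3)]]
  by simp

text \<open>Events about one count are not stable under intersection. Constraints on finitely many
  counts are, as the uniqueness theorem for measures requires.\<close>

lemma sets_config_space_finite_counts:
  "sets (config_space M) = sigma_sets (configurations (space M))
     {{\<omega> \<in> configurations (space M). \<forall>A\<in>\<A>. num_points A \<omega> \<in> R A} | \<A> R.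
        finite \<A> \<and> \<A> \<subseteq> sets M \<and> (\<forall>A\<in>\<A>. R A \<in> sets borel)}"
  (is "_ = sigma_sets ?\<Omega> ?G")
proof (rule antisym)
  show "sets (config_space M) \<subseteq> sigma_sets ?\<Omega> ?G"
    unfolding sets_config_space
  proof (rule sigma_sets_mono')
    show "{{\<omega> \<in> ?\<Omega>. num_points A \<omega> \<in> B} | A B. A \<in> sets M \<and> B \<in> sets borel} \<subseteq> ?G"
    proof safe
      fix A :: "'a set" and B :: "ennreal set" assume "A \<in> sets M" "B \<in> sets borel"
      then show "\<exists>\<A> R. {\<omega> \<in> ?\<Omega>. num_points A \<omega> \<in> B} =
          {\<omega> \<in> ?\<Omega>. \<forall>A\<in>\<A>. num_points A \<omega> \<in> R A} \<and>
          finite \<A> \<and> \<A> \<subseteq> sets M \<and> (\<forall>A\<in>\<A>. R A \<in> sets borel)"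
        by (intro exI[of _ "{A}"] exI[of _ "\<lambda>_. B"]) auto
    qed
  qed
  show "sigma_sets ?\<Omega> ?G \<subseteq> sets (config_space M)"
  proof -
    have "sigma_sets (space (config_space M)) ?G \<subseteq> sets (config_space M)"
    proof (rule sets.sigma_sets_subset, safe)
      fix \<A> :: "'a set set" and R :: "'a set \<Rightarrow> ennreal set"
      assume A: "finite \<A>" "\<A> \<subseteq> sets M" "\<forall>A\<in>\<A>. R A \<in> sets borel"
      have "{\<omega> \<in> space (config_space M). \<forall>A\<in>\<A>. num_points A \<omega> \<in> R A} \<in> sets (config_space M)"
        using A by (intro sets.sets_Collect_finite_All predE pred_sets2[OF _ measurable_num_points]) auto
      then show "{\<omega> \<in> configurations (space M). \<forall>A\<in>\<A>. num_points A \<omega> \<in> R A} \<in> sets (config_space M)"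
        by simp
    qed
    then show ?thesis by simp
  qed
qed

lemma AE_pair_fst:
  assumes "AE x in M1. Q x" "sigma_finite_measure M2"
  shows "AE p in M1 \<Otimes>\<^sub>M M2. Q (fst p)"
proof -
  interpret M2: sigma_finite_measure M2 by fact
  from assms(1) obtain N where N: "{x \<in> space M1. \<not> Q x} \<subseteq> N" "emeasure M1 N = 0" "N \<in> sets M1"
    by (rule AE_E)
  show ?thesis
  proof (rule AE_I)
    show "{p \<in> space (M1 \<Otimes>\<^sub>M M2). \<not> Q (fst p)} \<subseteq> N \<times> space M2"
      using N by (auto simp: space_pair_measure)
    show "emeasure (M1 \<Otimes>\<^sub>M M2) (N \<times> space M2) = 0"
      using N by (simp add: M2.emeasure_pair_measure_Times)
  qed (use N in auto)
qed

lemma AE_pair_snd: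
  assumes "AE x in M2. Q x" "sigma_finite_measure M2"
  shows "AE p in M1 \<Otimes>\<^sub>M M2. Q (snd p)"
proof -
  interpret M2: sigma_finite_measure M2 by fact
  from assms(1) obtain N where N: "{x \<in> space M2. \<not> Q x} \<subseteq> N" "emeasure M2 N = 0" "N \<in> sets M2"
    by (rule AE_E)
  show ?thesis
  proof (rule AE_I)
    show "{p \<in> space (M1 \<Otimes>\<^sub>M M2). \<not> Q (snd p)} \<subseteq> space M1 \<times> N"
      using N by (auto simp: space_pair_measure)
    show "emeasure (M1 \<Otimes>\<^sub>M M2) (space M1 \<times> N) = 0"
      using N by (simp add: M2.emeasure_pair_measure_Times)
  qed (use N in auto)
qed

section \<open>Poisson processes\<close>

text \<open>\<open>poisson_measure\<close> prescribes only the counts of sets of finite measure,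
  whereas the \<sigma>-algebra is generated by all counts. The assumption
  \<open>infinite_count\<close> fixes the remaining ones; for Radon intensities it is derived from
  inner regularity.\<close>

locale poisson_process = prob_space P
  for P :: "'a::topological_space set measure" +
  fixes M :: "'a measure"
  assumes poisson: "poisson_measure M P"
    and infinite_count: "\<And>A. A \<in> sets M \<Longrightarrow> emeasure M A = \<infinity> \<Longrightarrow> AE \<omega> in P. num_points A \<omega> = \<infinity>"
begin

lemma sets_P [measurable_cong]: "sets P = sets (config_space M)"
  using poisson by (simp add: poisson_measure_def)

lemma space_P: "space P = configurations (space M)"
  using sets_eq_imp_space_eq[OF sets_P] by simp

sublocale PP: pair_prob_space P P ..

lemma count_distribution:
  assumes "A \<in> sets M" "emeasure M A < \<infinity>"
  shows "prob {\<omega> \<in> space P. num_points A \<omega> = of_nat k} =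
    measure M A ^ k / fact k * exp (- measure M A)"
  using poisson assms by (simp add: poisson_measure_def)

lemma indep_counts:
  assumes "finite \<A>" "disjoint \<A>" "\<And>A. A \<in> \<A> \<Longrightarrow> A \<in> sets M" "\<And>A. A \<in> \<A> \<Longrightarrow> emeasure M A < \<infinity>"
  shows "indep_vars (\<lambda>_. borel) num_points \<A>"
proof -
  have "\<A> \<subseteq> {A \<in> sets M. emeasure M A < \<infinity>}" using assms(3,4) by auto
  with assms(1,2) show ?thesis using poisson unfolding poisson_measure_def by blast
qed

text \<open>The sets may overlap, so they are cut into atoms, and each atom is cut by
  \<open>B\<close>. The vectors of counts inside and outside of \<open>B\<close> are then
  independent: reading both off one configuration gives the same joint law as reading them off two
  independent ones.\<close>

lemma emeasure_counts_exchange_finite: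
  assumes \<A>: "finite \<A>" "\<And>A. A \<in> \<A> \<Longrightarrow> A \<in> sets M" "\<And>A. A \<in> \<A> \<Longrightarrow> emeasure M A < \<infinity>"
    and R: "\<And>A. A \<in> \<A> \<Longrightarrow> R A \<in> sets borel"
    and B: "B \<in> sets M"
  shows "emeasure (P \<Otimes>\<^sub>M P) {p \<in> space (P \<Otimes>\<^sub>M P).
      \<forall>A\<in>\<A>. num_points (A \<inter> B) (snd p) + num_points (A - B) (fst p) \<in> R A} =
    emeasure P {\<omega> \<in> space P. \<forall>A\<in>\<A>. num_points A \<omega> \<in> R A}"
proof -
  \<comment> \<open>The atom \<open>D s\<close> consists of the points lying in exactly the members
    of \<open>s\<close>. The empty \<open>s\<close> is excluded from \<open>S\<close> because the
    points outside of all members may have infinite measure.\<close>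
  define D where "D s = {x \<in> space M. {A \<in> \<A>. x \<in> A} = s}" for s
  define S where "S = Pow \<A> - {{}}"
  have D_sets: "D s \<in> sets M" if "s \<in> S" for s
  proof -
    have "D s = {x \<in> space M. \<forall>A\<in>\<A>. x \<in> A \<longleftrightarrow> A \<in> s}"
      using that unfolding D_def S_def by auto
    also have "\<dots> \<in> sets M"
    proof (rule sets.sets_Collect_finite_All[OF _ \<A>(1)])
      fix A assume "A \<in> \<A>"
      show "{x \<in> space M. (x \<in> A) = (A \<in> s)} \<in> sets M"
      proof (cases "A \<in> s")
        case True
        have "{x \<in> space M. (x \<in> A) = (A \<in> s)} = A"
          using True sets.sets_into_space[OF \<A>(2)[OF \<open>A \<in> \<A>\<close>]] by auto
        then show ?thesis using \<A>(2)[OF \<open>A \<in> \<A>\<close>] by simp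
      next
        case False
        then have "{x \<in> space M. (x \<in> A) = (A \<in> s)} = space M - A" by auto
        then show ?thesis using \<A>(2)[OF \<open>A \<in> \<A>\<close>] by auto
      qed
    qed
    finally show ?thesis .
  qed
  have D_fin: "emeasure M (D s \<inter> C) < \<infinity>" if s: "s \<in> S" for s C
  proof -
    obtain A where A: "A \<in> s" "A \<in> \<A>" using s unfolding S_def by blast
    then have "D s \<inter> C \<subseteq> A" unfolding D_def by auto
    then have "emeasure M (D s \<inter> C) \<le> emeasure M A" by (rule emeasure_mono[OF _ \<A>(2)[OF A(2)]])
    with \<A>(3)[OF A(2)] show ?thesis by (rule_tac le_less_trans) auto
  qed
  have finS: "finite S" using \<A>(1) by (simp add: S_def)
  \<comment> \<open>The empty set could arise on both sides of \<open>B\<close>; removing it makes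
    \<open>I\<close> and \<open>O'\<close> disjoint index sets.\<close>
  define I where "I = (\<lambda>s. D s \<inter> B) ` S - {{}}"
  define O' where "O' = (\<lambda>s. D s - B) ` S - {{}}"
  have fin: "finite I" "finite O'" using finS by (auto simp: I_def O'_def)
  have disj: "disjoint (I \<union> O')"
    unfolding disjoint_def I_def O'_def D_def by (auto; blast)
  have IO: "I \<inter> O' = {}" by (auto simp: I_def O'_def)
  have D_diff: "D s - B = D s \<inter> (space M - B)" for s by (auto simp: D_def)
  have meas: "E \<in> sets M \<and> emeasure M E < \<infinity>" if "E \<in> I \<union> O'" for E
    using that D_sets B D_fin unfolding I_def O'_def D_diff by auto
  have indep: "indep_vars (\<lambda>_. borel) num_points (I \<union> O')"
    using fin disj meas by (intro indep_counts) auto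
  have inside: "num_points (A \<inter> B) \<omega> = (\<Sum>E\<in>{E \<in> I. E \<subseteq> A}. num_points E \<omega>)" if "A \<in> \<A>" for A \<omega>
  proof -
    have "A \<inter> B = (\<Union>E\<in>{E \<in> I. E \<subseteq> A}. E)"
    proof safe
      fix x assume x: "x \<in> A" "x \<in> B"
      let ?s = "{A \<in> \<A>. x \<in> A}"
      have "x \<in> space M" using x \<A>(2)[OF that] sets.sets_into_space by blast
      then have "x \<in> D ?s \<inter> B" using x by (auto simp: D_def)
      moreover have "D ?s \<subseteq> A" "?s \<in> S" using that x by (auto simp: D_def S_def)
      ultimately show "x \<in> (\<Union>E\<in>{E \<in> I. E \<subseteq> A}. E)" unfolding I_def by blast
    qed (auto simp: I_def)
    then have "num_points (A \<inter> B) \<omega> = num_points (\<Union>E\<in>{E \<in> I. E \<subseteq> A}. E) \<omega>" by simp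
    also have "\<dots> = (\<Sum>E\<in>{E \<in> I. E \<subseteq> A}. num_points E \<omega>)"
      using fin disj by (intro num_points_UN) (auto simp: disjoint_family_on_def disjoint_def)
    finally show ?thesis .
  qed
  have outside: "num_points (A - B) \<omega> = (\<Sum>E\<in>{E \<in> O'. E \<subseteq> A}. num_points E \<omega>)" if "A \<in> \<A>" for A \<omega>
  proof -
    have "A - B = (\<Union>E\<in>{E \<in> O'. E \<subseteq> A}. E)"
    proof safe
      fix x assume x: "x \<in> A" "x \<notin> B"
      let ?s = "{A \<in> \<A>. x \<in> A}"
      have "x \<in> space M" using x \<A>(2)[OF that] sets.sets_into_space by blast
      then have "x \<in> D ?s - B" using x by (auto simp: D_def)
      moreover have "D ?s \<subseteq> A" "?s \<in> S" using that x by (auto simp: D_def S_def)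
      ultimately show "x \<in> (\<Union>E\<in>{E \<in> O'. E \<subseteq> A}. E)" unfolding O'_def by blast
    qed (auto simp: O'_def)
    then have "num_points (A - B) \<omega> = num_points (\<Union>E\<in>{E \<in> O'. E \<subseteq> A}. E) \<omega>" by simp
    also have "\<dots> = (\<Sum>E\<in>{E \<in> O'. E \<subseteq> A}. num_points E \<omega>)"
      using fin disj by (intro num_points_UN) (auto simp: disjoint_family_on_def disjoint_def)
    finally show ?thesis .
  qed
  define V1 where "V1 \<omega> = restrict (\<lambda>E. num_points E \<omega>) O'" for \<omega> :: "'a set"
  define V2 where "V2 \<omega> = restrict (\<lambda>E. num_points E \<omega>) I" for \<omega> :: "'a set"
  let ?N1 = "PiM O' (\<lambda>_. borel) :: ('a set \<Rightarrow> ennreal) measure"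
  let ?N2 = "PiM I (\<lambda>_. borel) :: ('a set \<Rightarrow> ennreal) measure"
  have iv: "indep_var ?N1 V1 ?N2 V2"
    unfolding V1_def V2_def by (rule indep_var_restrict[OF indep]) (use IO in auto)
  then have V1[measurable]: "V1 \<in> measurable P ?N1" and V2[measurable]: "V2 \<in> measurable P ?N2"
    by (auto dest: indep_var_rv1 indep_var_rv2)
  define W where "W = {q \<in> space (?N1 \<Otimes>\<^sub>M ?N2).
    \<forall>A\<in>\<A>. (\<Sum>E\<in>{E \<in> I. E \<subseteq> A}. snd q E) + (\<Sum>E\<in>{E \<in> O'. E \<subseteq> A}. fst q E) \<in> R A}"
  have W: "W \<in> sets (?N1 \<Otimes>\<^sub>M ?N2)"
    unfolding W_def
  proof (rule sets.sets_Collect_finite_All[OF _ \<A>(1)])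
    fix A assume A: "A \<in> \<A>"
    have "(\<lambda>q. (\<Sum>E\<in>{E \<in> I. E \<subseteq> A}. snd q E) + (\<Sum>E\<in>{E \<in> O'. E \<subseteq> A}. fst q E))
      \<in> borel_measurable (?N1 \<Otimes>\<^sub>M ?N2)"
      by measurable
    from measurable_sets[OF this R[OF A]]
    show "{q \<in> space (?N1 \<Otimes>\<^sub>M ?N2). (\<Sum>E\<in>{E \<in> I. E \<subseteq> A}. snd q E) +
        (\<Sum>E\<in>{E \<in> O'. E \<subseteq> A}. fst q E) \<in> R A} \<in> sets (?N1 \<Otimes>\<^sub>M ?N2)"
      by (simp add: vimage_def Int_def conj_commute)
  qed
  have V_space: "V1 \<omega> \<in> space ?N1" "V2 \<omega> \<in> space ?N2" for \<omega>
    by (auto simp: V1_def V2_def space_PiM)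
  have "prob_space (distr P ?N2 V2)" by (rule prob_space_distr) simp
  then interpret N2: prob_space "distr P ?N2 V2" .
  \<comment> \<open>The whole exchange property is contained here: two independent configurations on
    the left, a single one on the right.\<close>
  have eq: "distr (P \<Otimes>\<^sub>M P) (?N1 \<Otimes>\<^sub>M ?N2) (\<lambda>(x, y). (V1 x, V2 y)) =
      distr P (?N1 \<Otimes>\<^sub>M ?N2) (\<lambda>x. (V1 x, V2 x))"
    using iv pair_measure_distr[OF V1 V2 N2.sigma_finite_measure_axioms]
    by (simp add: indep_var_distribution_eq)
  have V_sum: "(\<Sum>E\<in>{E \<in> O'. E \<subseteq> A}. V1 \<omega> E) = (\<Sum>E\<in>{E \<in> O'. E \<subseteq> A}. num_points E \<omega>)"
      "(\<Sum>E\<in>{E \<in> I. E \<subseteq> A}. V2 \<omega> E) = (\<Sum>E\<in>{E \<in> I. E \<subseteq> A}. num_points E \<omega>)" for \<omega> A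
    by (auto simp: V1_def V2_def intro!: sum.cong)
  have "emeasure (P \<Otimes>\<^sub>M P) ((\<lambda>(x, y). (V1 x, V2 y)) -` W \<inter> space (P \<Otimes>\<^sub>M P)) =
      emeasure P ((\<lambda>x. (V1 x, V2 x)) -` W \<inter> space P)"
    using arg_cong[OF eq, where f = "\<lambda>N. emeasure N W"] W by (simp add: emeasure_distr)
  also have "(\<lambda>(x, y). (V1 x, V2 y)) -` W \<inter> space (P \<Otimes>\<^sub>M P) = {p \<in> space (P \<Otimes>\<^sub>M P).
      \<forall>A\<in>\<A>. num_points (A \<inter> B) (snd p) + num_points (A - B) (fst p) \<in> R A}"
    using V_space
    by (auto simp: W_def inside outside V_sum space_pair_measure)
  also have "(\<lambda>x. (V1 x, V2 x)) -` W \<inter> space P =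
      {\<omega> \<in> space P. \<forall>A\<in>\<A>. num_points (A \<inter> B) \<omega> + num_points (A - B) \<omega> \<in> R A}"
    using V_space
    by (auto simp: W_def inside outside V_sum space_pair_measure)
  also have "\<dots> = {\<omega> \<in> space P. \<forall>A\<in>\<A>. num_points A \<omega> \<in> R A}"
  proof -
    have "num_points (A \<inter> B) \<omega> + num_points (A - B) \<omega> = num_points A \<omega>" for A \<omega>
      by (subst num_points_union[symmetric]) (auto simp: Int_Diff_Un)
    then show ?thesis by simp
  qed
  finally show ?thesis .
qed

text \<open>A set of infinite measure has a part of infinite measure inside or outside of
  \<open>B\<close>, so its count is almost surely infinite before and after the exchange. It matters
  only whether its range \<open>R A\<close> contains \<infinity>; if one of them does not, both
  probabilities vanish.\<close>

lemma emeasure_counts_exchange: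
  assumes \<A>: "finite \<A>" "\<A> \<subseteq> sets M"
    and R: "\<And>A. A \<in> \<A> \<Longrightarrow> R A \<in> sets borel"
    and B: "B \<in> sets M"
  shows "emeasure (P \<Otimes>\<^sub>M P) {p \<in> space (P \<Otimes>\<^sub>M P).
      \<forall>A\<in>\<A>. num_points (A \<inter> B) (snd p) + num_points (A - B) (fst p) \<in> R A} =
    emeasure P {\<omega> \<in> space P. \<forall>A\<in>\<A>. num_points A \<omega> \<in> R A}"
proof -
  define \<F> where "\<F> = {A \<in> \<A>. emeasure M A < \<infinity>}"
  define \<I> where "\<I> = {A \<in> \<A>. emeasure M A = \<infinity>}"
  have split: "(\<forall>A\<in>\<A>. Q A) \<longleftrightarrow> (\<forall>A\<in>\<F>. Q A) \<and> (\<forall>A\<in>\<I>. Q A)" for Q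
    unfolding \<F>_def \<I>_def by (metis (mono_tags, lifting) infinity_ennreal_def less_top mem_Collect_eq)
  have fin: "finite \<F>" "finite \<I>" using \<A> by (auto simp: \<F>_def \<I>_def)
  have AE1: "AE p in P \<Otimes>\<^sub>M P. \<forall>A\<in>\<I>. num_points (A \<inter> B) (snd p) + num_points (A - B) (fst p) = \<infinity>"
  proof (rule AE_finite_allI[OF fin(2)])
    fix A assume "A \<in> \<I>"
    then have A: "A \<in> sets M" "emeasure M A = \<infinity>" using \<A> by (auto simp: \<I>_def)
    have "emeasure M A = emeasure M (A \<inter> B) + emeasure M (A - B)"
      using A(1) B by (subst plus_emeasure) (auto simp: Int_Diff_Un)
    with A(2) consider "emeasure M (A \<inter> B) = \<infinity>" | "emeasure M (A - B) = \<infinity>"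
      by (auto simp: ennreal_add_eq_top)
    then show "AE p in P \<Otimes>\<^sub>M P. num_points (A \<inter> B) (snd p) + num_points (A - B) (fst p) = \<infinity>"
    proof cases
      case 1
      have "AE p in P \<Otimes>\<^sub>M P. num_points (A \<inter> B) (snd p) = \<infinity>"
        using 1 A B by (intro AE_pair_snd infinite_count sigma_finite_measure_axioms) auto
      then show ?thesis by eventually_elim simp
    next
      case 2
      have "AE p in P \<Otimes>\<^sub>M P. num_points (A - B) (fst p) = \<infinity>"
        using 2 A B by (intro AE_pair_fst infinite_count sigma_finite_measure_axioms) auto
      then show ?thesis by eventually_elim simp
    qed
  qed
  have AE2: "AE \<omega> in P. \<forall>A\<in>\<I>. num_points A \<omega> = \<infinity>"
    using \<A> by (intro AE_finite_allI[OF fin(2)] infinite_count) (auto simp: \<I>_def)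
  have meas1: "{p \<in> space (P \<Otimes>\<^sub>M P).
      \<forall>A\<in>\<A>'. num_points (A \<inter> B) (snd p) + num_points (A - B) (fst p) \<in> R A} \<in> sets (P \<Otimes>\<^sub>M P)"
    if "\<A>' \<subseteq> \<A>" for \<A>'
  proof (rule sets.sets_Collect_finite_All)
    fix A assume "A \<in> \<A>'"
    then have [measurable]: "A \<inter> B \<in> sets M" "A - B \<in> sets M" "R A \<in> sets borel"
      using that \<A> B R by auto
    show "{p \<in> space (P \<Otimes>\<^sub>M P). num_points (A \<inter> B) (snd p) + num_points (A - B) (fst p) \<in> R A}
        \<in> sets (P \<Otimes>\<^sub>M P)" by measurable
  qed (use that \<A> finite_subset in auto)
  have meas2: "{\<omega> \<in> space P. \<forall>A\<in>\<A>'. num_points A \<omega> \<in> R A} \<in> sets P" if "\<A>' \<subseteq> \<A>" for \<A>'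
  proof (rule sets.sets_Collect_finite_All)
    fix A assume "A \<in> \<A>'"
    then have [measurable]: "A \<in> sets M" "R A \<in> sets borel" using that \<A> R by auto
    show "{\<omega> \<in> space P. num_points A \<omega> \<in> R A} \<in> sets P" by measurable
  qed (use that \<A> finite_subset in auto)
  have sub: "\<F> \<subseteq> \<A>" by (auto simp: \<F>_def)
  define cnt where "cnt A p = num_points (A \<inter> B) (snd p) + num_points (A - B) (fst p)"
    for A and p :: "'a set \<times> 'a set"
  note AE1 = AE1[folded cnt_def] and meas1 = meas1[folded cnt_def]
  have "emeasure (P \<Otimes>\<^sub>M P) {p \<in> space (P \<Otimes>\<^sub>M P). \<forall>A\<in>\<A>. cnt A p \<in> R A} =
    emeasure P {\<omega> \<in> space P. \<forall>A\<in>\<A>. num_points A \<omega> \<in> R A}"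
  proof (cases "\<forall>A\<in>\<I>. \<infinity> \<in> R A")
    case True
    have "AE p in P \<Otimes>\<^sub>M P. (\<forall>A\<in>\<A>. cnt A p \<in> R A) \<longleftrightarrow> (\<forall>A\<in>\<F>. cnt A p \<in> R A)"
      using AE1 by eventually_elim (unfold split, use True in metis)
    then have "emeasure (P \<Otimes>\<^sub>M P) {p \<in> space (P \<Otimes>\<^sub>M P). \<forall>A\<in>\<A>. cnt A p \<in> R A} =
      emeasure (P \<Otimes>\<^sub>M P) {p \<in> space (P \<Otimes>\<^sub>M P). \<forall>A\<in>\<F>. cnt A p \<in> R A}"
      by (intro emeasure_eq_AE meas1 sub order_refl) auto
    also have "\<dots> = emeasure P {\<omega> \<in> space P. \<forall>A\<in>\<F>. num_points A \<omega> \<in> R A}"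
      unfolding cnt_def
      using fin \<A> R B by (intro emeasure_counts_exchange_finite) (auto simp: \<F>_def)
    also have "\<dots> = emeasure P {\<omega> \<in> space P. \<forall>A\<in>\<A>. num_points A \<omega> \<in> R A}"
    proof -
      have "AE \<omega> in P. (\<forall>A\<in>\<A>. num_points A \<omega> \<in> R A) \<longleftrightarrow> (\<forall>A\<in>\<F>. num_points A \<omega> \<in> R A)"
      using AE2 by eventually_elim (unfold split, use True in metis)
      then show ?thesis by (intro emeasure_eq_AE meas2 sub order_refl) auto
    qed
    finally show ?thesis .
  next
    case False
    have "AE p in P \<Otimes>\<^sub>M P. \<not> (\<forall>A\<in>\<A>. cnt A p \<in> R A)"
      using AE1 by eventually_elim (unfold split, use False in metis)
    then have "emeasure (P \<Otimes>\<^sub>M P) {p \<in> space (P \<Otimes>\<^sub>M P). \<forall>A\<in>\<A>. cnt A p \<in> R A} =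
      emeasure (P \<Otimes>\<^sub>M P) {}"
      by (intro emeasure_eq_AE meas1 order_refl) auto
    moreover have "AE \<omega> in P. \<not> (\<forall>A\<in>\<A>. num_points A \<omega> \<in> R A)"
      using AE2 by eventually_elim (unfold split, use False in metis)
    then have "emeasure P {\<omega> \<in> space P. \<forall>A\<in>\<A>. num_points A \<omega> \<in> R A} = emeasure P {}"
      by (intro emeasure_eq_AE meas2 order_refl) auto
    ultimately show ?thesis by simp
  qed
  then show ?thesis by (simp add: cnt_def)
qed

lemma distr_exchange:
  assumes B: "B \<in> sets M"
  shows "distr (P \<Otimes>\<^sub>M P) P (\<lambda>p. exchange B (fst p) (snd p)) = P" (is "?Q = P")
proof (rule measure_eqI_generator_eq[where \<Omega> = "configurations (space M)" and A = "\<lambda>_. configurations (space M)"])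
  let ?G = "{{\<omega> \<in> configurations (space M). \<forall>A\<in>\<A>. num_points A \<omega> \<in> R A} | \<A> R.
        finite \<A> \<and> \<A> \<subseteq> sets M \<and> (\<forall>A\<in>\<A>. R A \<in> sets borel)}"
  show "Int_stable ?G"
  proof (rule Int_stableI)
    fix S T assume "S \<in> ?G" "T \<in> ?G"
    then obtain \<A> R \<A>' R' where S: "S = {\<omega> \<in> configurations (space M). \<forall>A\<in>\<A>. num_points A \<omega> \<in> R A}"
      and T: "T = {\<omega> \<in> configurations (space M). \<forall>A\<in>\<A>'. num_points A \<omega> \<in> R' A}"
      and *: "finite \<A>" "\<A> \<subseteq> sets M" "\<forall>A\<in>\<A>. R A \<in> sets borel"
        "finite \<A>'" "\<A>' \<subseteq> sets M" "\<forall>A\<in>\<A>'. R' A \<in> sets borel" by blast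
    define Q where "Q A = (if A \<in> \<A> then R A else UNIV) \<inter> (if A \<in> \<A>' then R' A else UNIV)" for A
    have "S \<inter> T = {\<omega> \<in> configurations (space M). \<forall>A\<in>\<A> \<union> \<A>'. num_points A \<omega> \<in> Q A}"
      unfolding S T Q_def by auto
    moreover have "\<forall>A\<in>\<A> \<union> \<A>'. Q A \<in> sets borel" using * by (auto simp: Q_def)
    ultimately show "S \<inter> T \<in> ?G" using *
      by (intro CollectI exI[of _ "\<A> \<union> \<A>'"] exI[of _ Q]) auto
  qed
  show "?G \<subseteq> Pow (configurations (space M))" by auto
  show "range (\<lambda>_. configurations (space M)) \<subseteq> ?G"
    by (auto intro!: exI[of _ "{}"])
  show "sets P = sigma_sets (configurations (space M)) ?G" "sets ?Q = sigma_sets (configurations (space M)) ?G"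
    by (simp_all add: sets_P sets_config_space_finite_counts)
  have meas: "(\<lambda>p. exchange B (fst p) (snd p)) \<in> measurable (P \<Otimes>\<^sub>M P) P"
    using B by measurable
  show "emeasure ?Q (configurations (space M)) \<noteq> \<infinity>"
    using emeasure_space_1 meas
    by (subst emeasure_distr) (auto simp: space_P[symmetric])
  fix X assume "X \<in> ?G"
  then obtain \<A> R where X: "X = {\<omega> \<in> configurations (space M). \<forall>A\<in>\<A>. num_points A \<omega> \<in> R A}"
      and *: "finite \<A>" "\<A> \<subseteq> sets M" "\<forall>A\<in>\<A>. R A \<in> sets borel" by blast
  have "X \<in> sets P" using \<open>X \<in> ?G\<close> unfolding sets_P sets_config_space_finite_counts
    by (rule sigma_sets.Basic)
  then have "emeasure ?Q X = emeasure (P \<Otimes>\<^sub>M P) ((\<lambda>p. exchange B (fst p) (snd p)) -` X \<inter> space (P \<Otimes>\<^sub>M P))"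
    by (rule emeasure_distr[OF meas])
  also have "(\<lambda>p. exchange B (fst p) (snd p)) -` X \<inter> space (P \<Otimes>\<^sub>M P) = {p \<in> space (P \<Otimes>\<^sub>M P).
      \<forall>A\<in>\<A>. num_points (A \<inter> B) (snd p) + num_points (A - B) (fst p) \<in> R A}"
    by (auto simp: X space_pair_measure space_P num_points_exchange exchange_in_configurations)
  also have "emeasure (P \<Otimes>\<^sub>M P) \<dots> = emeasure P X"
    using * B by (subst emeasure_counts_exchange) (auto simp: X space_P)
  finally show "emeasure ?Q X = emeasure P X" .
qed auto

lemma nn_integral_exchange:
  assumes f [measurable]: "f \<in> borel_measurable P" and B [measurable]: "B \<in> sets M"
  shows "(\<integral>\<^sup>+\<omega>. \<integral>\<^sup>+\<omega>'. f (exchange B \<omega> \<omega>') \<partial>P \<partial>P) = (\<integral>\<^sup>+\<omega>. f \<omega> \<partial>P)"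
proof -
  have "(\<integral>\<^sup>+\<omega>. f \<omega> \<partial>P) = (\<integral>\<^sup>+\<omega>. f \<omega> \<partial>distr (P \<Otimes>\<^sub>M P) P (\<lambda>p. exchange B (fst p) (snd p)))"
    by (simp add: distr_exchange)
  also have "\<dots> = (\<integral>\<^sup>+p. f (exchange B (fst p) (snd p)) \<partial>(P \<Otimes>\<^sub>M P))"
    by (rule nn_integral_distr) measurable
  also have "\<dots> = (\<integral>\<^sup>+\<omega>. \<integral>\<^sup>+\<omega>'. f (exchange B \<omega> \<omega>') \<partial>P \<partial>P)"
    by (subst nn_integral_fst[symmetric]) simp_all
  finally show ?thesis ..
qed

lemma exchange_exchange_cross:
  "exchange B (exchange B a b) (exchange B c d) = exchange B a d"
  by (auto simp: exchange_def)

text \<open>Each of the two configurations may itself be replaced by an exchange of two fresh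
  copies, \<open>a\<close>, \<open>b\<close> and \<open>c\<close>, \<open>d\<close>. By
  \<open>exchange_exchange_cross\<close> the first result then involves only \<open>a\<close> and
  \<open>d\<close>, the second only \<open>c\<close> and \<open>b\<close>, and the integral
  factorizes.\<close>

lemma distr_exchange_pair:
  assumes B [measurable]: "B \<in> sets M"
  shows "distr (P \<Otimes>\<^sub>M P) (P \<Otimes>\<^sub>M P) (\<lambda>p. (exchange B (fst p) (snd p), exchange B (snd p) (fst p))) =
    P \<Otimes>\<^sub>M P"
proof (rule pair_measure_eqI[symmetric])
  fix U V assume UV [measurable]: "U \<in> sets P" "V \<in> sets P"
  have meas: "(\<lambda>p. (exchange B (fst p) (snd p), exchange B (snd p) (fst p)))
      \<in> measurable (P \<Otimes>\<^sub>M P) (P \<Otimes>\<^sub>M P)" by measurable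
  define u where "u \<omega> = (indicator U \<omega> :: ennreal)" for \<omega>
  define v where "v \<omega> = (indicator V \<omega> :: ennreal)" for \<omega>
  have uv: "u = indicator U" "v = indicator V" by (auto simp: u_def v_def)
  have [measurable]: "u \<in> borel_measurable P" "v \<in> borel_measurable P"
    unfolding u_def v_def by measurable
  have uE: "(\<lambda>d. u (exchange B z d)) \<in> borel_measurable P" if "z \<in> space P" for z
  proof -
    have "(\<lambda>p. u (exchange B (fst p) (snd p))) \<in> borel_measurable (P \<Otimes>\<^sub>M P)" by measurable
    from measurable_compose[OF measurable_Pair1'[OF that] this] show ?thesis by simp
  qed
  have vE: "(\<lambda>c. v (exchange B c z)) \<in> borel_measurable P" if "z \<in> space P" for z
  proof -
    have "(\<lambda>p. v (exchange B (snd p) (fst p))) \<in> borel_measurable (P \<Otimes>\<^sub>M P)" by measurable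
    from measurable_compose[OF measurable_Pair1'[OF that] this] show ?thesis by simp
  qed
  have "emeasure (distr (P \<Otimes>\<^sub>M P) (P \<Otimes>\<^sub>M P)
      (\<lambda>p. (exchange B (fst p) (snd p), exchange B (snd p) (fst p)))) (U \<times> V) =
      (\<integral>\<^sup>+p. indicator (U \<times> V) (exchange B (fst p) (snd p), exchange B (snd p) (fst p)) \<partial>(P \<Otimes>\<^sub>M P))"
    by (subst nn_integral_indicator[symmetric], simp, subst nn_integral_distr[OF meas]) auto
  also have "\<dots> = (\<integral>\<^sup>+\<omega>. \<integral>\<^sup>+\<omega>'. u (exchange B \<omega> \<omega>') * v (exchange B \<omega>' \<omega>) \<partial>P \<partial>P)"
    by (subst nn_integral_fst[symmetric]) (simp_all add: indicator_times u_def v_def)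
  also have "\<dots> = (\<integral>\<^sup>+a. \<integral>\<^sup>+b. \<integral>\<^sup>+\<omega>'. u (exchange B (exchange B a b) \<omega>') * v (exchange B \<omega>' (exchange B a b)) \<partial>P \<partial>P \<partial>P)"
    by (rule nn_integral_exchange[symmetric]) measurable
  also have "\<dots> = (\<integral>\<^sup>+a. \<integral>\<^sup>+b. \<integral>\<^sup>+c. \<integral>\<^sup>+d. u (exchange B (exchange B a b) (exchange B c d)) *
      v (exchange B (exchange B c d) (exchange B a b)) \<partial>P \<partial>P \<partial>P \<partial>P)"
  proof (rule nn_integral_cong, rule nn_integral_cong)
    fix a b assume "a \<in> space P" "b \<in> space P"
    define z where "z = exchange B a b"
    with \<open>a \<in> space P\<close> \<open>b \<in> space P\<close> have z: "z \<in> space P"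
      by (simp add: space_P exchange_in_configurations)
    have "(\<lambda>p. u (exchange B (fst p) (snd p)) * v (exchange B (snd p) (fst p))) \<in> borel_measurable (P \<Otimes>\<^sub>M P)"
      by measurable
    from measurable_compose[OF measurable_Pair1'[OF z] this]
    have "(\<lambda>\<omega>'. u (exchange B z \<omega>') * v (exchange B \<omega>' z)) \<in> borel_measurable P" by simp
    from nn_integral_exchange[OF this B]
    show "(\<integral>\<^sup>+\<omega>'. u (exchange B (exchange B a b) \<omega>') * v (exchange B \<omega>' (exchange B a b)) \<partial>P) =
      (\<integral>\<^sup>+c. \<integral>\<^sup>+d. u (exchange B (exchange B a b) (exchange B c d)) *
        v (exchange B (exchange B c d) (exchange B a b)) \<partial>P \<partial>P)"
      by (simp add: z_def)
  qed
  also have "\<dots> = (\<integral>\<^sup>+a. \<integral>\<^sup>+b. \<integral>\<^sup>+c. (\<integral>\<^sup>+d. u (exchange B a d) \<partial>P) * v (exchange B c b) \<partial>P \<partial>P \<partial>P)"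
    unfolding exchange_exchange_cross by (intro nn_integral_cong nn_integral_multc uE)
  also have "\<dots> = (\<integral>\<^sup>+a. \<integral>\<^sup>+b. (\<integral>\<^sup>+d. u (exchange B a d) \<partial>P) * (\<integral>\<^sup>+c. v (exchange B c b) \<partial>P) \<partial>P \<partial>P)"
    by (intro nn_integral_cong nn_integral_cmult vE)
  also have "\<dots> = (\<integral>\<^sup>+a. (\<integral>\<^sup>+d. u (exchange B a d) \<partial>P) * (\<integral>\<^sup>+b. \<integral>\<^sup>+c. v (exchange B c b) \<partial>P \<partial>P) \<partial>P)"
    by (intro nn_integral_cong nn_integral_cmult) measurable
  also have "\<dots> = (\<integral>\<^sup>+a. \<integral>\<^sup>+d. u (exchange B a d) \<partial>P \<partial>P) * (\<integral>\<^sup>+b. \<integral>\<^sup>+c. v (exchange B c b) \<partial>P \<partial>P)"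
    by (rule nn_integral_multc) measurable
  also have "(\<integral>\<^sup>+b. \<integral>\<^sup>+c. v (exchange B c b) \<partial>P \<partial>P) = (\<integral>\<^sup>+c. \<integral>\<^sup>+b. v (exchange B c b) \<partial>P \<partial>P)"
    by (rule PP.Fubini') measurable
  also have "\<dots> = emeasure P V"
    by (subst nn_integral_exchange) (simp_all add: uv)
  also have "(\<integral>\<^sup>+a. \<integral>\<^sup>+d. u (exchange B a d) \<partial>P \<partial>P) = emeasure P U"
    by (subst nn_integral_exchange) (simp_all add: uv)
  finally show "emeasure P U * emeasure P V =
     emeasure (distr (P \<Otimes>\<^sub>M P) (P \<Otimes>\<^sub>M P)
      (\<lambda>p. (exchange B (fst p) (snd p), exchange B (snd p) (fst p)))) (U \<times> V)" ..
qed (auto intro: sigma_finite_measure_axioms)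

section \<open>Cells with at most one point\<close>

lemma emeasure_count_eq:
  assumes "A \<in> sets M" "emeasure M A < \<infinity>"
  shows "emeasure P {\<omega> \<in> space P. num_points A \<omega> = of_nat k} =
    ennreal (measure M A ^ k / fact k * exp (- measure M A))"
  by (simp add: emeasure_eq_measure count_distribution[OF assms])

lemma nn_integral_count_eq:
  assumes [measurable]: "A \<in> sets M" and "emeasure M A < \<infinity>"
  shows "(\<integral>\<^sup>+\<omega>. indicator {of_nat k} (num_points A \<omega>) \<partial>P) =
    ennreal (measure M A ^ k / fact k * exp (- measure M A))"
proof -
  have "(\<integral>\<^sup>+\<omega>. indicator {of_nat k} (num_points A \<omega>) \<partial>P) =
      (\<integral>\<^sup>+\<omega>. indicator {\<omega> \<in> space P. num_points A \<omega> = of_nat k} \<omega> \<partial>P)"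
    by (intro nn_integral_cong) (simp add: indicator_def)
  also have "\<dots> = emeasure P {\<omega> \<in> space P. num_points A \<omega> = of_nat k}"
    by (rule nn_integral_indicator) measurable
  finally show ?thesis by (simp only: emeasure_count_eq[OF assms])
qed

text \<open>The counts of \<open>A\<close> and \<open>C - A\<close> are independent, so the
  probability is a product of two Poisson weights whose exponentials combine to one for
  \<open>C\<close>.\<close>

lemma emeasure_single_point_in:
  assumes A [measurable]: "A \<in> sets M" and C [measurable]: "C \<in> sets M" and "A \<subseteq> C"
    and fin: "emeasure M C < \<infinity>"
  shows "emeasure P {\<omega> \<in> space P. num_points A \<omega> = 1 \<and> num_points (C - A) \<omega> = 0} =
    ennreal (exp (- measure M C)) * emeasure M A"
proof -
  have finA: "emeasure M A < \<infinity>" "emeasure M (C - A) < \<infinity>"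
    using emeasure_mono[OF \<open>A \<subseteq> C\<close> C] emeasure_mono[OF Diff_subset C, of A] fin by auto
  have CA[measurable]: "C - A \<in> sets M" by simp
  have "emeasure P {\<omega> \<in> space P. num_points A \<omega> = 1 \<and> num_points (C - A) \<omega> = 0} =
      (\<integral>\<^sup>+\<omega>. indicator {\<omega> \<in> space P. num_points A \<omega> = 1 \<and> num_points (C - A) \<omega> = 0} \<omega> \<partial>P)"
    by (rule nn_integral_indicator[symmetric]) measurable
  also have "\<dots> = (\<integral>\<^sup>+\<omega>. indicator {1} (num_points A \<omega>) * indicator {0} (num_points (C - A) \<omega>) \<partial>P)"
    by (intro nn_integral_cong) (auto simp: indicator_def)
  also have "\<dots> = (\<integral>\<^sup>+\<omega>. \<integral>\<^sup>+\<omega>'. indicator {1} (num_points A (exchange A \<omega> \<omega>')) *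
      indicator {0} (num_points (C - A) (exchange A \<omega> \<omega>')) \<partial>P \<partial>P)"
    by (rule nn_integral_exchange[symmetric]) measurable
  also have "\<dots> = (\<integral>\<^sup>+\<omega>. \<integral>\<^sup>+\<omega>'. indicator {of_nat 1} (num_points A \<omega>') *
      indicator {of_nat 0} (num_points (C - A) \<omega>) \<partial>P \<partial>P)"
  proof -
    have "(C - A) \<inter> A = {}" "C - A - A = C - A" by auto
    then show ?thesis by (simp only: num_points_exchange Int_absorb Diff_cancel num_points_empty) simp
  qed
  also have "\<dots> = (\<integral>\<^sup>+\<omega>. (\<integral>\<^sup>+\<omega>'. indicator {of_nat 1} (num_points A \<omega>') \<partial>P) *
      indicator {of_nat 0} (num_points (C - A) \<omega>) \<partial>P)"
    by (intro nn_integral_cong nn_integral_multc) measurable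
  also have "\<dots> = (\<integral>\<^sup>+\<omega>'. indicator {of_nat 1} (num_points A \<omega>') \<partial>P) *
      (\<integral>\<^sup>+\<omega>. indicator {of_nat 0} (num_points (C - A) \<omega>) \<partial>P)"
    by (rule nn_integral_cmult) measurable
  also have "\<dots> = ennreal (measure M A ^ 1 / fact 1 * exp (- measure M A)) *
      ennreal (measure M (C - A) ^ 0 / fact 0 * exp (- measure M (C - A)))"
    by (subst (1 2) nn_integral_count_eq) (use finA in auto)
  also have "\<dots> = ennreal (measure M A * (exp (- measure M A) * exp (- measure M (C - A))))"
    by (simp add: ennreal_mult[symmetric] mult_ac)
  also have "exp (- measure M A) * exp (- measure M (C - A)) = exp (- measure M C)"
  proof -
    have "measure M (C - A) = measure M C - measure M A"
      using \<open>A \<subseteq> C\<close> fin by (intro measure_Diff) auto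
    then show ?thesis by (simp add: exp_add[symmetric])
  qed
  also have "ennreal (measure M A * exp (- measure M C)) = ennreal (exp (- measure M C)) * emeasure M A"
    using finA by (simp add: ennreal_mult mult.commute emeasure_eq_ennreal_measure)
  finally show ?thesis .
qed

text \<open>Given that \<open>C\<close> contains exactly one point, this point is distributed
  according to the normalized intensity on \<open>C\<close>. The default value of
  \<open>the_elem\<close> never enters because of the indicator.\<close>

lemma nn_integral_single_point:
  assumes C [measurable]: "C \<in> sets M" and fin: "emeasure M C < \<infinity>"
    and g: "g \<in> borel_measurable (restrict_space M C)"
  shows "(\<integral>\<^sup>+\<omega>. g (the_elem (\<omega> \<inter> C)) * indicator {1} (num_points C \<omega>) \<partial>P) =
    ennreal (exp (- measure M C)) * (\<integral>\<^sup>+y. g y \<partial>restrict_space M C)"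
proof -
  define S where "S = {\<omega> \<in> space P. num_points C \<omega> = 1}"
  have S: "S \<in> sets P" unfolding S_def by measurable
  have S_space: "S \<inter> space P = S" by (auto simp: S_def)
  let ?pt = "\<lambda>\<omega>. the_elem (\<omega> \<inter> C)"
  have C_space: "C \<subseteq> space M" using sets.sets_into_space[OF C] .
  have preimage: "{\<omega> \<in> S. ?pt \<omega> \<in> A} = {\<omega> \<in> space P. num_points A \<omega> = 1 \<and> num_points (C - A) \<omega> = 0}"
    if "A \<subseteq> C" for A
  proof (intro set_eqI iffI)
    fix \<omega> assume "\<omega> \<in> {\<omega> \<in> S. ?pt \<omega> \<in> A}"
    then obtain y where y: "\<omega> \<inter> C = {y}" "y \<in> A" "\<omega> \<in> space P"
      using num_points_eq_1D[of C \<omega>] by (auto simp: S_def)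
    have "num_points A \<omega> = num_points A {y}" by (rule num_points_cong) (use y that in auto)
    then have "num_points A \<omega> = 1" using y by (simp add: num_points_singleton)
    moreover have "num_points (C - A) \<omega> = 0" using y by (auto simp: num_points_eq_0_iff)
    ultimately show "\<omega> \<in> {\<omega> \<in> space P. num_points A \<omega> = 1 \<and> num_points (C - A) \<omega> = 0}"
      using y by simp
  next
    fix \<omega> assume w: "\<omega> \<in> {\<omega> \<in> space P. num_points A \<omega> = 1 \<and> num_points (C - A) \<omega> = 0}"
    then obtain y where y: "\<omega> \<inter> A = {y}" using num_points_eq_1D[of A \<omega>] by auto
    have "\<omega> \<inter> C = \<omega> \<inter> A" using w that by (auto simp: num_points_eq_0_iff)
    with y w that show "\<omega> \<in> {\<omega> \<in> S. ?pt \<omega> \<in> A}"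
      using num_points_cong[of \<omega> C \<omega> A] by (auto simp: S_def)
  qed
  have pt: "?pt \<in> measurable (restrict_space P S) (restrict_space M C)"
  proof (rule measurableI)
    fix \<omega> assume "\<omega> \<in> space (restrict_space P S)"
    then have "num_points C \<omega> = 1" by (auto simp: space_restrict_space S_def)
    then obtain y where "\<omega> \<inter> C = {y}" using num_points_eq_1D by blast
    then have "?pt \<omega> = y" "y \<in> C" by auto
    then show "?pt \<omega> \<in> space (restrict_space M C)"
      using C_space by (auto simp: space_restrict_space)
  next
    fix A assume "A \<in> sets (restrict_space M C)"
    then have A [measurable]: "A \<in> sets M" and AC: "A \<subseteq> C"
      using C_space by (auto simp: sets_restrict_space_iff Int_absorb2)
    have "?pt -` A \<inter> space (restrict_space P S) = {\<omega> \<in> S. ?pt \<omega> \<in> A}"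
      by (auto simp: space_restrict_space S_def)
    also have "\<dots> \<in> sets (restrict_space P S)"
      using S unfolding preimage[OF AC]
      by (subst sets_restrict_space_iff) (auto simp: S_space preimage[OF AC, symmetric], simp add: preimage[OF AC])
    finally show "?pt -` A \<inter> space (restrict_space P S) \<in> sets (restrict_space P S)" .
  qed
  have "distr (restrict_space P S) (restrict_space M C) ?pt =
      scale_measure (ennreal (exp (- measure M C))) (restrict_space M C)"
  proof (rule measure_eqI)
    fix A assume "A \<in> sets (distr (restrict_space P S) (restrict_space M C) ?pt)"
    then have A': "A \<in> sets (restrict_space M C)" by simp
    then have A [measurable]: "A \<in> sets M" and AC: "A \<subseteq> C"
      using C_space by (auto simp: sets_restrict_space_iff Int_absorb2)
    have "emeasure (distr (restrict_space P S) (restrict_space M C) ?pt) A =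
        emeasure (restrict_space P S) {\<omega> \<in> S. ?pt \<omega> \<in> A}"
      using pt A' by (subst emeasure_distr)
        (auto simp: space_restrict_space S_def intro!: arg_cong[where f = "emeasure _"])
    also have "\<dots> = emeasure P {\<omega> \<in> S. ?pt \<omega> \<in> A}"
      using S by (intro emeasure_restrict_space) (auto simp: S_space)
    also have "\<dots> = ennreal (exp (- measure M C)) * emeasure M A"
      unfolding preimage[OF AC] by (rule emeasure_single_point_in[OF A C AC fin])
    also have "emeasure M A = emeasure (restrict_space M C) A"
      using C AC C_space by (intro emeasure_restrict_space[symmetric]) (auto simp: Int_absorb2)
    finally show "emeasure (distr (restrict_space P S) (restrict_space M C) ?pt) A =
        emeasure (scale_measure (ennreal (exp (- measure M C))) (restrict_space M C)) A" by simp
  qed simp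
  then have "ennreal (exp (- measure M C)) * (\<integral>\<^sup>+y. g y \<partial>restrict_space M C) =
      (\<integral>\<^sup>+y. g y \<partial>distr (restrict_space P S) (restrict_space M C) ?pt)"
    using g by (simp add: nn_integral_scale_measure)
  also have "\<dots> = (\<integral>\<^sup>+\<omega>. g (?pt \<omega>) \<partial>restrict_space P S)"
    by (rule nn_integral_distr[OF pt]) (simp add: g)
  also have "\<dots> = (\<integral>\<^sup>+\<omega>. g (?pt \<omega>) * indicator S \<omega> \<partial>P)"
    using S by (intro nn_integral_restrict_space) (simp add: S_space)
  also have "\<dots> = (\<integral>\<^sup>+\<omega>. g (?pt \<omega>) * indicator {1} (num_points C \<omega>) \<partial>P)"
    by (intro nn_integral_cong) (auto simp: S_def indicator_def)
  finally show ?thesis ..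
qed

lemma measurable_insert_P:
  assumes "\<phi> \<in> borel_measurable P" "C \<in> sets M"
  shows "(\<lambda>p. \<phi> (insert (fst p) (snd p - C))) \<in> borel_measurable (restrict_space M C \<Otimes>\<^sub>M P)"
proof -
  have "(\<lambda>p. insert (fst p) (snd p - C)) \<in> measurable (restrict_space M C \<Otimes>\<^sub>M P) P"
    using measurable_insert_config[OF assms(2)]
    by (simp add: case_prod_beta measurable_cong_sets[OF sets_pair_measure_cong[OF refl sets_P] sets_P])
  from measurable_compose[OF this assms(1)] show ?thesis .
qed

lemma sigma_finite_restrict:
  assumes "C \<in> sets M" "emeasure M C < \<infinity>"
  shows "sigma_finite_measure (restrict_space M C)"
proof -
  have "finite_measure (restrict_space M C)"
    using assms sets.sets_into_space[OF assms(1)]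
    by (intro finite_measureI) (simp add: space_restrict_space emeasure_restrict_space Int_absorb2)
  then show ?thesis by (simp add: finite_measure_def)
qed

text \<open>A version of the Mecke formula on one cell. Finding one point and finding none have
  probabilities with the same factor \<open>exp (- measure M C)\<close>, and the configuration
  outside of \<open>C\<close> is independent of either event; hence no constant appears.\<close>

lemma one_point_formula:
  assumes \<phi> [measurable]: "\<phi> \<in> borel_measurable P"
    and C [measurable]: "C \<in> sets M" and fin: "emeasure M C < \<infinity>"
  shows "(\<integral>\<^sup>+\<omega>. \<phi> \<omega> * indicator {1} (num_points C \<omega>) \<partial>P) =
    (\<integral>\<^sup>+y. \<integral>\<^sup>+\<omega>. \<phi> (insert y (\<omega> - C)) * indicator {0} (num_points C \<omega>) \<partial>P \<partial>restrict_space M C)"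
proof -
  have C_space: "C \<subseteq> space M" using sets.sets_into_space[OF C] .
  interpret C: sigma_finite_measure "restrict_space M C" by (rule sigma_finite_restrict[OF C fin])
  interpret CP: pair_sigma_finite "restrict_space M C" P ..
  let ?c = "ennreal (exp (- measure M C))"
  have ins: "(\<lambda>p. \<phi> (insert (fst p) (snd p - C))) \<in> borel_measurable (restrict_space M C \<Otimes>\<^sub>M P)"
    by (rule measurable_insert_P[OF \<phi> C])
  have ins1: "(\<lambda>\<omega>. \<phi> (insert y (\<omega> - C))) \<in> borel_measurable P" if "y \<in> C" for y
    using measurable_compose[OF measurable_Pair1' ins, of y] that C_space
    by (simp add: space_restrict_space subset_iff)
  have ins2: "(\<lambda>y. \<phi> (insert y (\<omega> - C))) \<in> borel_measurable (restrict_space M C)" if "\<omega> \<in> space P" for \<omega>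
    using measurable_compose[OF measurable_Pair2'[OF that] ins] by simp
  have "(\<integral>\<^sup>+\<omega>. \<phi> \<omega> * indicator {1} (num_points C \<omega>) \<partial>P) =
      (\<integral>\<^sup>+\<omega>. \<integral>\<^sup>+\<omega>'. \<phi> (exchange C \<omega> \<omega>') * indicator {1} (num_points C (exchange C \<omega> \<omega>')) \<partial>P \<partial>P)"
    by (rule nn_integral_exchange[symmetric]) measurable
  also have "\<dots> = (\<integral>\<^sup>+\<omega>. \<integral>\<^sup>+\<omega>'. \<phi> (insert (the_elem (\<omega>' \<inter> C)) (\<omega> - C)) * indicator {1} (num_points C \<omega>') \<partial>P \<partial>P)"
  proof (rule nn_integral_cong, rule nn_integral_cong)
    fix \<omega> \<omega>'
    have "exchange C \<omega> \<omega>' = insert (the_elem (\<omega>' \<inter> C)) (\<omega> - C)" if "num_points C \<omega>' = 1"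
    proof -
      obtain y where "\<omega>' \<inter> C = {y}" using num_points_eq_1D[OF \<open>num_points C \<omega>' = 1\<close>] by blast
      then show ?thesis by (simp add: exchange_def)
    qed
    then show "\<phi> (exchange C \<omega> \<omega>') * indicator {1} (num_points C (exchange C \<omega> \<omega>')) =
        \<phi> (insert (the_elem (\<omega>' \<inter> C)) (\<omega> - C)) * indicator {1} (num_points C \<omega>')"
      by (auto simp: num_points_exchange indicator_def)
  qed
  also have "\<dots> = (\<integral>\<^sup>+\<omega>. ?c * (\<integral>\<^sup>+y. \<phi> (insert y (\<omega> - C)) \<partial>restrict_space M C) \<partial>P)"
    by (intro nn_integral_cong nn_integral_single_point C fin ins2)
  also have "\<dots> = ?c * (\<integral>\<^sup>+\<omega>. (\<integral>\<^sup>+y. \<phi> (insert y (\<omega> - C)) \<partial>restrict_space M C) \<partial>P)"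
  proof (rule nn_integral_cmult)
    show "(\<lambda>\<omega>. \<integral>\<^sup>+y. \<phi> (insert y (\<omega> - C)) \<partial>restrict_space M C) \<in> borel_measurable P"
      using C.borel_measurable_nn_integral_fst[of "\<lambda>p. \<phi> (insert (snd p) (fst p - C))" P]
        measurable_pair_swap[OF ins] by (simp add: case_prod_beta)
  qed
  also have "(\<integral>\<^sup>+\<omega>. (\<integral>\<^sup>+y. \<phi> (insert y (\<omega> - C)) \<partial>restrict_space M C) \<partial>P) =
      (\<integral>\<^sup>+y. (\<integral>\<^sup>+\<omega>. \<phi> (insert y (\<omega> - C)) \<partial>P) \<partial>restrict_space M C)"
    using ins by (intro CP.Fubini') (simp add: case_prod_beta)
  also have "?c * \<dots> = (\<integral>\<^sup>+y. ?c * (\<integral>\<^sup>+\<omega>. \<phi> (insert y (\<omega> - C)) \<partial>P) \<partial>restrict_space M C)"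
    using borel_measurable_nn_integral_fst[OF ins]
    by (intro nn_integral_cmult[symmetric]) simp
  \<comment> \<open>The constant is read backwards as the probability that \<open>C\<close> is
    empty, independently of the part outside of \<open>C\<close>.\<close>
  also have "\<dots> = (\<integral>\<^sup>+y. \<integral>\<^sup>+\<omega>. \<phi> (insert y (\<omega> - C)) * indicator {0} (num_points C \<omega>) \<partial>P \<partial>restrict_space M C)"
  proof (rule nn_integral_cong)
    fix y assume "y \<in> space (restrict_space M C)"
    then have y: "y \<in> C" by (simp add: space_restrict_space)
    note [measurable] = ins1[OF y]
    have "(\<integral>\<^sup>+\<omega>. \<phi> (insert y (\<omega> - C)) * indicator {0} (num_points C \<omega>) \<partial>P) =
        (\<integral>\<^sup>+\<omega>. \<integral>\<^sup>+\<omega>'. \<phi> (insert y (exchange C \<omega> \<omega>' - C)) * indicator {0} (num_points C (exchange C \<omega> \<omega>')) \<partial>P \<partial>P)"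
      by (rule nn_integral_exchange[symmetric]) measurable
    also have "\<dots> = (\<integral>\<^sup>+\<omega>. \<integral>\<^sup>+\<omega>'. \<phi> (insert y (\<omega> - C)) * indicator {of_nat 0} (num_points C \<omega>') \<partial>P \<partial>P)"
    proof -
      have "exchange C \<omega> \<omega>' - C = \<omega> - C" for \<omega> \<omega>' by (auto simp: exchange_def)
      then show ?thesis by (simp add: num_points_exchange)
    qed
    also have "\<dots> = (\<integral>\<^sup>+\<omega>. \<phi> (insert y (\<omega> - C)) * (\<integral>\<^sup>+\<omega>'. indicator {of_nat 0} (num_points C \<omega>') \<partial>P) \<partial>P)"
      by (intro nn_integral_cong nn_integral_cmult) measurable
    also have "\<dots> = (\<integral>\<^sup>+\<omega>. \<phi> (insert y (\<omega> - C)) * ?c \<partial>P)"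
      by (subst nn_integral_count_eq[OF C fin]) simp
    also have "\<dots> = ?c * (\<integral>\<^sup>+\<omega>. \<phi> (insert y (\<omega> - C)) \<partial>P)"
      by (subst nn_integral_multc) (auto simp: mult.commute)
    finally show "?c * (\<integral>\<^sup>+\<omega>. \<phi> (insert y (\<omega> - C)) \<partial>P) =
      (\<integral>\<^sup>+\<omega>. \<phi> (insert y (\<omega> - C)) * indicator {0} (num_points C \<omega>) \<partial>P)" ..
  qed
  finally show ?thesis .
qed

end

lemma measurable_insert_config' [measurable (raw)]:
  assumes "f \<in> measurable N (restrict_space M C)" "g \<in> measurable N (config_space M)" "C \<in> sets M"
  shows "(\<lambda>x. insert (f x) (g x - C)) \<in> measurable N (config_space M)"
  using measurable_compose[OF measurable_Pair[OF assms(1,2)] measurable_insert_config[OF assms(3)]]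
  by simp

context poisson_process
begin

lemma one_point_formula_pair:
  assumes \<phi> [measurable]: "\<phi> \<in> borel_measurable (P \<Otimes>\<^sub>M P)"
    and C [measurable]: "C \<in> sets M" and fin: "emeasure M C < \<infinity>"
  shows "(\<integral>\<^sup>+p. \<phi> p * indicator {1} (num_points C (fst p)) \<partial>(P \<Otimes>\<^sub>M P)) =
    (\<integral>\<^sup>+y. \<integral>\<^sup>+p. \<phi> (insert y (fst p - C), snd p) * indicator {0} (num_points C (fst p)) \<partial>(P \<Otimes>\<^sub>M P)
      \<partial>restrict_space M C)"
proof -
  interpret C: sigma_finite_measure "restrict_space M C" by (rule sigma_finite_restrict[OF C fin])
  interpret CP: pair_sigma_finite P "restrict_space M C" ..
  have ins: "(\<lambda>q. \<phi> (insert (snd (fst q)) (snd q - C), fst (fst q)) * indicator {0} (num_points C (snd q)))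
    \<in> borel_measurable ((P \<Otimes>\<^sub>M restrict_space M C) \<Otimes>\<^sub>M P)" by measurable
  have "(\<integral>\<^sup>+p. \<phi> p * indicator {1} (num_points C (fst p)) \<partial>(P \<Otimes>\<^sub>M P)) =
    (\<integral>\<^sup>+\<omega>'. \<integral>\<^sup>+\<omega>. \<phi> (\<omega>, \<omega>') * indicator {1} (num_points C \<omega>) \<partial>P \<partial>P)"
    by (subst PP.nn_integral_snd[symmetric]) simp_all
  also have "\<dots> = (\<integral>\<^sup>+\<omega>'. \<integral>\<^sup>+y. \<integral>\<^sup>+\<omega>. \<phi> (insert y (\<omega> - C), \<omega>') * indicator {0} (num_points C \<omega>)
      \<partial>P \<partial>restrict_space M C \<partial>P)"
    by (intro nn_integral_cong one_point_formula C fin measurable_compose[OF measurable_Pair2' \<phi>])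
  also have "\<dots> = (\<integral>\<^sup>+y. \<integral>\<^sup>+\<omega>'. \<integral>\<^sup>+\<omega>. \<phi> (insert y (\<omega> - C), \<omega>') * indicator {0} (num_points C \<omega>)
      \<partial>P \<partial>P \<partial>restrict_space M C)"
    using borel_measurable_nn_integral_fst[OF ins]
    by (intro CP.Fubini'[symmetric]) (simp add: case_prod_beta)
  also have "\<dots> = (\<integral>\<^sup>+y. \<integral>\<^sup>+p. \<phi> (insert y (fst p - C), snd p) * indicator {0} (num_points C (fst p)) \<partial>(P \<Otimes>\<^sub>M P)
      \<partial>restrict_space M C)"
  proof (rule nn_integral_cong)
    fix y assume y: "y \<in> space (restrict_space M C)"
    have "(\<lambda>q. \<phi> (insert (fst q) (fst (snd q) - C), snd (snd q)) * indicator {0} (num_points C (fst (snd q))))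
      \<in> borel_measurable (restrict_space M C \<Otimes>\<^sub>M (P \<Otimes>\<^sub>M P))" by measurable
    from measurable_compose[OF measurable_Pair1'[OF y] this]
    have "(\<lambda>p. \<phi> (insert y (fst p - C), snd p) * indicator {0} (num_points C (fst p))) \<in> borel_measurable (P \<Otimes>\<^sub>M P)"
      by simp
    then show "(\<integral>\<^sup>+\<omega>'. \<integral>\<^sup>+\<omega>. \<phi> (insert y (\<omega> - C), \<omega>') * indicator {0} (num_points C \<omega>) \<partial>P \<partial>P) =
      (\<integral>\<^sup>+p. \<phi> (insert y (fst p - C), snd p) * indicator {0} (num_points C (fst p)) \<partial>(P \<Otimes>\<^sub>M P))"
      by (subst PP.nn_integral_snd[symmetric]) simp_all
  qed
  finally show ?thesis .
qed

lemma nn_integral_exchange_pair: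
  assumes [measurable]: "f \<in> borel_measurable (P \<Otimes>\<^sub>M P)" "B \<in> sets M"
  shows "(\<integral>\<^sup>+p. f (exchange B (fst p) (snd p), exchange B (snd p) (fst p)) \<partial>(P \<Otimes>\<^sub>M P)) =
    (\<integral>\<^sup>+p. f p \<partial>(P \<Otimes>\<^sub>M P))"
proof -
  have "(\<integral>\<^sup>+p. f p \<partial>(P \<Otimes>\<^sub>M P)) = (\<integral>\<^sup>+p. f p \<partial>distr (P \<Otimes>\<^sub>M P) (P \<Otimes>\<^sub>M P)
      (\<lambda>p. (exchange B (fst p) (snd p), exchange B (snd p) (fst p))))"
    by (simp add: distr_exchange_pair)
  also have "\<dots> = (\<integral>\<^sup>+p. f (exchange B (fst p) (snd p), exchange B (snd p) (fst p)) \<partial>(P \<Otimes>\<^sub>M P))"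
    by (rule nn_integral_distr) measurable
  finally show ?thesis ..
qed

lemma integral_exchange_pair:
  fixes f :: "'a set \<times> 'a set \<Rightarrow> real"
  assumes [measurable]: "f \<in> borel_measurable (P \<Otimes>\<^sub>M P)" "B \<in> sets M"
  shows "(\<integral>p. f (exchange B (fst p) (snd p), exchange B (snd p) (fst p)) \<partial>(P \<Otimes>\<^sub>M P)) =
    (\<integral>p. f p \<partial>(P \<Otimes>\<^sub>M P))"
proof -
  have "(\<integral>p. f p \<partial>(P \<Otimes>\<^sub>M P)) = (\<integral>p. f p \<partial>distr (P \<Otimes>\<^sub>M P) (P \<Otimes>\<^sub>M P)
      (\<lambda>p. (exchange B (fst p) (snd p), exchange B (snd p) (fst p))))"
    by (simp add: distr_exchange_pair)
  also have "\<dots> = (\<integral>p. f (exchange B (fst p) (snd p), exchange B (snd p) (fst p)) \<partial>(P \<Otimes>\<^sub>M P))"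
    by (rule integral_distr) measurable
  finally show ?thesis ..
qed

lemma AE_exchange:
  assumes "AE \<omega> in P. Q \<omega>" and [measurable]: "B \<in> sets M"
  shows "AE p in P \<Otimes>\<^sub>M P. Q (exchange B (fst p) (snd p))"
proof -
  have "AE \<omega> in distr (P \<Otimes>\<^sub>M P) P (\<lambda>p. exchange B (fst p) (snd p)). Q \<omega>"
    unfolding distr_exchange[OF assms(2)] by (rule assms(1))
  then show ?thesis by (rule AE_distrD[rotated]) measurable
qed

lemma nn_integral_pair_counts:
  assumes C [measurable]: "C \<in> sets M" and fin: "emeasure M C < \<infinity>"
  shows "(\<integral>\<^sup>+p. indicator {of_nat j} (num_points C (fst p)) * indicator {of_nat k} (num_points C (snd p))
      \<partial>(P \<Otimes>\<^sub>M P)) =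
    ennreal (measure M C ^ (j + k) / (fact j * fact k) * exp (- (2 * measure M C)))"
proof -
  have "(\<integral>\<^sup>+p. indicator {of_nat j} (num_points C (fst p)) * indicator {of_nat k} (num_points C (snd p))
      \<partial>(P \<Otimes>\<^sub>M P)) =
    (\<integral>\<^sup>+\<omega>. \<integral>\<^sup>+\<omega>'. indicator {of_nat j} (num_points C \<omega>) * indicator {of_nat k} (num_points C \<omega>') \<partial>P \<partial>P)"
    by (subst nn_integral_fst[symmetric]) simp_all
  also have "\<dots> = (\<integral>\<^sup>+\<omega>. indicator {of_nat j} (num_points C \<omega>) *
      (\<integral>\<^sup>+\<omega>'. indicator {of_nat k} (num_points C \<omega>') \<partial>P) \<partial>P)"
    by (intro nn_integral_cong nn_integral_cmult) measurable
  also have "\<dots> = (\<integral>\<^sup>+\<omega>. indicator {of_nat j} (num_points C \<omega>) \<partial>P) *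
      (\<integral>\<^sup>+\<omega>'. indicator {of_nat k} (num_points C \<omega>') \<partial>P)"
    by (rule nn_integral_multc) measurable
  also have "\<dots> = ennreal ((measure M C ^ j / fact j * exp (- measure M C)) *
      (measure M C ^ k / fact k * exp (- measure M C)))"
    unfolding nn_integral_count_eq[OF C fin] by (rule ennreal_mult[symmetric]) auto
  also have "(measure M C ^ j / fact j * exp (- measure M C)) * (measure M C ^ k / fact k * exp (- measure M C)) =
      measure M C ^ (j + k) / (fact j * fact k) * exp (- (2 * measure M C))"
    by (simp add: power_add mult_exp_exp field_simps)
  finally show ?thesis .
qed

text \<open>The indicator of the event that the two configurations together have at least two points
  in \<open>C\<close>. At most one subtracted product is nonzero, so the truncated subtraction is
  exact.\<close>

definition several_points :: "'a set \<Rightarrow> 'a set \<times> 'a set \<Rightarrow> ennreal" where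
  "several_points C p = 1 - indicator {0} (num_points C (fst p)) * indicator {0} (num_points C (snd p)) -
     indicator {1} (num_points C (fst p)) * indicator {0} (num_points C (snd p)) -
     indicator {0} (num_points C (fst p)) * indicator {1} (num_points C (snd p))"

lemma several_points_split:
  "indicator {0} (num_points C (fst p)) * indicator {0} (num_points C (snd p)) +
     indicator {1} (num_points C (fst p)) * indicator {0} (num_points C (snd p)) +
     indicator {0} (num_points C (fst p)) * indicator {1} (num_points C (snd p)) + several_points C p = 1"
  by (auto simp: several_points_def indicator_def)

text \<open>Two independent copies together have a Poisson number of points in \<open>C\<close> with
  mean \<open>2 * measure M C\<close>, and at least two points occur with probability at most the
  square of this mean. The quadratic order makes these events negligible on fine partitions.\<close>

lemma nn_integral_several_points:
  assumes C [measurable]: "C \<in> sets M" and fin: "emeasure M C < \<infinity>"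
  shows "(\<integral>\<^sup>+p. several_points C p \<partial>(P \<Otimes>\<^sub>M P)) \<le> ennreal (4 * (measure M C)\<^sup>2)"
proof -
  let ?m = "measure M C"
  have [measurable]: "several_points C \<in> borel_measurable (P \<Otimes>\<^sub>M P)"
    unfolding several_points_def by measurable
  define I where "I j k p = (indicator {of_nat j} (num_points C (fst p)) *
      indicator {of_nat k} (num_points C (snd p)) :: ennreal)"
    for j k :: nat and p :: "'a set \<times> 'a set"
  have [measurable]: "I j k \<in> borel_measurable (P \<Otimes>\<^sub>M P)" for j k
    unfolding I_def by measurable
  have cnt: "(\<integral>\<^sup>+p. I j k p \<partial>(P \<Otimes>\<^sub>M P)) =
      ennreal (?m ^ (j + k) / (fact j * fact k) * exp (- (2 * ?m)))" for j k
    unfolding I_def by (rule nn_integral_pair_counts[OF C fin])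
  have "1 = (\<integral>\<^sup>+p. (1::ennreal) \<partial>(P \<Otimes>\<^sub>M P))"
    by (simp add: PP.emeasure_space_1)
  also have "\<dots> = (\<integral>\<^sup>+p. I 0 0 p + I 1 0 p + I 0 1 p + several_points C p \<partial>(P \<Otimes>\<^sub>M P))"
  proof (rule nn_integral_cong)
    fix p
    show "1 = I 0 0 p + I 1 0 p + I 0 1 p + several_points C p"
      using several_points_split[of C p] by (simp add: I_def)
  qed
  also have "\<dots> = (\<integral>\<^sup>+p. I 0 0 p \<partial>(P \<Otimes>\<^sub>M P)) + (\<integral>\<^sup>+p. I 1 0 p \<partial>(P \<Otimes>\<^sub>M P)) +
      (\<integral>\<^sup>+p. I 0 1 p \<partial>(P \<Otimes>\<^sub>M P)) + (\<integral>\<^sup>+p. several_points C p \<partial>(P \<Otimes>\<^sub>M P))"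
    by (simp add: nn_integral_add)
  also have "\<dots> = ennreal (exp (- (2 * ?m))) + ennreal (?m * exp (- (2 * ?m))) +
      ennreal (?m * exp (- (2 * ?m))) + (\<integral>\<^sup>+p. several_points C p \<partial>(P \<Otimes>\<^sub>M P))"
    unfolding cnt by simp
  also have "\<dots> = ennreal ((1 + 2 * ?m) * exp (- (2 * ?m))) + (\<integral>\<^sup>+p. several_points C p \<partial>(P \<Otimes>\<^sub>M P))"
    by (simp add: ennreal_plus[symmetric] algebra_simps del: ennreal_plus)
  finally have eq: "1 = ennreal ((1 + 2 * ?m) * exp (- (2 * ?m))) + (\<integral>\<^sup>+p. several_points C p \<partial>(P \<Otimes>\<^sub>M P))" .
  then have "(\<integral>\<^sup>+p. several_points C p \<partial>(P \<Otimes>\<^sub>M P)) = ennreal 1 - ennreal ((1 + 2 * ?m) * exp (- (2 * ?m)))"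
    by (metis add.commute ennreal_1 ennreal_add_diff_cancel_right ennreal_neq_top)
  also have "\<dots> = ennreal (1 - (1 + 2 * ?m) * exp (- (2 * ?m)))"
    by (rule ennreal_minus) simp
  also have "\<dots> \<le> ennreal (4 * ?m\<^sup>2)"
  proof (rule ennreal_leI)
    \<comment> \<open>Multiplied by \<open>1 + 2 * ?m\<close>, the left side becomes
      \<open>1 - 4 * ?m\<^sup>2\<close>.\<close>
    have "1 - 2 * ?m \<le> exp (- (2 * ?m))" using exp_ge_add_one_self[of "- (2 * ?m)"] by simp
    then have "(1 + 2 * ?m) * (1 - 2 * ?m) \<le> (1 + 2 * ?m) * exp (- (2 * ?m))"
      by (intro mult_left_mono) auto
    then show "1 - (1 + 2 * ?m) * exp (- (2 * ?m)) \<le> 4 * ?m\<^sup>2"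
      by (simp add: algebra_simps power2_eq_square)
  qed
  finally show ?thesis .
qed

end

section \<open>Covariances on Poisson space\<close>

lemma exchange_involution: "exchange C (exchange C a b) (exchange C b a) = a"
  by (auto simp: exchange_def)

lemma exchange_exchange_disjoint:
  assumes "B \<inter> C = {}"
  shows "exchange B (exchange C a b) (exchange C b a) = exchange (B \<union> C) a b"
    and "exchange (B \<union> C) (exchange C a b) (exchange C b a) = exchange B a b"
  using assms by (auto simp: exchange_def)

text \<open>In the application \<open>H\<close> is \<open>exp (t * Z)\<close>. The weight
  \<open>w\<close> measures an increment of \<open>H\<close> against the corresponding one of
  \<open>Z\<close>, so that the product of the two increments is governed by \<open>w\<close> times
  a square; \<open>\<rho>\<close> dominates this quantity and is what gets integrated.
  \<open>N\<^sub>0\<close> holds the points with second coordinate 0, where no Lipschitz bound is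
  given.\<close>

locale poisson_covariance = poisson_process P M
  for P :: "'a::topological_space set measure" and M :: "'a measure" +
  fixes Z H :: "'a set \<Rightarrow> real" and c d :: real
    and w :: "'a \<Rightarrow> real" and \<rho> :: "'a set \<Rightarrow> 'a \<Rightarrow> ennreal" and N\<^sub>0 :: "'a set"
  assumes Z_measurable [measurable]: "Z \<in> borel_measurable (config_space M)"
    and H_measurable [measurable]: "H \<in> borel_measurable (config_space M)"
    and Z_nonneg: "\<And>\<omega>. 0 \<le> Z \<omega>" and Z_le: "\<And>\<omega>. Z \<omega> \<le> c"
    and H_nonneg: "\<And>\<omega>. 0 \<le> H \<omega>" and H_le: "\<And>\<omega>. H \<omega> \<le> d"
    and w_nonneg: "\<And>y. 0 \<le> w y"
    and \<rho>_measurable: "(\<lambda>p. \<rho> (fst p) (snd p)) \<in> borel_measurable (P \<Otimes>\<^sub>M M)"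
    and null: "N\<^sub>0 \<in> null_sets M"
    and diff_H: "\<And>y. y \<in> space M - N\<^sub>0 \<Longrightarrow>
      AE \<omega> in P. \<bar>H (insert y \<omega>) - H \<omega>\<bar> \<le> w y * H \<omega> * \<bar>Z (insert y \<omega>) - Z \<omega>\<bar>"
    and diff_Z: "\<And>y. y \<in> space M - N\<^sub>0 \<Longrightarrow>
      AE \<omega> in P. ennreal (w y * (Z (insert y \<omega>) - Z \<omega>)\<^sup>2) \<le> \<rho> \<omega> y"
begin

lemma c_nonneg: "0 \<le> c" and d_nonneg: "0 \<le> d"
  using order_trans[OF Z_nonneg Z_le] order_trans[OF H_nonneg H_le] by auto

lemma measurable_\<rho> [measurable (raw)]:
  assumes "f \<in> measurable N (config_space M)" "h \<in> measurable N M"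
  shows "(\<lambda>x. \<rho> (f x) (h x)) \<in> borel_measurable N"
proof -
  have "f \<in> measurable N P" using assms(1) by (simp add: measurable_cong_sets[OF refl sets_P])
  from measurable_compose[OF measurable_Pair[OF this assms(2)] \<rho>_measurable] show ?thesis by simp
qed

text \<open>This interpolates between the mean of the product \<open>Z * H\<close>, at the empty
  set, and the product of the means, approached as \<open>B\<close> exhausts the information in
  \<open>Z\<close>.\<close>

definition mixed :: "'a set \<Rightarrow> real" where
  "mixed B = (\<integral>p. Z (fst p) * H (exchange B (fst p) (snd p)) \<partial>(P \<Otimes>\<^sub>M P))"

text \<open>The half comes from splitting a product of increments into two squares. Keeping the
  requirement that both configurations be empty on \<open>C\<close> makes the density insensitive to
  whether \<open>C\<close> itself is exchanged; see \<open>cell_density_absorb\<close>.\<close>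

definition cell_density :: "'a set \<Rightarrow> 'a set \<Rightarrow> 'a \<Rightarrow> ennreal" where
  "cell_density B C y = (\<integral>\<^sup>+p. ennreal (H (exchange B (fst p) (snd p)) / 2) *
     (\<rho> (fst p) y + \<rho> (exchange B (fst p) (snd p)) y) *
     (indicator {0} (num_points C (fst p)) * indicator {0} (num_points C (snd p))) \<partial>(P \<Otimes>\<^sub>M P))"

lemma integrable_bounded:
  fixes f :: "'a set \<times> 'a set \<Rightarrow> real"
  assumes "f \<in> borel_measurable (P \<Otimes>\<^sub>M P)" "\<And>p. \<bar>f p\<bar> \<le> b"
  shows "integrable (P \<Otimes>\<^sub>M P) f"
  using assms by (intro PP.integrable_const_bound[where B = b]) auto

lemma integrable_mixed:
  assumes [measurable]: "B \<in> sets M"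
  shows "integrable (P \<Otimes>\<^sub>M P) (\<lambda>p. Z (fst p) * H (exchange B (fst p) (snd p)))"
proof (rule integrable_bounded)
  show "\<bar>Z (fst p) * H (exchange B (fst p) (snd p))\<bar> \<le> c * d" for p
    using Z_nonneg Z_le H_nonneg H_le c_nonneg by (simp add: abs_mult mult_mono)
qed measurable

lemma mixed_empty: "mixed {} = (\<integral>\<omega>. Z \<omega> * H \<omega> \<partial>P)"
proof -
  have "mixed {} = (\<integral>p. Z (fst p) * H (fst p) \<partial>(P \<Otimes>\<^sub>M P))"
    by (simp add: mixed_def exchange_def)
  also have "\<dots> = (\<integral>\<omega>. \<integral>\<omega>'. Z \<omega> * H \<omega> \<partial>P \<partial>P)"
    using integrable_mixed[of "{}"] by (subst PP.integral_fst'[symmetric]) (simp_all add: exchange_def)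
  finally show ?thesis by (simp add: prob_space)
qed

text \<open>Swapping the two configurations on \<open>C\<close> preserves their joint law, and
  symmetrizing under this swap turns the difference into half the mean of an increment of
  \<open>Z\<close> times an increment of \<open>H\<close>. The product vanishes if \<open>C\<close>
  is empty in both configurations, and two or more points cost only the quadratic error. What
  remains is one point against none.\<close>

lemma cell_bound:
  assumes B [measurable]: "B \<in> sets M" and C [measurable]: "C \<in> sets M"
    and fin: "emeasure M C < \<infinity>" and BC: "B \<inter> C = {}"
  shows "ennreal (mixed B - mixed (B \<union> C)) \<le>
    (\<integral>\<^sup>+y. cell_density B C y \<partial>restrict_space M C) + ennreal (2 * c * d * (measure M C)\<^sup>2)"
proof -
  let ?ex = "\<lambda>B p. exchange B (fst p) (snd p)"
  let ?s = "\<lambda>p. (exchange C (fst p) (snd p), exchange C (snd p) (fst p))"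
  have [measurable]: "B \<union> C \<in> sets M" by simp
  define f where "f p = Z (fst p) * (H (?ex B p) - H (?ex (B \<union> C) p))" for p
  define G where "G p = \<bar>Z (fst p) - Z (?ex C p)\<bar> * \<bar>H (?ex B p) - H (?ex (B \<union> C) p)\<bar>" for p
  have f_meas [measurable]: "f \<in> borel_measurable (P \<Otimes>\<^sub>M P)" unfolding f_def by measurable
  have G_meas [measurable]: "G \<in> borel_measurable (P \<Otimes>\<^sub>M P)" unfolding G_def by measurable
  have fs_meas: "(\<lambda>p. f (?s p)) \<in> borel_measurable (P \<Otimes>\<^sub>M P)" by measurable
  have H_diff: "\<bar>H a - H b\<bar> \<le> d" for a b
    using H_nonneg[of a] H_nonneg[of b] H_le[of a] H_le[of b] by linarith
  have Z_diff: "\<bar>Z a - Z b\<bar> \<le> c" for a b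
    using Z_nonneg[of a] Z_nonneg[of b] Z_le[of a] Z_le[of b] by linarith
  have f_bound: "\<bar>f p\<bar> \<le> c * d" for p
    unfolding f_def abs_mult using Z_nonneg Z_le H_diff c_nonneg by (intro mult_mono) auto
  have int_f: "integrable (P \<Otimes>\<^sub>M P) f" "integrable (P \<Otimes>\<^sub>M P) (\<lambda>p. f (?s p))"
    using f_bound by (auto intro!: integrable_bounded[where b = "c * d"] f_meas fs_meas)
  have G_nonneg: "0 \<le> G p" for p by (simp add: G_def)
  have G_le: "G p \<le> c * d" for p
    unfolding G_def using Z_diff H_diff c_nonneg by (intro mult_mono) auto
  have f_swap: "f (?s p) = Z (?ex C p) * (H (?ex (B \<union> C) p) - H (?ex B p))" for p
    by (simp add: f_def exchange_exchange_disjoint[OF BC])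
  have G_swap: "G (?s p) = G p" for p
    by (simp add: G_def exchange_exchange_disjoint[OF BC] exchange_involution abs_minus_commute)
  have "mixed B - mixed (B \<union> C) = (\<integral>p. f p \<partial>(P \<Otimes>\<^sub>M P))"
    unfolding mixed_def f_def right_diff_distrib
    by (rule Bochner_Integration.integral_diff[symmetric]) (rule integrable_mixed; simp)+
  \<comment> \<open>The symmetrization: \<open>f\<close> and its swapped version have the same
    integral, and their sum is a product of increments.\<close>
  also have "\<dots> = ((\<integral>p. f p \<partial>(P \<Otimes>\<^sub>M P)) + (\<integral>p. f (?s p) \<partial>(P \<Otimes>\<^sub>M P))) / 2"
    using integral_exchange_pair[OF f_meas C] by simp
  also have "\<dots> = (\<integral>p. (f p + f (?s p)) / 2 \<partial>(P \<Otimes>\<^sub>M P))"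
    using int_f by simp
  finally have diff_eq: "mixed B - mixed (B \<union> C) = (\<integral>p. (f p + f (?s p)) / 2 \<partial>(P \<Otimes>\<^sub>M P))" .
  have "ennreal (mixed B - mixed (B \<union> C)) \<le> ennreal (norm (\<integral>p. (f p + f (?s p)) / 2 \<partial>(P \<Otimes>\<^sub>M P)))"
    unfolding diff_eq by (intro ennreal_leI) simp
  also have "\<dots> \<le> (\<integral>\<^sup>+p. ennreal (norm ((f p + f (?s p)) / 2)) \<partial>(P \<Otimes>\<^sub>M P))"
    using int_f by (intro integral_norm_bound_ennreal) auto
  also have "\<dots> = (\<integral>\<^sup>+p. ennreal (G p / 2) \<partial>(P \<Otimes>\<^sub>M P))"
  proof (rule nn_integral_cong)
    fix p
    have "f p + f (?s p) = (Z (fst p) - Z (?ex C p)) * (H (?ex B p) - H (?ex (B \<union> C) p))"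
      unfolding f_swap by (simp add: f_def algebra_simps)
    then show "ennreal (norm ((f p + f (?s p)) / 2)) = ennreal (G p / 2)"
      by (simp add: G_def abs_mult)
  qed
  also have "\<dots> = (\<integral>\<^sup>+p.
      ennreal (G p / 2) * (indicator {0} (num_points C (fst p)) * indicator {0} (num_points C (snd p))) +
      ennreal (G p / 2) * (indicator {1} (num_points C (fst p)) * indicator {0} (num_points C (snd p))) +
      ennreal (G p / 2) * (indicator {0} (num_points C (fst p)) * indicator {1} (num_points C (snd p))) +
      ennreal (G p / 2) * several_points C p \<partial>(P \<Otimes>\<^sub>M P))" (is "_ = (\<integral>\<^sup>+p. ?G00 p + ?G10 p + ?G01 p + ?Gs p \<partial>_)")
  proof (rule nn_integral_cong)
    fix p
    have "?G00 p + ?G10 p + ?G01 p + ?Gs p = ennreal (G p / 2) *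
      (indicator {0} (num_points C (fst p)) * indicator {0} (num_points C (snd p)) +
       indicator {1} (num_points C (fst p)) * indicator {0} (num_points C (snd p)) +
       indicator {0} (num_points C (fst p)) * indicator {1} (num_points C (snd p)) + several_points C p)"
      by (simp only: distrib_left)
    also have "\<dots> = ennreal (G p / 2)"
      by (simp only: several_points_split mult_1_right)
    finally show "ennreal (G p / 2) = ?G00 p + ?G10 p + ?G01 p + ?Gs p" ..
  qed
  also have "\<dots> = (\<integral>\<^sup>+p. ?G00 p \<partial>(P \<Otimes>\<^sub>M P)) + (\<integral>\<^sup>+p. ?G10 p \<partial>(P \<Otimes>\<^sub>M P)) +
      (\<integral>\<^sup>+p. ?G01 p \<partial>(P \<Otimes>\<^sub>M P)) + (\<integral>\<^sup>+p. ?Gs p \<partial>(P \<Otimes>\<^sub>M P))"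
  proof -
    have 1: "?G00 \<in> borel_measurable (P \<Otimes>\<^sub>M P)" "?G10 \<in> borel_measurable (P \<Otimes>\<^sub>M P)"
      "?G01 \<in> borel_measurable (P \<Otimes>\<^sub>M P)" by measurable
    have 2: "?Gs \<in> borel_measurable (P \<Otimes>\<^sub>M P)" unfolding several_points_def by measurable
    from 1 2 show ?thesis by (simp only: nn_integral_add borel_measurable_add)
  qed
  also have "(\<integral>\<^sup>+p. ?G00 p \<partial>(P \<Otimes>\<^sub>M P)) = 0"
  proof -
    have "?G00 p = 0" for p
    proof (cases "num_points C (fst p) = 0 \<and> num_points C (snd p) = 0")
      case True
      then have "?ex C p = fst p" by (auto simp: num_points_eq_0_iff exchange_def)
      then show ?thesis by (simp add: G_def)
    qed (auto simp: indicator_def)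
    then have "?G00 = (\<lambda>p. 0)" by (rule ext)
    then show ?thesis by (simp only: nn_integral_const mult_zero_left)
  qed
  \<comment> \<open>The swap on \<open>C\<close> preserves \<open>G\<close> and interchanges the two
    events with exactly one point.\<close>
  also have "(\<integral>\<^sup>+p. ?G01 p \<partial>(P \<Otimes>\<^sub>M P)) = (\<integral>\<^sup>+p. ?G10 p \<partial>(P \<Otimes>\<^sub>M P))"
  proof -
    have "?G10 \<in> borel_measurable (P \<Otimes>\<^sub>M P)" by measurable
    from nn_integral_exchange_pair[OF this C] show ?thesis
      unfolding G_swap by (simp add: num_points_exchange mult.commute)
  qed
  also have "(\<integral>\<^sup>+p. ?Gs p \<partial>(P \<Otimes>\<^sub>M P)) \<le> ennreal (2 * c * d * (measure M C)\<^sup>2)"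
  proof -
    have "(\<integral>\<^sup>+p. ?Gs p \<partial>(P \<Otimes>\<^sub>M P)) \<le> (\<integral>\<^sup>+p. ennreal (c * d / 2) * several_points C p \<partial>(P \<Otimes>\<^sub>M P))"
      using G_le by (intro nn_integral_mono mult_right_mono ennreal_leI) auto
    also have "\<dots> = ennreal (c * d / 2) * (\<integral>\<^sup>+p. several_points C p \<partial>(P \<Otimes>\<^sub>M P))"
      by (rule nn_integral_cmult) (unfold several_points_def, measurable)
    also have "\<dots> \<le> ennreal (c * d / 2) * ennreal (4 * (measure M C)\<^sup>2)"
      by (intro mult_left_mono nn_integral_several_points C fin) simp
    also have "\<dots> = ennreal (2 * c * d * (measure M C)\<^sup>2)"
      using c_nonneg d_nonneg by (subst ennreal_mult[symmetric]) (auto simp: mult_ac)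
    finally show ?thesis .
  qed
  \<comment> \<open>The two equal contributions absorb the half from the symmetrization.\<close>
  also have "0 + (\<integral>\<^sup>+p. ?G10 p \<partial>(P \<Otimes>\<^sub>M P)) + (\<integral>\<^sup>+p. ?G10 p \<partial>(P \<Otimes>\<^sub>M P)) =
      (\<integral>\<^sup>+p. ennreal (G p) * indicator {0} (num_points C (snd p)) * indicator {1} (num_points C (fst p)) \<partial>(P \<Otimes>\<^sub>M P))"
  proof -
    have "?G10 \<in> borel_measurable (P \<Otimes>\<^sub>M P)" by measurable
    then have "0 + (\<integral>\<^sup>+p. ?G10 p \<partial>(P \<Otimes>\<^sub>M P)) + (\<integral>\<^sup>+p. ?G10 p \<partial>(P \<Otimes>\<^sub>M P)) =
        (\<integral>\<^sup>+p. ?G10 p + ?G10 p \<partial>(P \<Otimes>\<^sub>M P))"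
      by (simp only: nn_integral_add add_0)
    also have "\<dots> = (\<integral>\<^sup>+p. ennreal (G p) * indicator {0} (num_points C (snd p)) * indicator {1} (num_points C (fst p)) \<partial>(P \<Otimes>\<^sub>M P))"
    proof (rule nn_integral_cong)
      fix p
      have "?G10 p + ?G10 p = (ennreal (G p / 2) + ennreal (G p / 2)) *
          (indicator {1} (num_points C (fst p)) * indicator {0} (num_points C (snd p)))"
        by (simp only: distrib_right)
      also have "ennreal (G p / 2) + ennreal (G p / 2) = ennreal (G p)"
        using G_nonneg[of p] by (subst ennreal_plus[symmetric]) auto
      finally show "?G10 p + ?G10 p =
          ennreal (G p) * indicator {0} (num_points C (snd p)) * indicator {1} (num_points C (fst p))"
        by (simp only: mult_ac)
    qed
    finally show ?thesis .
  qed
  also have "\<dots> = (\<integral>\<^sup>+y. \<integral>\<^sup>+p. ennreal (G (insert y (fst p - C), snd p)) *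
      indicator {0} (num_points C (snd p)) * indicator {0} (num_points C (fst p)) \<partial>(P \<Otimes>\<^sub>M P) \<partial>restrict_space M C)"
    by (subst one_point_formula_pair[OF _ C fin]) simp_all
  also have "\<dots> \<le> (\<integral>\<^sup>+y. cell_density B C y \<partial>restrict_space M C)"
  proof (rule nn_integral_mono_AE)
    have "AE y in M. y \<notin> N\<^sub>0" using null by (rule AE_not_in)
    then have "AE y in restrict_space M C. y \<notin> N\<^sub>0"
      using C sets.sets_into_space[OF C] by (subst AE_restrict_space_iff) (auto simp: Int_absorb2)
    then show "AE y in restrict_space M C. (\<integral>\<^sup>+p. ennreal (G (insert y (fst p - C), snd p)) *
        indicator {0} (num_points C (snd p)) * indicator {0} (num_points C (fst p)) \<partial>(P \<Otimes>\<^sub>M P))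
        \<le> cell_density B C y"
    proof (rule AE_mp, intro AE_I2 impI)
      fix y assume "y \<in> space (restrict_space M C)" and "y \<notin> N\<^sub>0"
      then have y: "y \<in> C" "y \<in> space M - N\<^sub>0"
        using sets.sets_into_space[OF C] by (auto simp: space_restrict_space)
      \<comment> \<open>The almost sure estimates transfer to the resampled configuration because it
        has law \<open>P\<close>, too.\<close>
      have AEs: "AE p in P \<Otimes>\<^sub>M P. ennreal (w y * (Z (insert y (fst p)) - Z (fst p))\<^sup>2) \<le> \<rho> (fst p) y"
        "AE p in P \<Otimes>\<^sub>M P. ennreal (w y * (Z (insert y (?ex B p)) - Z (?ex B p))\<^sup>2) \<le> \<rho> (?ex B p) y"
        "AE p in P \<Otimes>\<^sub>M P. \<bar>H (insert y (?ex B p)) - H (?ex B p)\<bar> \<le>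
          w y * H (?ex B p) * \<bar>Z (insert y (?ex B p)) - Z (?ex B p)\<bar>"
        using AE_pair_fst[OF diff_Z[OF y(2)] sigma_finite_measure_axioms]
          AE_exchange[OF diff_Z[OF y(2)] B] AE_exchange[OF diff_H[OF y(2)] B] by auto
      show "(\<integral>\<^sup>+p. ennreal (G (insert y (fst p - C), snd p)) *
        indicator {0} (num_points C (snd p)) * indicator {0} (num_points C (fst p)) \<partial>(P \<Otimes>\<^sub>M P))
        \<le> cell_density B C y"
        unfolding cell_density_def
      proof (rule nn_integral_mono_AE, use AEs in eventually_elim)
        fix p
        assume 1: "ennreal (w y * (Z (insert y (fst p)) - Z (fst p))\<^sup>2) \<le> \<rho> (fst p) y"
          and 2: "ennreal (w y * (Z (insert y (?ex B p)) - Z (?ex B p))\<^sup>2) \<le> \<rho> (?ex B p) y"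
          and 3: "\<bar>H (insert y (?ex B p)) - H (?ex B p)\<bar> \<le>
            w y * H (?ex B p) * \<bar>Z (insert y (?ex B p)) - Z (?ex B p)\<bar>"
        let ?e = "?ex B p"
        show "ennreal (G (insert y (fst p - C), snd p)) *
          indicator {0} (num_points C (snd p)) * indicator {0} (num_points C (fst p))
          \<le> ennreal (H ?e / 2) * (\<rho> (fst p) y + \<rho> ?e y) *
           (indicator {0} (num_points C (fst p)) * indicator {0} (num_points C (snd p)))"
        proof (cases "num_points C (fst p) = 0 \<and> num_points C (snd p) = 0")
          case True
          then have empty: "fst p \<inter> C = {}" "snd p \<inter> C = {}" by (auto simp: num_points_eq_0_iff)
          have eqs: "insert y (fst p - C) = insert y (fst p)"
            "exchange C (insert y (fst p)) (snd p) = fst p"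
            "exchange B (insert y (fst p)) (snd p) = insert y ?e"
            "exchange (B \<union> C) (insert y (fst p)) (snd p) = ?e"
            using empty y(1) BC by (auto simp: exchange_def)
          let ?a = "\<bar>Z (insert y (fst p)) - Z (fst p)\<bar>" and ?b = "\<bar>Z (insert y ?e) - Z ?e\<bar>"
          have "G (insert y (fst p - C), snd p) = ?a * \<bar>H (insert y ?e) - H ?e\<bar>"
            unfolding G_def by (simp add: eqs)
          also have "\<dots> \<le> ?a * (w y * H ?e * ?b)" by (intro mult_left_mono 3) simp
          also have "\<dots> = w y * H ?e * (?a * ?b)" by (simp add: mult_ac)
          \<comment> \<open>Each square now involves the increment of \<open>Z\<close> at only one
            of the two configurations, so \<open>\<rho>\<close> can be inserted separately.\<close>
          also have "\<dots> \<le> w y * H ?e * ((?a\<^sup>2 + ?b\<^sup>2) / 2)"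
            using sum_squares_bound[of ?a ?b] w_nonneg[of y] H_nonneg[of ?e]
            by (intro mult_left_mono) auto
          also have "\<dots> = H ?e / 2 * (w y * ?a\<^sup>2 + w y * ?b\<^sup>2)"
            by (simp only: power2_abs) (simp add: field_simps)
          finally have "ennreal (G (insert y (fst p - C), snd p)) \<le>
              ennreal (H ?e / 2 * (w y * ?a\<^sup>2 + w y * ?b\<^sup>2))" by (rule ennreal_leI)
          also have "\<dots> = ennreal (H ?e / 2) * (ennreal (w y * ?a\<^sup>2) + ennreal (w y * ?b\<^sup>2))"
            using H_nonneg[of ?e] w_nonneg[of y]
            by (subst ennreal_mult) (auto simp: ennreal_plus)
          also have "\<dots> \<le> ennreal (H ?e / 2) * (\<rho> (fst p) y + \<rho> ?e y)"
            using 1 2 by (intro mult_left_mono add_mono) (auto simp: power2_abs)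
          finally show ?thesis using True by simp
        qed (auto simp: indicator_def)
      qed
    qed
  qed
  finally show ?thesis by (simp add: add_mono)
qed

end

section \<open>Averaging over random orders\<close>

text \<open>When \<open>m\<close> cells are put into uniformly random order, \<open>shapley m (card A)\<close> is the probability
  that \<open>A\<close> is the set of the cells preceding a given cell outside of \<open>A\<close>. The weight
  \<open>beta_weight m (card A)\<close> is the probability of selecting \<open>A\<close> when each cell is
  selected independently with a common probability that is uniformly distributed on \<open>[0, 1]\<close>.\<close>

definition shapley :: "nat \<Rightarrow> nat \<Rightarrow> real" where
  "shapley m k = fact k * fact (m - 1 - k) / fact m"

definition beta_weight :: "nat \<Rightarrow> nat \<Rightarrow> real" where
  "beta_weight m k = fact k * fact (m - k) / fact (m + 1)"

lemma shapley_nonneg: "0 \<le> shapley m k" and beta_weight_nonneg: "0 \<le> beta_weight m k"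
  by (simp_all add: shapley_def beta_weight_def)

text \<open>In terms of Beta integrals this sums out the state of one cell:
  \<open>u ^ k * (1 - u) ^ (m - 1 - k)\<close> is split according to
  \<open>(1 - u) + u = 1\<close>.\<close>

lemma beta_weight_add:
  assumes "k < m"
  shows "beta_weight m k + beta_weight m (Suc k) = shapley m k"
proof -
  obtain j where m: "m = Suc (k + j)" using assms less_imp_Suc_add by blast
  have "beta_weight m k + beta_weight m (Suc k) =
      fact k * fact j * (real (Suc j) + real (Suc k)) / fact (m + 1)"
    unfolding beta_weight_def m by (simp add: add_divide_distrib algebra_simps)
  also have "real (Suc j) + real (Suc k) = real (m + 1)" by (simp add: m)
  also have "fact k * fact j * real (m + 1) / fact (m + 1) = fact k * fact j / (fact m :: real)"
    by (simp add: divide_simps del: of_nat_Suc of_nat_add)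
  finally show ?thesis by (simp add: shapley_def m)
qed

lemma sum_Pow_Diff:
  fixes f :: "'b set \<Rightarrow> 'c::comm_monoid_add"
  assumes "finite S"
  shows "(\<Sum>A\<in>Pow (S - {C}). f A) = (\<Sum>A\<in>Pow S. if C \<in> A then 0 else f A)"
proof -
  have "Pow (S - {C}) = Pow S \<inter> {A. C \<notin> A}" by auto
  then show ?thesis using assms by (simp add: sum.inter_restrict if_distrib cong: if_cong)
      (rule sum.cong, auto)
qed

lemma sum_Pow_insert:
  fixes f :: "'b set \<Rightarrow> 'c::comm_monoid_add"
  assumes "finite S" "C \<in> S"
  shows "(\<Sum>A\<in>Pow (S - {C}). f (insert C A)) = (\<Sum>A\<in>Pow S. if C \<in> A then f A else 0)"
proof -
  have "(\<Sum>A\<in>Pow (S - {C}). f (insert C A)) = (\<Sum>A\<in>Pow S \<inter> {A. C \<in> A}. f A)"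
    by (rule sum.reindex_bij_witness[where i = "\<lambda>A. A - {C}" and j = "insert C"])
      (use assms in auto)
  then show ?thesis using assms by (simp add: sum.inter_restrict)
qed

text \<open>Along every order of the cells the differences telescope, and this is the average over
  all orders. The proof collects the coefficient of each \<open>g A\<close>.\<close>

lemma sum_shapley_differences:
  fixes g :: "'b set \<Rightarrow> real"
  assumes "finite S"
  shows "(\<Sum>C\<in>S. \<Sum>A\<in>Pow (S - {C}). shapley (card S) (card A) * (g A - g (insert C A))) = g {} - g S"
proof (cases "S = {}")
  case False
  define m where "m = card S"
  have m: "0 < m" using False assms by (simp add: m_def card_gt_0_iff)
  have card_Suc: "card (insert C A) = Suc (card A)" if "A \<in> Pow (S - {C})" for A C
  proof -
    have "finite A" "C \<notin> A" using that assms finite_subset by auto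
    then show ?thesis by simp
  qed
  have "(\<Sum>C\<in>S. \<Sum>A\<in>Pow (S - {C}). shapley m (card A) * g A) =
      (\<Sum>A\<in>Pow S. \<Sum>C\<in>S. if C \<in> A then 0 else shapley m (card A) * g A)"
    unfolding sum_Pow_Diff[OF assms] by (rule sum.swap)
  also have "\<dots> = (\<Sum>A\<in>Pow S. real (m - card A) * shapley m (card A) * g A)"
  proof (rule sum.cong[OF refl])
    fix A assume "A \<in> Pow S"
    then have A: "A \<subseteq> S" "finite A" using assms finite_subset by auto
    have "(\<Sum>C\<in>S. if C \<in> A then 0 else shapley m (card A) * g A) =
        (\<Sum>C\<in>S - A. shapley m (card A) * g A)"
      using assms by (intro sum.mono_neutral_cong_right) auto
    also have "\<dots> = real (m - card A) * shapley m (card A) * g A"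
      using A by (simp add: card_Diff_subset m_def)
    finally show "(\<Sum>C\<in>S. if C \<in> A then 0 else shapley m (card A) * g A) =
        real (m - card A) * shapley m (card A) * g A" .
  qed
  finally have 1: "(\<Sum>C\<in>S. \<Sum>A\<in>Pow (S - {C}). shapley m (card A) * g A) =
      (\<Sum>A\<in>Pow S. real (m - card A) * shapley m (card A) * g A)" .
  \<comment> \<open>Writing the weight in terms of \<open>insert C A\<close> allows the second sum
    to be indexed by the set at which \<open>g\<close> is evaluated.\<close>
  have "(\<Sum>C\<in>S. \<Sum>A\<in>Pow (S - {C}). shapley m (card A) * g (insert C A)) =
      (\<Sum>C\<in>S. \<Sum>A\<in>Pow (S - {C}). shapley m (card (insert C A) - 1) * g (insert C A))"
    by (intro sum.cong refl) (simp add: card_Suc)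
  also have "\<dots> = (\<Sum>C\<in>S. \<Sum>A\<in>Pow S. if C \<in> A then shapley m (card A - 1) * g A else 0)"
    by (intro sum.cong refl sum_Pow_insert[OF assms])
  also have "\<dots> = (\<Sum>A\<in>Pow S. \<Sum>C\<in>S. if C \<in> A then shapley m (card A - 1) * g A else 0)"
    by (rule sum.swap)
  also have "\<dots> = (\<Sum>A\<in>Pow S. real (card A) * shapley m (card A - 1) * g A)"
  proof (rule sum.cong[OF refl])
    fix A assume "A \<in> Pow S"
    then have "S \<inter> A = A" by auto
    then show "(\<Sum>C\<in>S. if C \<in> A then shapley m (card A - 1) * g A else 0) =
        real (card A) * shapley m (card A - 1) * g A"
      using assms by (simp add: sum.inter_restrict[symmetric])
  qed
  finally have 2: "(\<Sum>C\<in>S. \<Sum>A\<in>Pow (S - {C}). shapley m (card A) * g (insert C A)) =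
      (\<Sum>A\<in>Pow S. real (card A) * shapley m (card A - 1) * g A)" .
  have "(\<Sum>C\<in>S. \<Sum>A\<in>Pow (S - {C}). shapley m (card A) * (g A - g (insert C A))) =
      (\<Sum>A\<in>Pow S. real (m - card A) * shapley m (card A) * g A) -
      (\<Sum>A\<in>Pow S. real (card A) * shapley m (card A - 1) * g A)"
    unfolding right_diff_distrib sum_subtractf 1 2 ..
  also have "\<dots> = (\<Sum>A\<in>Pow S. (real (m - card A) * shapley m (card A) -
      real (card A) * shapley m (card A - 1)) * g A)"
    by (simp add: sum_subtractf left_diff_distrib)
  also have "\<dots> = (\<Sum>A\<in>Pow S. (if A = {} then g A else 0) - (if A = S then g A else 0))"
  proof (rule sum.cong[OF refl])
    fix A assume "A \<in> Pow S"
    then have A: "A \<subseteq> S" "finite A" using assms finite_subset by auto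
    then have "card A \<le> m" using assms by (auto simp: m_def intro: card_mono)
    \<comment> \<open>Strictly between the extremes both coefficients are the probability that
      \<open>A\<close> is an initial segment of the random order, and they cancel. At either end one
      coefficient is 0 and the other is 1.\<close>
    consider "A = {}" | "A = S" | "A \<noteq> {}" "A \<noteq> S" by blast
    then show "(real (m - card A) * shapley m (card A) - real (card A) * shapley m (card A - 1)) * g A =
        (if A = {} then g A else 0) - (if A = S then g A else 0)"
    proof cases
      case 1
      have "fact m = real m * fact (m - 1)" using m by (rule fact_reduce)
      then show ?thesis using 1 False m by (simp add: shapley_def)
    next
      case 2
      have "fact m = real m * fact (m - 1)" using m by (rule fact_reduce)
      then show ?thesis using 2 False m by (simp add: shapley_def m_def[symmetric])
    next
      case 3
      with A assms have "0 < card A" "card A < m"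
        by (auto simp: m_def card_gt_0_iff intro: psubset_card_mono)
      then obtain k j where k: "card A = Suc k" and j: "m = Suc (Suc k + j)"
        by (metis gr0_implies_Suc less_imp_Suc_add)
      have "real (m - card A) * shapley m (card A) = real (card A) * shapley m (card A - 1)"
        unfolding shapley_def k j by (simp add: divide_simps)
      with 3 show ?thesis by simp
    qed
  qed
  also have "\<dots> = g {} - g S"
    using assms by (simp add: sum_subtractf)
  finally show ?thesis by (simp only: m_def)
qed simp

text \<open>There are \<open>m choose k\<close> sets of size \<open>k\<close>, so each size receives
  mass \<open>1 / (m + 1)\<close>: the number of selected cells is uniform on
  \<open>{0..m}\<close>.\<close>

lemma sum_beta_weight:
  assumes "finite S"
  shows "(\<Sum>A\<in>Pow S. beta_weight (card S) (card A)) = 1"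
proof -
  define m where "m = card S"
  have "(\<Sum>A\<in>Pow S. beta_weight m (card A)) =
      (\<Sum>k\<le>m. \<Sum>A\<in>{A \<in> Pow S. card A = k}. beta_weight m (card A))"
    using assms by (intro sum.group[symmetric]) (auto simp: m_def card_mono)
  also have "\<dots> = (\<Sum>k\<le>m. real (m choose k) * beta_weight m k)"
    using n_subsets[OF assms] by (intro sum.cong refl) (simp add: m_def)
  also have "\<dots> = (\<Sum>k\<le>m. 1 / real (m + 1))"
  proof (rule sum.cong[OF refl])
    fix k assume "k \<in> {..m}"
    then have "real (m choose k) = fact m / (fact k * fact (m - k))"
      by (intro binomial_fact) simp
    then show "real (m choose k) * beta_weight m k = 1 / real (m + 1)"
      by (simp add: beta_weight_def divide_simps)
  qed
  also have "\<dots> = 1" by simp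
  finally show ?thesis by (simp only: m_def)
qed

text \<open>The weights on the left concern sets that avoid \<open>C\<close>; those on the right are
  the same for all cells. The change costs nothing when \<phi> ignores the presence of
  \<open>C\<close>, because by \<open>beta_weight_add\<close> the weights of \<open>A\<close> and
  \<open>insert C A\<close> add up to the weight of \<open>A\<close> on the left.\<close>

lemma sum_shapley_invariant:
  fixes \<phi> :: "'b set \<Rightarrow> ennreal"
  assumes S: "finite S" "C \<in> S" and \<phi>: "\<And>A. A \<in> Pow (S - {C}) \<Longrightarrow> \<phi> (insert C A) = \<phi> A"
  shows "(\<Sum>A\<in>Pow (S - {C}). ennreal (shapley (card S) (card A)) * \<phi> A) =
    (\<Sum>A\<in>Pow S. ennreal (beta_weight (card S) (card A)) * \<phi> A)"
proof -
  let ?q = "\<lambda>k. ennreal (beta_weight (card S) k)"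
  have "ennreal (shapley (card S) (card A)) * \<phi> A =
      ?q (card A) * \<phi> A + ?q (card (insert C A)) * \<phi> (insert C A)" if "A \<in> Pow (S - {C})" for A
  proof -
    have A: "finite A" "C \<notin> A" "A \<subset> S" using that S finite_subset by auto
    then have "card A < card S" using S by (intro psubset_card_mono)
    then have "shapley (card S) (card A) =
        beta_weight (card S) (card A) + beta_weight (card S) (card (insert C A))"
      using A beta_weight_add by simp
    then show ?thesis
      using \<phi>[OF that] by (simp add: ennreal_plus beta_weight_nonneg distrib_right del: card_insert_if)
  qed
  then have "(\<Sum>A\<in>Pow (S - {C}). ennreal (shapley (card S) (card A)) * \<phi> A) =
      (\<Sum>A\<in>Pow (S - {C}). ?q (card A) * \<phi> A) +
      (\<Sum>A\<in>Pow (S - {C}). ?q (card (insert C A)) * \<phi> (insert C A))"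
    by (simp add: sum.distrib)
  also have "\<dots> = (\<Sum>A\<in>Pow S. if C \<in> A then 0 else ?q (card A) * \<phi> A) +
      (\<Sum>A\<in>Pow S. if C \<in> A then ?q (card A) * \<phi> A else 0)"
    using sum_Pow_insert[OF S, of "\<lambda>A. ?q (card A) * \<phi> A"] sum_Pow_Diff[OF S(1), of "\<lambda>A. ?q (card A) * \<phi> A" C]
    by simp
  also have "\<dots> = (\<Sum>A\<in>Pow S. ?q (card A) * \<phi> A)"
    unfolding sum.distrib[symmetric] by (intro sum.cong) auto
  finally show ?thesis .
qed

text \<open>Equality can fail since \<open>ennreal\<close> sends negative terms to 0. The inequality
  suits differences of \<open>mixed\<close>, whose signs are unknown.\<close>

lemma ennreal_sum_le: "ennreal (\<Sum>i\<in>I. f i) \<le> (\<Sum>i\<in>I. ennreal (f i))"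
proof (induction I rule: infinite_finite_induct)
  case (insert i I)
  have "ennreal (f i + sum f I) \<le> ennreal (max 0 (f i) + max 0 (sum f I))"
    by (intro ennreal_leI add_mono) auto
  also have "\<dots> = ennreal (f i) + ennreal (sum f I)"
    by (simp add: ennreal_plus max_def ennreal_neg)
  finally show ?case using insert by (simp add: add_left_mono order_trans)
qed auto

section \<open>Summing the cells of a partition\<close>

context poisson_covariance
begin

text \<open>Exchanging \<open>C\<close> has no effect on configurations that are both empty there,
  and only those count. This is the invariance needed for
  \<open>sum_shapley_invariant\<close>.\<close>

lemma cell_density_absorb:
  assumes "B \<inter> C = {}"
  shows "cell_density (B \<union> C) C y = cell_density B C y"
  unfolding cell_density_def
proof (rule nn_integral_cong)
  fix p
  have "exchange (B \<union> C) (fst p) (snd p) = exchange B (fst p) (snd p)"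
    if "num_points C (fst p) = 0" "num_points C (snd p) = 0"
    using that by (auto simp: num_points_eq_0_iff exchange_def)
  then show "ennreal (H (exchange (B \<union> C) (fst p) (snd p)) / 2) *
       (\<rho> (fst p) y + \<rho> (exchange (B \<union> C) (fst p) (snd p)) y) *
       (indicator {0} (num_points C (fst p)) * indicator {0} (num_points C (snd p))) =
     ennreal (H (exchange B (fst p) (snd p)) / 2) *
       (\<rho> (fst p) y + \<rho> (exchange B (fst p) (snd p)) y) *
       (indicator {0} (num_points C (fst p)) * indicator {0} (num_points C (snd p)))"
    by (simp add: indicator_def)
qed

lemma nn_integral_H_exchange:
  assumes [measurable]: "B \<in> sets M"
  shows "(\<integral>\<^sup>+p. ennreal (H (exchange B (fst p) (snd p))) \<partial>(P \<Otimes>\<^sub>M P)) = ennreal (\<integral>\<omega>. H \<omega> \<partial>P)"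
proof -
  have "(\<integral>\<^sup>+p. ennreal (H (exchange B (fst p) (snd p))) \<partial>(P \<Otimes>\<^sub>M P)) =
      (\<integral>\<^sup>+\<omega>. \<integral>\<^sup>+\<omega>'. ennreal (H (exchange B \<omega> \<omega>')) \<partial>P \<partial>P)"
    by (subst nn_integral_fst[symmetric]) simp_all
  also have "\<dots> = (\<integral>\<^sup>+\<omega>. ennreal (H \<omega>) \<partial>P)"
    by (rule nn_integral_exchange) measurable
  also have "\<dots> = ennreal (\<integral>\<omega>. H \<omega> \<partial>P)"
    using H_nonneg H_le
    by (intro nn_integral_eq_integral integrable_const_bound[where B = d]) auto
  finally show ?thesis .
qed

text \<open>The bound \<kappa> holds at every configuration, hence at both that occur, with
  \<open>H\<close> as a common factor; the two halves give one \<kappa>. Finiteness of the measure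
  of \<open>B\<close> serves the exchange of the integrals.\<close>

lemma nn_integral_density_le:
  assumes A [measurable]: "A \<in> sets M" and B: "B \<in> sets M" "emeasure M B < \<infinity>"
    and \<kappa>: "\<And>\<omega>. \<omega> \<in> space P \<Longrightarrow> (\<integral>\<^sup>+y. \<rho> \<omega> y \<partial>M) \<le> \<kappa>"
  shows "(\<integral>\<^sup>+y. \<integral>\<^sup>+p. ennreal (H (exchange A (fst p) (snd p)) / 2) *
     (\<rho> (fst p) y + \<rho> (exchange A (fst p) (snd p)) y) \<partial>(P \<Otimes>\<^sub>M P) \<partial>restrict_space M B)
     \<le> \<kappa> * ennreal (\<integral>\<omega>. H \<omega> \<partial>P)"
proof -
  interpret B: sigma_finite_measure "restrict_space M B" by (rule sigma_finite_restrict[OF B])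
  interpret PB: pair_sigma_finite "restrict_space M B" "P \<Otimes>\<^sub>M P" ..
  let ?e = "\<lambda>p. exchange A (fst p) (snd p)"
  have idM [measurable]: "(\<lambda>y. y) \<in> measurable (restrict_space M B) M"
    using B by (intro measurable_restrict_space1) auto
  have fst_M [measurable]: "fst \<in> measurable (restrict_space M B \<Otimes>\<^sub>M (P \<Otimes>\<^sub>M P)) M"
    using measurable_compose[OF measurable_fst idM] by simp
  have meas: "(\<lambda>q. ennreal (H (?e (snd q)) / 2) * (\<rho> (fst (snd q)) (fst q) + \<rho> (?e (snd q)) (fst q)))
      \<in> borel_measurable (restrict_space M B \<Otimes>\<^sub>M (P \<Otimes>\<^sub>M P))"
    by measurable
  have \<rho>_sec: "\<rho> \<omega> \<in> borel_measurable (restrict_space M B)" if "\<omega> \<in> space P" for \<omega>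
    using measurable_restrict_space1[OF measurable_compose[OF measurable_Pair1'[OF that] \<rho>_measurable]]
    by simp
  have \<rho>_B: "(\<integral>\<^sup>+y. \<rho> \<omega> y \<partial>restrict_space M B) \<le> \<kappa>" if "\<omega> \<in> space P" for \<omega>
  proof -
    have "(\<integral>\<^sup>+y. \<rho> \<omega> y \<partial>restrict_space M B) = (\<integral>\<^sup>+y. \<rho> \<omega> y * indicator B y \<partial>M)"
      using B by (intro nn_integral_restrict_space) auto
    also have "\<dots> \<le> (\<integral>\<^sup>+y. \<rho> \<omega> y \<partial>M)"
      by (intro nn_integral_mono) (auto simp: indicator_def)
    finally show ?thesis using \<kappa>[OF that] by (rule order_trans)
  qed
  have "(\<integral>\<^sup>+y. \<integral>\<^sup>+p. ennreal (H (?e p) / 2) * (\<rho> (fst p) y + \<rho> (?e p) y) \<partial>(P \<Otimes>\<^sub>M P) \<partial>restrict_space M B) =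
      (\<integral>\<^sup>+p. \<integral>\<^sup>+y. ennreal (H (?e p) / 2) * (\<rho> (fst p) y + \<rho> (?e p) y) \<partial>restrict_space M B \<partial>(P \<Otimes>\<^sub>M P))"
    by (rule PB.Fubini'[symmetric]) (use meas in \<open>simp add: case_prod_beta\<close>)
  also have "\<dots> \<le> (\<integral>\<^sup>+p. \<kappa> * ennreal (H (?e p)) \<partial>(P \<Otimes>\<^sub>M P))"
  proof (rule nn_integral_mono)
    fix p assume "p \<in> space (P \<Otimes>\<^sub>M P)"
    then have p: "fst p \<in> space P" "?e p \<in> space P"
      by (auto simp: space_pair_measure space_P exchange_in_configurations)
    have "(\<integral>\<^sup>+y. ennreal (H (?e p) / 2) * (\<rho> (fst p) y + \<rho> (?e p) y) \<partial>restrict_space M B) =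
        ennreal (H (?e p) / 2) * ((\<integral>\<^sup>+y. \<rho> (fst p) y \<partial>restrict_space M B) + (\<integral>\<^sup>+y. \<rho> (?e p) y \<partial>restrict_space M B))"
      using \<rho>_sec[OF p(1)] \<rho>_sec[OF p(2)] by (simp add: nn_integral_cmult nn_integral_add)
    also have "\<dots> \<le> ennreal (H (?e p) / 2) * (\<kappa> + \<kappa>)"
      by (intro mult_left_mono add_mono \<rho>_B p) simp
    also have "\<dots> = \<kappa> * (ennreal (H (?e p) / 2) + ennreal (H (?e p) / 2))"
      by (simp add: algebra_simps)
    also have "ennreal (H (?e p) / 2) + ennreal (H (?e p) / 2) = ennreal (H (?e p))"
      using H_nonneg[of "?e p"] by (subst ennreal_plus[symmetric]) auto
    finally show "(\<integral>\<^sup>+y. ennreal (H (?e p) / 2) * (\<rho> (fst p) y + \<rho> (?e p) y) \<partial>restrict_space M B)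
        \<le> \<kappa> * ennreal (H (?e p))" .
  qed
  also have "\<dots> = \<kappa> * (\<integral>\<^sup>+p. ennreal (H (?e p)) \<partial>(P \<Otimes>\<^sub>M P))"
    by (rule nn_integral_cmult) measurable
  finally show ?thesis by (simp only: nn_integral_H_exchange[OF A])
qed

text \<open>The telescoped differences are bounded cell by cell, and the weights are then made
  independent of the cell. For each fixed \<open>A\<close> all cells refer to the same pair of
  configurations, so they add up to a single integral over their union and \<kappa> is paid once,
  not once per cell.\<close>

lemma mixed_partition_bound:
  assumes \<C>: "finite \<C>" "disjoint \<C>" "\<C> \<subseteq> sets M" and fin: "\<And>C. C \<in> \<C> \<Longrightarrow> emeasure M C < \<infinity>"
    and \<kappa>: "\<And>\<omega>. \<omega> \<in> space P \<Longrightarrow> (\<integral>\<^sup>+y. \<rho> \<omega> y \<partial>M) \<le> \<kappa>"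
  shows "ennreal (mixed {} - mixed (\<Union>\<C>)) \<le>
    \<kappa> * ennreal (\<integral>\<omega>. H \<omega> \<partial>P) + ennreal (\<Sum>C\<in>\<C>. 2 * c * d * (measure M C)\<^sup>2)"
proof -
  define s where "s A = ennreal (shapley (card \<C>) (card A))" for A :: "'a set set"
  define q where "q A = ennreal (beta_weight (card \<C>) (card A))" for A :: "'a set set"
  \<comment> \<open>The cell density without its emptiness indicators. Dropping them removes the
    dependence on \<open>C\<close>, but it also destroys the invariance, so it must happen after the
    weights have been changed.\<close>
  define U where "U A y = (\<integral>\<^sup>+p. ennreal (H (exchange (\<Union>A) (fst p) (snd p)) / 2) *
     (\<rho> (fst p) y + \<rho> (exchange (\<Union>A) (fst p) (snd p)) y) \<partial>(P \<Otimes>\<^sub>M P))" for A y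
  let ?B = "\<Union>\<C>"
  have sets_Un [measurable]: "\<Union>A \<in> sets M" if "A \<in> Pow \<C>" for A
    using that \<C> finite_subset by (intro sets.finite_Union) auto
  have B: "?B \<in> sets M" using sets_Un[of \<C>] by simp
  have B_fin: "emeasure M ?B < \<infinity>"
  proof -
    have "emeasure M ?B \<le> (\<Sum>C\<in>\<C>. emeasure M C)"
      using emeasure_subadditive_finite[of \<C> "\<lambda>C. C" M] \<C> by auto
    also have "\<dots> < \<infinity>" using fin \<C>(1) by (simp add: less_top)
    finally show ?thesis .
  qed
  have Int: "\<Union>A \<inter> C = {}" if "A \<in> Pow (\<C> - {C})" "C \<in> \<C>" for A C
    using that \<C>(2) unfolding disjoint_def by blast
  have U_meas: "U A \<in> borel_measurable M" if "A \<in> Pow \<C>" for A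
  proof -
    note [measurable] = sets_Un[OF that]
    have "(\<lambda>z. ennreal (H (exchange (\<Union>A) (fst (snd z)) (snd (snd z))) / 2) *
       (\<rho> (fst (snd z)) (fst z) + \<rho> (exchange (\<Union>A) (fst (snd z)) (snd (snd z))) (fst z)))
       \<in> borel_measurable (M \<Otimes>\<^sub>M (P \<Otimes>\<^sub>M P))" by measurable
    from PP.borel_measurable_nn_integral_fst[OF this] show ?thesis
      unfolding U_def by simp
  qed
  have cell: "s A * ennreal (mixed (\<Union>A) - mixed (\<Union>(insert C A))) \<le>
      s A * (\<integral>\<^sup>+y. cell_density (\<Union>A) C y \<partial>restrict_space M C) + s A * ennreal (2 * c * d * (measure M C)\<^sup>2)"
    if "C \<in> \<C>" "A \<in> Pow (\<C> - {C})" for C A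
  proof -
    have "\<Union>(insert C A) = \<Union>A \<union> C" by auto
    moreover have "ennreal (mixed (\<Union>A) - mixed (\<Union>A \<union> C)) \<le>
        (\<integral>\<^sup>+y. cell_density (\<Union>A) C y \<partial>restrict_space M C) + ennreal (2 * c * d * (measure M C)\<^sup>2)"
      using that \<C> by (intro cell_bound sets_Un fin Int) auto
    ultimately show ?thesis by (simp add: distrib_left[symmetric] mult_left_mono)
  qed
  have density: "(\<Sum>A\<in>Pow (\<C> - {C}). s A * (\<integral>\<^sup>+y. cell_density (\<Union>A) C y \<partial>restrict_space M C))
      \<le> (\<Sum>A\<in>Pow \<C>. q A * (\<integral>\<^sup>+y. U A y \<partial>restrict_space M C))" if C: "C \<in> \<C>" for C
  proof -
    define \<phi> where "\<phi> A = (\<integral>\<^sup>+y. cell_density (\<Union>A) C y \<partial>restrict_space M C)" for A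
    have "(\<Sum>A\<in>Pow (\<C> - {C}). s A * \<phi> A) = (\<Sum>A\<in>Pow \<C>. q A * \<phi> A)"
      unfolding s_def q_def
    proof (rule sum_shapley_invariant[OF \<C>(1) C])
      fix A assume A: "A \<in> Pow (\<C> - {C})"
      have "\<Union>(insert C A) = \<Union>A \<union> C" by auto
      moreover have "cell_density (\<Union>A \<union> C) C = cell_density (\<Union>A) C"
        by (rule ext) (rule cell_density_absorb[OF Int[OF A C]])
      ultimately show "\<phi> (insert C A) = \<phi> A"
        unfolding \<phi>_def by (simp only:)
    qed
    also have "\<dots> \<le> (\<Sum>A\<in>Pow \<C>. q A * (\<integral>\<^sup>+y. U A y \<partial>restrict_space M C))"
    proof (intro sum_mono mult_left_mono)
      fix A
      have "cell_density (\<Union>A) C y \<le> U A y" for y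
        unfolding cell_density_def U_def by (intro nn_integral_mono) (auto simp: indicator_def)
      then show "\<phi> A \<le> (\<integral>\<^sup>+y. U A y \<partial>restrict_space M C)"
        unfolding \<phi>_def by (rule nn_integral_mono)
    qed simp
    finally show ?thesis by (simp only: \<phi>_def)
  qed
  have sum_s: "(\<Sum>A\<in>Pow (\<C> - {C}). s A) = 1" if "C \<in> \<C>" for C
  proof -
    have "(\<Sum>A\<in>Pow (\<C> - {C}). s A * 1) = (\<Sum>A\<in>Pow \<C>. q A * 1)"
      unfolding s_def q_def by (rule sum_shapley_invariant[OF \<C>(1) that]) simp
    also have "\<dots> = ennreal (\<Sum>A\<in>Pow \<C>. beta_weight (card \<C>) (card A))"
      unfolding q_def by (simp add: sum_ennreal beta_weight_nonneg)
    finally show ?thesis by (simp add: sum_beta_weight[OF \<C>(1)])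
  qed
  have "mixed {} - mixed ?B = (\<Sum>C\<in>\<C>. \<Sum>A\<in>Pow (\<C> - {C}).
      shapley (card \<C>) (card A) * (mixed (\<Union>A) - mixed (\<Union>(insert C A))))"
    using sum_shapley_differences[OF \<C>(1), of "\<lambda>A. mixed (\<Union>A)"] by simp
  then have "ennreal (mixed {} - mixed ?B) \<le> (\<Sum>C\<in>\<C>. ennreal (\<Sum>A\<in>Pow (\<C> - {C}).
      shapley (card \<C>) (card A) * (mixed (\<Union>A) - mixed (\<Union>(insert C A)))))"
    by (simp only: ennreal_sum_le)
  also have "\<dots> \<le> (\<Sum>C\<in>\<C>. \<Sum>A\<in>Pow (\<C> - {C}).
      ennreal (shapley (card \<C>) (card A) * (mixed (\<Union>A) - mixed (\<Union>(insert C A)))))"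
    by (intro sum_mono ennreal_sum_le)
  also have "\<dots> = (\<Sum>C\<in>\<C>. \<Sum>A\<in>Pow (\<C> - {C}). s A * ennreal (mixed (\<Union>A) - mixed (\<Union>(insert C A))))"
    unfolding s_def by (simp only: ennreal_mult' shapley_nonneg)
  also have "\<dots> \<le> (\<Sum>C\<in>\<C>. \<Sum>A\<in>Pow (\<C> - {C}).
      s A * (\<integral>\<^sup>+y. cell_density (\<Union>A) C y \<partial>restrict_space M C) + s A * ennreal (2 * c * d * (measure M C)\<^sup>2))"
    by (intro sum_mono cell)
  also have "\<dots> = (\<Sum>C\<in>\<C>. (\<Sum>A\<in>Pow (\<C> - {C}). s A * (\<integral>\<^sup>+y. cell_density (\<Union>A) C y \<partial>restrict_space M C)) +
      ennreal (2 * c * d * (measure M C)\<^sup>2))"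
    by (intro sum.cong refl) (simp add: sum.distrib sum_distrib_right[symmetric] sum_s)
  also have "\<dots> \<le> (\<Sum>C\<in>\<C>. (\<Sum>A\<in>Pow \<C>. q A * (\<integral>\<^sup>+y. U A y \<partial>restrict_space M C)) +
      ennreal (2 * c * d * (measure M C)\<^sup>2))"
    by (intro sum_mono add_right_mono density)
  also have "\<dots> = (\<Sum>A\<in>Pow \<C>. q A * (\<Sum>C\<in>\<C>. \<integral>\<^sup>+y. U A y \<partial>restrict_space M C)) +
      (\<Sum>C\<in>\<C>. ennreal (2 * c * d * (measure M C)\<^sup>2))"
    unfolding sum.distrib sum_distrib_left by (subst sum.swap) simp
  also have "(\<Sum>C\<in>\<C>. ennreal (2 * c * d * (measure M C)\<^sup>2)) =
      ennreal (\<Sum>C\<in>\<C>. 2 * c * d * (measure M C)\<^sup>2)"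
    using c_nonneg d_nonneg by (intro sum_ennreal) auto
  also have "(\<Sum>A\<in>Pow \<C>. q A * (\<Sum>C\<in>\<C>. \<integral>\<^sup>+y. U A y \<partial>restrict_space M C)) \<le>
      (\<Sum>A\<in>Pow \<C>. q A * (\<kappa> * ennreal (\<integral>\<omega>. H \<omega> \<partial>P)))"
  proof (intro sum_mono mult_left_mono)
    fix A assume A: "A \<in> Pow \<C>"
    have "(\<Sum>C\<in>\<C>. \<integral>\<^sup>+y. U A y \<partial>restrict_space M C) = (\<Sum>C\<in>\<C>. \<integral>\<^sup>+y. U A y * indicator C y \<partial>M)"
      using \<C> by (intro sum.cong refl nn_integral_restrict_space) auto
    also have "\<dots> = (\<integral>\<^sup>+y. (\<Sum>C\<in>\<C>. U A y * indicator C y) \<partial>M)"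
      using \<C> U_meas[OF A] by (intro nn_integral_sum[symmetric]) auto
    also have "\<dots> = (\<integral>\<^sup>+y. U A y * indicator ?B y \<partial>M)"
    proof (rule nn_integral_cong)
      fix y
      have "(\<Sum>C\<in>\<C>. indicator C y) = (indicator (\<Union>C\<in>\<C>. C) y :: ennreal)"
        using \<C> by (intro indicator_UN_disjoint[symmetric]) (auto simp: disjoint_family_on_def disjoint_def)
      then show "(\<Sum>C\<in>\<C>. U A y * indicator C y) = U A y * indicator ?B y"
        by (simp add: sum_distrib_left[symmetric])
    qed
    also have "\<dots> = (\<integral>\<^sup>+y. U A y \<partial>restrict_space M ?B)"
      using B by (intro nn_integral_restrict_space[symmetric]) auto
    also have "\<dots> \<le> \<kappa> * ennreal (\<integral>\<omega>. H \<omega> \<partial>P)"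
      unfolding U_def by (intro nn_integral_density_le sets_Un A B B_fin \<kappa>)
    finally show "(\<Sum>C\<in>\<C>. \<integral>\<^sup>+y. U A y \<partial>restrict_space M C) \<le> \<kappa> * ennreal (\<integral>\<omega>. H \<omega> \<partial>P)" .
  qed simp
  also have "(\<Sum>A\<in>Pow \<C>. q A * (\<kappa> * ennreal (\<integral>\<omega>. H \<omega> \<partial>P))) = \<kappa> * ennreal (\<integral>\<omega>. H \<omega> \<partial>P)"
  proof -
    have "(\<Sum>A\<in>Pow \<C>. q A) = 1"
      unfolding q_def using sum_beta_weight[OF \<C>(1)] by (simp add: sum_ennreal beta_weight_nonneg)
    then show ?thesis by (simp add: sum_distrib_right[symmetric])
  qed
  finally show ?thesis by (simp add: add_right_mono)
qed

end

section \<open>Approximation by functionals of a set of finite measure\<close>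

context poisson_process
begin

definition determined_by :: "'a set \<Rightarrow> ('a set \<Rightarrow> 'b) \<Rightarrow> bool" where
  "determined_by B f \<longleftrightarrow> (\<forall>\<omega>\<in>space P. \<forall>\<omega>'\<in>space P. \<omega> \<inter> B = \<omega>' \<inter> B \<longrightarrow> f \<omega> = f \<omega>')"

lemma determined_by_compose: "determined_by B f \<Longrightarrow> determined_by B (\<lambda>\<omega>. g (f \<omega>))"
  unfolding determined_by_def by metis

text \<open>Only a set of finite measure can be cut into finitely many cells of small measure;
  approximation in the mean reduces the covariance to that situation.\<close>

definition approximable :: "('a set \<Rightarrow> real) \<Rightarrow> bool" where
  "approximable f \<longleftrightarrow> integrable P f \<and> (\<forall>\<epsilon>>0. \<exists>B\<in>sets M. emeasure M B < \<infinity> \<and>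
     (\<exists>f'. integrable P f' \<and> determined_by B f' \<and> (\<integral>\<omega>. \<bar>f \<omega> - f' \<omega>\<bar> \<partial>P) < \<epsilon>))"

lemma approximableE:
  assumes "approximable f" "0 < \<epsilon>"
  obtains B f' where "B \<in> sets M" "emeasure M B < \<infinity>" "integrable P f'" "determined_by B f'"
    "(\<integral>\<omega>. \<bar>f \<omega> - f' \<omega>\<bar> \<partial>P) < \<epsilon>"
  using assms unfolding approximable_def by blast

text \<open>One criterion for sums, differences and maxima. The approximants are determined by two
  different sets and are combined on their union.\<close>

lemma approximable_Lipschitz:
  fixes \<phi> :: "real \<Rightarrow> real \<Rightarrow> real"
  assumes f: "approximable f" and g: "approximable g"
    and Lipschitz: "\<And>a b a' b'. \<bar>\<phi> a b - \<phi> a' b'\<bar> \<le> \<bar>a - a'\<bar> + \<bar>b - b'\<bar>"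
    and int: "\<And>f g. integrable P f \<Longrightarrow> integrable P g \<Longrightarrow> integrable P (\<lambda>\<omega>. \<phi> (f \<omega>) (g \<omega>))"
  shows "approximable (\<lambda>\<omega>. \<phi> (f \<omega>) (g \<omega>))"
  unfolding approximable_def
proof safe
  have ints: "integrable P f" "integrable P g" using f g by (auto simp: approximable_def)
  then show "integrable P (\<lambda>\<omega>. \<phi> (f \<omega>) (g \<omega>))" by (rule int)
  fix \<epsilon> :: real assume "0 < \<epsilon>"
  then have "0 < \<epsilon> / 2" by simp
  obtain B f' where B: "B \<in> sets M" "emeasure M B < \<infinity>" "integrable P f'" "determined_by B f'"
    "(\<integral>\<omega>. \<bar>f \<omega> - f' \<omega>\<bar> \<partial>P) < \<epsilon> / 2" by (rule approximableE[OF f \<open>0 < \<epsilon> / 2\<close>])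
  obtain C g' where C: "C \<in> sets M" "emeasure M C < \<infinity>" "integrable P g'" "determined_by C g'"
    "(\<integral>\<omega>. \<bar>g \<omega> - g' \<omega>\<bar> \<partial>P) < \<epsilon> / 2" by (rule approximableE[OF g \<open>0 < \<epsilon> / 2\<close>])
  have "emeasure M (B \<union> C) \<le> emeasure M B + emeasure M C"
    using B C by (intro emeasure_subadditive) auto
  also have "\<dots> < \<infinity>" using B C by (simp add: less_top)
  finally have fin: "emeasure M (B \<union> C) < \<infinity>" .
  have det: "determined_by (B \<union> C) (\<lambda>\<omega>. \<phi> (f' \<omega>) (g' \<omega>))"
    unfolding determined_by_def
  proof (intro ballI impI)
    fix \<omega> \<omega>' assume w: "\<omega> \<in> space P" "\<omega>' \<in> space P" and eq: "\<omega> \<inter> (B \<union> C) = \<omega>' \<inter> (B \<union> C)"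
    have "\<omega> \<inter> B = \<omega>' \<inter> B" "\<omega> \<inter> C = \<omega>' \<inter> C" using eq by blast+
    then have "f' \<omega> = f' \<omega>'" "g' \<omega> = g' \<omega>'"
      using B(4) C(4) w unfolding determined_by_def by blast+
    then show "\<phi> (f' \<omega>) (g' \<omega>) = \<phi> (f' \<omega>') (g' \<omega>')" by simp
  qed
  have "(\<integral>\<omega>. \<bar>\<phi> (f \<omega>) (g \<omega>) - \<phi> (f' \<omega>) (g' \<omega>)\<bar> \<partial>P) \<le>
      (\<integral>\<omega>. \<bar>f \<omega> - f' \<omega>\<bar> + \<bar>g \<omega> - g' \<omega>\<bar> \<partial>P)"
    using ints B(3) C(3)
    by (intro integral_mono integrable_abs Bochner_Integration.integrable_diff
        Bochner_Integration.integrable_add int Lipschitz)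
  also have "\<dots> = (\<integral>\<omega>. \<bar>f \<omega> - f' \<omega>\<bar> \<partial>P) + (\<integral>\<omega>. \<bar>g \<omega> - g' \<omega>\<bar> \<partial>P)"
    using ints B(3) C(3)
    by (intro Bochner_Integration.integral_add integrable_abs Bochner_Integration.integrable_diff)
  also have "\<dots> < \<epsilon>" using B(5) C(5) by simp
  finally have "(\<integral>\<omega>. \<bar>\<phi> (f \<omega>) (g \<omega>) - \<phi> (f' \<omega>) (g' \<omega>)\<bar> \<partial>P) < \<epsilon>" .
  then show "\<exists>B\<in>sets M. emeasure M B < \<infinity> \<and> (\<exists>h. integrable P h \<and> determined_by B h \<and>
      (\<integral>\<omega>. \<bar>\<phi> (f \<omega>) (g \<omega>) - h \<omega>\<bar> \<partial>P) < \<epsilon>)"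
    using det fin int[OF B(3) C(3)] sets.Un[OF B(1) C(1)] by blast
qed

lemma approximable_AE_const:
  assumes f: "integrable P f" "AE \<omega> in P. f \<omega> = a"
  shows "approximable f"
  unfolding approximable_def
proof safe
  fix \<epsilon> :: real assume "0 < \<epsilon>"
  have "(\<integral>\<omega>. \<bar>f \<omega> - a\<bar> \<partial>P) = (\<integral>\<omega>. 0 \<partial>P)"
    using f by (intro integral_cong_AE) auto
  then show "\<exists>B\<in>sets M. emeasure M B < \<infinity> \<and> (\<exists>f'. integrable P f' \<and> determined_by B f' \<and>
      (\<integral>\<omega>. \<bar>f \<omega> - f' \<omega>\<bar> \<partial>P) < \<epsilon>)"
    using \<open>0 < \<epsilon>\<close> by (intro bexI[of _ "{}"] conjI exI[of _ "\<lambda>_. a"]) (auto simp: determined_by_def)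
qed (use f in simp)

lemma approximable_scale:
  assumes f: "approximable f"
  shows "approximable (\<lambda>\<omega>. f \<omega> * a)"
  unfolding approximable_def
proof safe
  show "integrable P (\<lambda>\<omega>. f \<omega> * a)" using f by (simp add: approximable_def)
  fix \<epsilon> :: real assume "0 < \<epsilon>"
  then have "0 < \<epsilon> / (\<bar>a\<bar> + 1)" by simp
  obtain B f' where B: "B \<in> sets M" "emeasure M B < \<infinity>" "integrable P f'" "determined_by B f'"
    "(\<integral>\<omega>. \<bar>f \<omega> - f' \<omega>\<bar> \<partial>P) < \<epsilon> / (\<bar>a\<bar> + 1)" by (rule approximableE[OF f \<open>0 < \<epsilon> / (\<bar>a\<bar> + 1)\<close>])
  have "(\<integral>\<omega>. \<bar>f \<omega> * a - f' \<omega> * a\<bar> \<partial>P) = (\<integral>\<omega>. \<bar>f \<omega> - f' \<omega>\<bar> * \<bar>a\<bar> \<partial>P)"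
    by (simp only: left_diff_distrib[symmetric] abs_mult)
  also have "\<dots> = (\<integral>\<omega>. \<bar>f \<omega> - f' \<omega>\<bar> \<partial>P) * \<bar>a\<bar>" by simp
  also have "\<dots> \<le> (\<integral>\<omega>. \<bar>f \<omega> - f' \<omega>\<bar> \<partial>P) * (\<bar>a\<bar> + 1)"
    by (intro mult_left_mono) auto
  also have "\<dots> < \<epsilon>" using B(5) by (simp add: pos_less_divide_eq)
  finally have "(\<integral>\<omega>. \<bar>f \<omega> * a - f' \<omega> * a\<bar> \<partial>P) < \<epsilon>" .
  then show "\<exists>B\<in>sets M. emeasure M B < \<infinity> \<and> (\<exists>h. integrable P h \<and> determined_by B h \<and>
      (\<integral>\<omega>. \<bar>f \<omega> * a - h \<omega>\<bar> \<partial>P) < \<epsilon>)"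
    using B(1-3) determined_by_compose[OF B(4), of "\<lambda>x. x * a"]
    by (intro bexI[of _ B] conjI exI[of _ "\<lambda>\<omega>. f' \<omega> * a"] integrable_mult_left)
qed

lemma approximable_lim:
  assumes s: "\<And>i. approximable (s i)" and lim: "\<And>\<omega>. \<omega> \<in> space P \<Longrightarrow> (\<lambda>i. s i \<omega>) \<longlonglongrightarrow> f \<omega>"
    and bound: "\<And>i \<omega>. \<omega> \<in> space P \<Longrightarrow> \<bar>s i \<omega>\<bar> \<le> g \<omega>" and g: "integrable P g" and f: "integrable P f"
  shows "approximable f"
  unfolding approximable_def
proof safe
  fix \<epsilon> :: real assume "0 < \<epsilon>"
  then have pos: "0 < \<epsilon> / 2" by simp
  have s_int: "integrable P (s i)" for i using s by (simp add: approximable_def)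
  have "(\<lambda>i. \<integral>\<omega>. \<bar>f \<omega> - s i \<omega>\<bar> \<partial>P) \<longlonglongrightarrow> (\<integral>\<omega>. 0 \<partial>P)"
  proof (rule integral_dominated_convergence[where w = "\<lambda>\<omega>. \<bar>f \<omega>\<bar> + g \<omega>"])
    show "AE \<omega> in P. (\<lambda>i. \<bar>f \<omega> - s i \<omega>\<bar>) \<longlonglongrightarrow> 0"
    proof (rule AE_I2)
      fix \<omega> assume "\<omega> \<in> space P"
      from tendsto_rabs[OF tendsto_diff[OF tendsto_const[of "f \<omega>"] lim[OF this]]]
      show "(\<lambda>i. \<bar>f \<omega> - s i \<omega>\<bar>) \<longlonglongrightarrow> 0" by simp
    qed
    show "AE \<omega> in P. norm \<bar>f \<omega> - s i \<omega>\<bar> \<le> \<bar>f \<omega>\<bar> + g \<omega>" for i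
    proof (rule AE_I2)
      fix \<omega> assume "\<omega> \<in> space P"
      from bound[OF this, of i] show "norm \<bar>f \<omega> - s i \<omega>\<bar> \<le> \<bar>f \<omega>\<bar> + g \<omega>" by simp
    qed
  qed (use f g s_int in auto)
  then have "eventually (\<lambda>i. (\<integral>\<omega>. \<bar>f \<omega> - s i \<omega>\<bar> \<partial>P) < \<epsilon> / 2) sequentially"
    using pos by (intro order_tendstoD(2)) auto
  then obtain i where i: "(\<integral>\<omega>. \<bar>f \<omega> - s i \<omega>\<bar> \<partial>P) < \<epsilon> / 2"
    by (auto simp: eventually_sequentially)
  obtain B f' where B: "B \<in> sets M" "emeasure M B < \<infinity>" "integrable P f'" "determined_by B f'"
    "(\<integral>\<omega>. \<bar>s i \<omega> - f' \<omega>\<bar> \<partial>P) < \<epsilon> / 2" by (rule approximableE[OF s pos])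
  have "(\<integral>\<omega>. \<bar>f \<omega> - f' \<omega>\<bar> \<partial>P) \<le> (\<integral>\<omega>. \<bar>f \<omega> - s i \<omega>\<bar> + \<bar>s i \<omega> - f' \<omega>\<bar> \<partial>P)"
    using f B(3) s_int
    by (intro integral_mono integrable_abs Bochner_Integration.integrable_diff
        Bochner_Integration.integrable_add) auto
  also have "\<dots> = (\<integral>\<omega>. \<bar>f \<omega> - s i \<omega>\<bar> \<partial>P) + (\<integral>\<omega>. \<bar>s i \<omega> - f' \<omega>\<bar> \<partial>P)"
    using f B(3) s_int
    by (intro Bochner_Integration.integral_add integrable_abs Bochner_Integration.integrable_diff)
  also have "\<dots> < \<epsilon>" using i B(5) by simp
  finally show "\<exists>B\<in>sets M. emeasure M B < \<infinity> \<and> (\<exists>f'. integrable P f' \<and> determined_by B f' \<and>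
      (\<integral>\<omega>. \<bar>f \<omega> - f' \<omega>\<bar> \<partial>P) < \<epsilon>)" using B by blast
qed (use f in simp)

lemma approximable_cong:
  assumes f: "approximable f" and fg: "\<And>\<omega>. \<omega> \<in> space P \<Longrightarrow> f \<omega> = g \<omega>"
  shows "approximable g"
proof (rule approximable_lim[where s = "\<lambda>_. f" and g = "\<lambda>\<omega>. \<bar>f \<omega>\<bar>"])
  have "integrable P f" using f by (simp add: approximable_def)
  then show "integrable P (\<lambda>\<omega>. \<bar>f \<omega>\<bar>)" by simp
  show "integrable P g"
    using \<open>integrable P f\<close> fg by (subst Bochner_Integration.integrable_cong[OF refl, of _ _ f]) auto
qed (use f fg in auto)

text \<open>Induction over the generation of the \<sigma>-algebra from events about one count.
  Complements and finite unions are the Lipschitz operations \<open>1 - b\<close> and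
  \<open>max\<close>; countable unions follow by dominated convergence.\<close>

lemma approximable_indicator:
  assumes "A \<in> sets P"
  shows "approximable (indicator A)"
proof -
  have int: "integrable P (indicator A :: _ \<Rightarrow> real)" if "A \<in> sets P" for A
    using that emeasure_finite[of A] by (intro integrable_real_indicator) (auto simp: less_top[symmetric])
  have "A \<in> sigma_sets (configurations (space M))
     {{\<omega> \<in> configurations (space M). num_points A \<omega> \<in> B} | A B. A \<in> sets M \<and> B \<in> sets borel}"
    using assms unfolding sets_P sets_config_space .
  then show ?thesis
  proof (induction A rule: sigma_sets.induct)
    case (Basic S)
    then obtain A R where S: "S = {\<omega> \<in> space P. num_points A \<omega> \<in> R}"
      and A [measurable]: "A \<in> sets M" and R [measurable]: "R \<in> sets borel"
      unfolding space_P by blast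
    have "S \<in> sets P" unfolding S by measurable
    then have S_int: "integrable P (indicator S :: _ \<Rightarrow> real)" by (rule int)
    show ?case
    \<comment> \<open>For infinite measure the count is almost surely infinite, so the indicator is
      almost surely constant and the empty set suffices as the determining set.\<close>
    proof (cases "emeasure M A = \<infinity>")
      case True
      then have "AE \<omega> in P. num_points A \<omega> = \<infinity>" by (rule infinite_count[OF A])
      then have "AE \<omega> in P. indicator S \<omega> = (indicator R \<infinity> :: real)"
        by (rule AE_mp) (auto intro!: AE_I2 simp: S indicator_def)
      then show ?thesis by (rule approximable_AE_const[OF S_int])
    next
      case False
      have "determined_by A (indicator S :: _ \<Rightarrow> real)"
        unfolding determined_by_def
      proof (intro ballI impI)
        fix \<omega> \<omega>' assume "\<omega> \<in> space P" "\<omega>' \<in> space P" "\<omega> \<inter> A = \<omega>' \<inter> A"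
        then show "indicator S \<omega> = (indicator S \<omega>' :: real)"
          using num_points_cong[of \<omega> A \<omega>' A] by (simp add: S indicator_def)
      qed
      with False S_int A show ?thesis
        unfolding approximable_def
        by (intro conjI allI impI bexI[of _ A] exI[of _ "indicator S"]) (auto simp: less_top)
    qed
  next
    case Empty
    show ?case by (rule approximable_AE_const[of _ 0]) auto
  next
    case (Compl S)
    have "S \<in> sets P" using Compl.hyps unfolding sets_P sets_config_space .
    have one: "approximable (\<lambda>_. 1)" by (rule approximable_AE_const[of _ 1]) auto
    have "approximable (\<lambda>\<omega>. 1 - indicator S \<omega>)"
      by (rule approximable_Lipschitz[OF one Compl.IH, where \<phi> = "\<lambda>a b. a - b"]) auto
    moreover have "1 - indicator S \<omega> = (indicator (configurations (space M) - S) \<omega> :: real)"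
      if "\<omega> \<in> space P" for \<omega>
      using that by (auto simp: indicator_def space_P)
    ultimately show ?case by (rule approximable_cong)
  next
    case (Union S)
    have S: "S i \<in> sets P" for i using Union.hyps unfolding sets_P sets_config_space .
    have "approximable (indicator (\<Union>k<i. S k))" for i :: nat
    proof (induction i)
      case 0
      show ?case by (rule approximable_AE_const[of _ 0]) auto
    next
      case (Suc i)
      have "approximable (\<lambda>\<omega>. max (indicator (\<Union>k<i. S k) \<omega>) (indicator (S i) \<omega>))"
      proof (rule approximable_Lipschitz[OF Suc Union.IH, where \<phi> = max])
        show "\<bar>max a b - max a' b'\<bar> \<le> \<bar>a - a'\<bar> + \<bar>b - b'\<bar>" for a b a' b' :: real
          by (auto simp: max_def)
      qed (rule Bochner_Integration.integrable_max)
      moreover have "(\<lambda>\<omega>. max (indicator (\<Union>k<i. S k) \<omega>) (indicator (S i) \<omega>)) =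
          (indicator (\<Union>k<Suc i. S k) :: _ \<Rightarrow> real)"
      proof (rule ext)
        fix \<omega>
        have "(\<Union>k<Suc i. S k) = S i \<union> (\<Union>k<i. S k)" by (simp only: lessThan_Suc UN_insert)
        then show "max (indicator (\<Union>k<i. S k) \<omega>) (indicator (S i) \<omega>) =
            (indicator (\<Union>k<Suc i. S k) \<omega> :: real)"
          by (cases "\<omega> \<in> S i"; cases "\<omega> \<in> (\<Union>k<i. S k)") (simp_all only: indicator_def Un_iff, simp_all)
      qed
      ultimately show ?case by simp
    qed
    then show ?case
    proof (rule approximable_lim[where s = "\<lambda>i. indicator (\<Union>k<i. S k)" and g = "\<lambda>_. 1"])
      show "(\<lambda>i. indicator (\<Union>k<i. S k) \<omega>) \<longlonglongrightarrow> (indicator (\<Union>i. S i) \<omega> :: real)" for \<omega>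
      by (rule LIMSEQ_indicator_UN)
      show "integrable P (indicator (\<Union>i. S i) :: _ \<Rightarrow> real)"
      by (rule int, rule sets.countable_UN) (use S in auto)
      show "\<bar>indicator (\<Union>k<i. S k) \<omega>\<bar> \<le> (1::real)" for i and \<omega> :: "'a set"
      by (simp add: indicator_def)
    qed simp
  qed
qed

lemma approximable_integrable:
  fixes f :: "'a set \<Rightarrow> real"
  assumes "integrable P f"
  shows "approximable f"
  using assms
proof (induction rule: integrable_induct)
  case (base A a)
  show ?case
    using approximable_scale[OF approximable_indicator[OF base(1)], of a] by (simp add: mult.commute)
next
  case (add f g)
  show ?case
    by (rule approximable_Lipschitz[OF add.IH, where \<phi> = "\<lambda>a b. a + b"]) auto
next
  case (lim f s)
  show ?case
  proof (rule approximable_lim[where s = s and g = "\<lambda>\<omega>. 2 * \<bar>f \<omega>\<bar>"])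
    show "approximable (s i)" for i by (rule lim.IH)
    show "(\<lambda>i. s i \<omega>) \<longlonglongrightarrow> f \<omega>" if "\<omega> \<in> space P" for \<omega> using that by (rule lim.hyps)
    show "\<bar>s i \<omega>\<bar> \<le> 2 * \<bar>f \<omega>\<bar>" if "\<omega> \<in> space P" for i \<omega>
      using lim.hyps(3)[OF that, of i] by simp
    show "integrable P f" by (rule lim.hyps)
    then show "integrable P (\<lambda>\<omega>. 2 * \<bar>f \<omega>\<bar>)" by simp
  qed
qed

end

section \<open>The covariance inequality\<close>

context poisson_covariance
begin

lemma integrable_H: "integrable P H"
  using H_nonneg H_le by (intro integrable_const_bound[where B = d]) auto

lemma integrable_Z: "integrable P Z"
  using Z_nonneg Z_le by (intro integrable_const_bound[where B = c]) auto

lemma integrable_determined_product: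
  assumes f: "integrable P f" and [measurable]: "B \<in> sets M"
  shows "integrable (P \<Otimes>\<^sub>M P) (\<lambda>p. f (fst p) * H (exchange B (fst p) (snd p)))"
proof (rule Bochner_Integration.integrable_bound)
  have [measurable]: "f \<in> borel_measurable (config_space M)"
    using borel_measurable_integrable[OF f] by (simp add: measurable_cong_sets[OF sets_P refl])
  show "(\<lambda>p. f (fst p) * H (exchange B (fst p) (snd p))) \<in> borel_measurable (P \<Otimes>\<^sub>M P)"
    by measurable
  have "integrable (distr (P \<Otimes>\<^sub>M P) P fst) f" using f by (simp add: distr_pair_fst)
  then have "integrable (P \<Otimes>\<^sub>M P) (\<lambda>p. f (fst p))" by (rule integrable_distr[OF measurable_fst])
  then show "integrable (P \<Otimes>\<^sub>M P) (\<lambda>p. f (fst p) * d)" by simp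
  show "AE p in P \<Otimes>\<^sub>M P. norm (f (fst p) * H (exchange B (fst p) (snd p))) \<le> norm (f (fst p) * d)"
    using H_nonneg H_le d_nonneg by (intro AE_I2) (simp add: abs_mult mult_left_mono)
qed

text \<open>The reversed exchange agrees with the first configuration on \<open>B\<close>, and
  \<open>f\<close> sees nothing else. The integrand is therefore a product of functions of the two
  exchanged configurations, which are independent with law \<open>P\<close>.\<close>

lemma integral_determined_product:
  assumes f: "integrable P f" "determined_by B f" and B [measurable]: "B \<in> sets M"
  shows "(\<integral>p. f (fst p) * H (exchange B (fst p) (snd p)) \<partial>(P \<Otimes>\<^sub>M P)) = (\<integral>\<omega>. f \<omega> \<partial>P) * (\<integral>\<omega>. H \<omega> \<partial>P)"
proof -
  have [measurable]: "f \<in> borel_measurable (config_space M)"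
    using borel_measurable_integrable[OF f(1)] by (simp add: measurable_cong_sets[OF sets_P refl])
  let ?g = "\<lambda>p. H (fst p) * f (snd p)"
  have g [measurable]: "?g \<in> borel_measurable (P \<Otimes>\<^sub>M P)" by measurable
  have g_int: "integrable (P \<Otimes>\<^sub>M P) ?g"
  proof (rule PP.Fubini_integrable[OF g])
    show "integrable P (\<lambda>\<omega>. \<integral>\<omega>'. norm (?g (\<omega>, \<omega>')) \<partial>P)"
      using integrable_H by (simp add: abs_mult)
    show "AE \<omega> in P. integrable P (\<lambda>\<omega>'. ?g (\<omega>, \<omega>'))" using f by simp
  qed
  have "(\<integral>p. f (fst p) * H (exchange B (fst p) (snd p)) \<partial>(P \<Otimes>\<^sub>M P)) =
      (\<integral>p. ?g (exchange B (fst p) (snd p), exchange B (snd p) (fst p)) \<partial>(P \<Otimes>\<^sub>M P))"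
  proof (rule Bochner_Integration.integral_cong[OF refl])
    fix p assume "p \<in> space (P \<Otimes>\<^sub>M P)"
    then have sp: "fst p \<in> space P" "exchange B (snd p) (fst p) \<in> space P"
      by (auto simp: space_pair_measure space_P exchange_in_configurations)
    have "fst p \<inter> B = exchange B (snd p) (fst p) \<inter> B" by (auto simp: exchange_def)
    with sp f(2) have "f (fst p) = f (exchange B (snd p) (fst p))"
      unfolding determined_by_def by blast
    then show "f (fst p) * H (exchange B (fst p) (snd p)) =
        ?g (exchange B (fst p) (snd p), exchange B (snd p) (fst p))"
      by (simp add: mult.commute)
  qed
  also have "\<dots> = (\<integral>p. ?g p \<partial>(P \<Otimes>\<^sub>M P))" by (rule integral_exchange_pair[OF g B])
  also have "\<dots> = (\<integral>\<omega>. \<integral>\<omega>'. ?g (\<omega>, \<omega>') \<partial>P \<partial>P)" by (rule PP.integral_fst'[OF g_int, symmetric])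
  also have "\<dots> = (\<integral>\<omega>. f \<omega> \<partial>P) * (\<integral>\<omega>. H \<omega> \<partial>P)" by simp
  finally show ?thesis .
qed

text \<open>\<open>Z\<close> is replaced by a functional determined by \<open>B\<close>, for which
  the mixed integral factorizes. The error occurs twice, in the mixed integral and in the product of
  means, and \<open>H\<close> contributes at most \<open>d\<close> each time.\<close>

lemma mixed_approximation:
  assumes "0 < \<epsilon>"
  obtains B where "B \<in> sets M" "emeasure M B < \<infinity>"
    "\<bar>mixed B - (\<integral>\<omega>. Z \<omega> \<partial>P) * (\<integral>\<omega>. H \<omega> \<partial>P)\<bar> \<le> 2 * d * \<epsilon>"
proof -
  obtain B f where B: "B \<in> sets M" "emeasure M B < \<infinity>" and f: "integrable P f" "determined_by B f"
    and close: "(\<integral>\<omega>. \<bar>Z \<omega> - f \<omega>\<bar> \<partial>P) < \<epsilon>"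
    by (rule approximableE[OF approximable_integrable[OF integrable_Z] assms])
  let ?e = "\<integral>\<omega>. \<bar>Z \<omega> - f \<omega>\<bar> \<partial>P"
  have int_abs: "integrable P (\<lambda>\<omega>. \<bar>Z \<omega> - f \<omega>\<bar>)" using f integrable_Z by simp
  have H_mean: "0 \<le> (\<integral>\<omega>. H \<omega> \<partial>P)" "(\<integral>\<omega>. H \<omega> \<partial>P) \<le> d"
    using H_nonneg H_le integrable_H
    by (auto intro!: integral_nonneg_AE integral_le_const)
  have "mixed B - (\<integral>\<omega>. f \<omega> \<partial>P) * (\<integral>\<omega>. H \<omega> \<partial>P) =
      (\<integral>p. (Z (fst p) - f (fst p)) * H (exchange B (fst p) (snd p)) \<partial>(P \<Otimes>\<^sub>M P))"
    unfolding mixed_def integral_determined_product[OF f B(1), symmetric] left_diff_distrib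
    by (rule Bochner_Integration.integral_diff[symmetric])
      (intro integrable_determined_product integrable_Z f B)+
  also have "\<bar>\<dots>\<bar> \<le> (\<integral>p. \<bar>(Z (fst p) - f (fst p)) * H (exchange B (fst p) (snd p))\<bar> \<partial>(P \<Otimes>\<^sub>M P))"
    by (rule integral_abs_bound)
  also have "\<dots> \<le> (\<integral>p. \<bar>Z (fst p) - f (fst p)\<bar> * d \<partial>(P \<Otimes>\<^sub>M P))"
  proof (rule integral_mono)
    show "integrable (P \<Otimes>\<^sub>M P) (\<lambda>p. \<bar>(Z (fst p) - f (fst p)) * H (exchange B (fst p) (snd p))\<bar>)"
      by (intro integrable_abs integrable_determined_product Bochner_Integration.integrable_diff integrable_Z f B)
    have "integrable (distr (P \<Otimes>\<^sub>M P) P fst) (\<lambda>\<omega>. \<bar>Z \<omega> - f \<omega>\<bar>)" using int_abs by (simp add: distr_pair_fst)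
    from integrable_distr[OF measurable_fst this]
    show "integrable (P \<Otimes>\<^sub>M P) (\<lambda>p. \<bar>Z (fst p) - f (fst p)\<bar> * d)" by simp
  qed (use H_nonneg H_le in \<open>simp add: abs_mult mult_left_mono\<close>)
  also have "\<dots> = (\<integral>p. \<bar>Z (fst p) - f (fst p)\<bar> \<partial>(P \<Otimes>\<^sub>M P)) * d" by simp
  also have "(\<integral>p. \<bar>Z (fst p) - f (fst p)\<bar> \<partial>(P \<Otimes>\<^sub>M P)) = (\<integral>\<omega>. \<bar>Z \<omega> - f \<omega>\<bar> \<partial>distr (P \<Otimes>\<^sub>M P) P fst)"
    by (rule integral_distr[symmetric, OF measurable_fst])
      (use int_abs in \<open>rule borel_measurable_integrable\<close>)
  also have "\<dots> = ?e" by (simp add: distr_pair_fst)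
  finally have 1: "\<bar>mixed B - (\<integral>\<omega>. f \<omega> \<partial>P) * (\<integral>\<omega>. H \<omega> \<partial>P)\<bar> \<le> ?e * d" .
  have "\<bar>(\<integral>\<omega>. f \<omega> \<partial>P) - (\<integral>\<omega>. Z \<omega> \<partial>P)\<bar> \<le> ?e"
    using integral_abs_bound[of P "\<lambda>\<omega>. Z \<omega> - f \<omega>"] f integrable_Z by (simp add: abs_minus_commute)
  then have "\<bar>(\<integral>\<omega>. f \<omega> \<partial>P) * (\<integral>\<omega>. H \<omega> \<partial>P) - (\<integral>\<omega>. Z \<omega> \<partial>P) * (\<integral>\<omega>. H \<omega> \<partial>P)\<bar> \<le> ?e * d"
    unfolding left_diff_distrib[symmetric] abs_mult using H_mean by (intro mult_mono) auto
  with 1 have "\<bar>mixed B - (\<integral>\<omega>. Z \<omega> \<partial>P) * (\<integral>\<omega>. H \<omega> \<partial>P)\<bar> \<le> 2 * d * ?e"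
    by (simp add: algebra_simps)
  also have "\<dots> \<le> 2 * d * \<epsilon>" using close d_nonneg by (intro mult_left_mono) auto
  finally show ?thesis using that B by blast
qed

theorem covariance_le:
  assumes \<kappa>: "0 \<le> \<kappa>" "\<And>\<omega>. \<omega> \<in> space P \<Longrightarrow> (\<integral>\<^sup>+y. \<rho> \<omega> y \<partial>M) \<le> ennreal \<kappa>"
    and partition: "\<And>B \<epsilon>. B \<in> sets M \<Longrightarrow> emeasure M B < \<infinity> \<Longrightarrow> 0 < \<epsilon> \<Longrightarrow>
      \<exists>\<C>. finite \<C> \<and> disjoint \<C> \<and> \<C> \<subseteq> sets M \<and> \<Union>\<C> = B \<and> (\<forall>C\<in>\<C>. measure M C \<le> \<epsilon>)"
  shows "(\<integral>\<omega>. Z \<omega> * H \<omega> \<partial>P) - (\<integral>\<omega>. Z \<omega> \<partial>P) * (\<integral>\<omega>. H \<omega> \<partial>P) \<le> \<kappa> * (\<integral>\<omega>. H \<omega> \<partial>P)"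
proof (rule field_le_epsilon)
  fix e :: real assume "0 < e"
  \<comment> \<open>Half of \<open>e\<close> is reserved for the approximation of \<open>Z\<close>;
    the summand 1 prevents a division by 0.\<close>
  define \<epsilon> where "\<epsilon> = e / (4 * (d + 1))"
  have \<epsilon>: "0 < \<epsilon>" "2 * d * \<epsilon> \<le> e / 2"
    using \<open>0 < e\<close> d_nonneg by (auto simp: \<epsilon>_def field_simps)
  obtain B where B: "B \<in> sets M" "emeasure M B < \<infinity>"
    "\<bar>mixed B - (\<integral>\<omega>. Z \<omega> \<partial>P) * (\<integral>\<omega>. H \<omega> \<partial>P)\<bar> \<le> 2 * d * \<epsilon>"
    by (rule mixed_approximation[OF \<epsilon>(1)])
  \<comment> \<open>The other half of \<open>e\<close> is for the quadratic errors of the cells,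
    whose sum is linear in the mesh \<delta>. The set \<open>B\<close> has to be chosen before the
    mesh.\<close>
  define \<delta> where "\<delta> = e / (4 * (c * d * measure M B + 1))"
  have cdB: "0 \<le> c * d * measure M B" using c_nonneg d_nonneg by simp
  have \<delta>: "0 < \<delta>" "2 * c * d * measure M B * \<delta> \<le> e / 2"
    using \<open>0 < e\<close> cdB by (auto simp: \<delta>_def field_simps intro: add_nonneg_pos)
  obtain \<C> where \<C>: "finite \<C>" "disjoint \<C>" "\<C> \<subseteq> sets M" "\<Union>\<C> = B"
    and small: "\<And>C. C \<in> \<C> \<Longrightarrow> measure M C \<le> \<delta>"
    using partition[OF B(1,2) \<delta>(1)] by blast
  have fin: "emeasure M C < \<infinity>" if "C \<in> \<C>" for C
  proof -
    have "emeasure M C \<le> emeasure M B" using that \<C> B by (intro emeasure_mono) auto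
    then show ?thesis using B(2) by simp
  qed
  have H_mean: "0 \<le> (\<integral>\<omega>. H \<omega> \<partial>P)" using H_nonneg by (intro integral_nonneg_AE) simp
  have sum_measure: "(\<Sum>C\<in>\<C>. measure M C) = measure M B"
  proof -
    have "measure M (\<Union>C\<in>\<C>. C) = (\<Sum>C\<in>\<C>. measure M C)"
      using \<C> fin by (intro measure_finite_Union) (auto simp: disjoint_family_on_def disjoint_def less_top)
    then show ?thesis using \<C>(4) by simp
  qed
  have "ennreal (mixed {} - mixed B) \<le>
      ennreal \<kappa> * ennreal (\<integral>\<omega>. H \<omega> \<partial>P) + ennreal (\<Sum>C\<in>\<C>. 2 * c * d * (measure M C)\<^sup>2)"
    using mixed_partition_bound[OF \<C>(1-3) fin \<kappa>(2)] \<C>(4) by simp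
  also have "\<dots> = ennreal (\<kappa> * (\<integral>\<omega>. H \<omega> \<partial>P) + (\<Sum>C\<in>\<C>. 2 * c * d * (measure M C)\<^sup>2))"
    using \<kappa>(1) H_mean c_nonneg d_nonneg by (simp add: ennreal_mult ennreal_plus sum_nonneg)
  finally have "mixed {} - mixed B \<le> \<kappa> * (\<integral>\<omega>. H \<omega> \<partial>P) + (\<Sum>C\<in>\<C>. 2 * c * d * (measure M C)\<^sup>2)"
    using \<kappa>(1) H_mean c_nonneg d_nonneg by (subst (asm) ennreal_le_iff) (auto intro!: add_nonneg_nonneg sum_nonneg)
  moreover have "(\<Sum>C\<in>\<C>. 2 * c * d * (measure M C)\<^sup>2) \<le> e / 2"
  proof -
    have "(\<Sum>C\<in>\<C>. 2 * c * d * (measure M C)\<^sup>2) \<le> (\<Sum>C\<in>\<C>. 2 * c * d * (measure M C * \<delta>))"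
      unfolding power2_eq_square using small c_nonneg d_nonneg
      by (intro sum_mono mult_left_mono) auto
    also have "\<dots> = 2 * c * d * measure M B * \<delta>"
      by (simp add: sum_distrib_left[symmetric] sum_distrib_right[symmetric] sum_measure)
    finally show ?thesis using \<delta>(2) by simp
  qed
  ultimately show "(\<integral>\<omega>. Z \<omega> * H \<omega> \<partial>P) - (\<integral>\<omega>. Z \<omega> \<partial>P) * (\<integral>\<omega>. H \<omega> \<partial>P) \<le> \<kappa> * (\<integral>\<omega>. H \<omega> \<partial>P) + e"
    using B(3) \<epsilon>(2) mixed_empty by linarith
qed

end

section \<open>From covariances to tail estimates\<close>

text \<open>The superlevel sets of a monotone function are intervals.\<close>

lemma borel_measurable_mono_ennreal:
  fixes f :: "real \<Rightarrow> ennreal"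
  assumes "mono f"
  shows "f \<in> borel_measurable borel"
proof (rule borel_measurableI_greater)
  fix a :: ennreal
  have "is_interval {x. a < f x}"
    unfolding is_interval_1 using assms by (auto simp: mono_def intro: less_le_trans)
  then have "{x. a < f x} \<in> sets borel" by (rule real_interval_borel_measurable)
  then show "{x \<in> space borel. a < f x} \<in> sets borel" by simp
qed

lemma exp_quadratic_bound:
  fixes a u :: real
  assumes "\<bar>a\<bar> \<le> c" "\<bar>u\<bar> \<le> 1"
  shows "\<bar>exp (u * a) - 1 - u * a\<bar> \<le> u\<^sup>2 * (c\<^sup>2 * exp c)"
proof -
  obtain \<xi> where \<xi>: "\<bar>\<xi>\<bar> \<le> \<bar>u * a\<bar>" "exp (u * a) = (\<Sum>m<2. (u * a) ^ m / fact m) + exp \<xi> / fact 2 * (u * a) ^ 2"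
    using Maclaurin_exp_le[of "u * a" 2] by blast
  have ua: "\<bar>u * a\<bar> \<le> c" using assms mult_mono[of "\<bar>u\<bar>" 1 "\<bar>a\<bar>" c] by (simp add: abs_mult)
  have "exp (u * a) - 1 - u * a = exp \<xi> / 2 * (u * a)\<^sup>2"
    using \<xi>(2) by (simp add: eval_nat_numeral)
  moreover have "0 \<le> exp \<xi> / 2 * (u * a)\<^sup>2" by simp
  ultimately have "\<bar>exp (u * a) - 1 - u * a\<bar> = exp \<xi> / 2 * (u * a)\<^sup>2" by (simp only: abs_of_nonneg)
  also have "\<dots> = u\<^sup>2 * (exp \<xi> / 2 * a\<^sup>2)" by (simp add: power_mult_distrib)
  also have "\<dots> \<le> u\<^sup>2 * (exp c * c\<^sup>2)"
  proof (intro mult_left_mono mult_mono)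
    have "exp \<xi> \<le> exp c" using \<xi>(1) ua by simp
    then show "exp \<xi> / 2 \<le> exp c" using exp_gt_zero[of c] by linarith
    show "a\<^sup>2 \<le> c\<^sup>2" using assms(1) power_mono[of "\<bar>a\<bar>" c 2] by simp
  qed auto
  finally show ?thesis by (simp add: mult.commute)
qed

text \<open>This replaces differentiation under the integral sign: for bounded \<open>Z\<close> the
  Taylor error of the exponential can be integrated directly.\<close>

lemma DERIV_quadratic_error:
  fixes f :: "real \<Rightarrow> real"
  assumes "\<And>u. \<bar>u\<bar> \<le> 1 \<Longrightarrow> \<bar>f (x + u) - f x - u * D\<bar> \<le> u\<^sup>2 * K"
  shows "DERIV f x :> D"
  unfolding DERIV_def
proof (rule LIM_I)
  fix r :: real assume "0 < r"
  define s where "s = min 1 (r / (\<bar>K\<bar> + 1))"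
  have "0 < s" using \<open>0 < r\<close> by (simp add: s_def)
  moreover have "norm ((f (x + u) - f x) / u - D) < r" if "u \<noteq> 0 \<and> norm (u - 0) < s" for u
  proof -
    have u: "u \<noteq> 0" "\<bar>u\<bar> \<le> 1" "\<bar>u\<bar> < r / (\<bar>K\<bar> + 1)" using that by (auto simp: s_def)
    have "((f (x + u) - f x) / u - D) * u = f (x + u) - f x - u * D"
      using u(1) by (simp add: field_simps)
    then have "\<bar>(f (x + u) - f x) / u - D\<bar> * \<bar>u\<bar> = \<bar>f (x + u) - f x - u * D\<bar>"
      by (simp only: abs_mult[symmetric])
    also have "\<dots> \<le> u\<^sup>2 * K" by (rule assms[OF u(2)])
    also have "\<dots> \<le> u\<^sup>2 * \<bar>K\<bar>" by (intro mult_left_mono) auto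
    also have "u\<^sup>2 = \<bar>u\<bar> * \<bar>u\<bar>" by (simp add: power2_eq_square)
    also have "\<bar>u\<bar> * \<bar>u\<bar> * \<bar>K\<bar> = (\<bar>u\<bar> * \<bar>K\<bar>) * \<bar>u\<bar>" by (simp only: mult_ac)
    finally have "\<bar>(f (x + u) - f x) / u - D\<bar> \<le> \<bar>u\<bar> * \<bar>K\<bar>"
      by (rule mult_right_le_imp_le) (use u(1) in simp)
    also have "\<dots> \<le> \<bar>u\<bar> * (\<bar>K\<bar> + 1)" by (intro mult_left_mono) auto
    also have "\<dots> < r" using u(3) by (simp add: pos_less_divide_eq)
    finally show ?thesis by simp
  qed
  ultimately show "\<exists>s>0. \<forall>u. u \<noteq> 0 \<and> norm (u - 0) < s \<longrightarrow> norm ((f (x + u) - f x) / u - D) < r" by blast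
qed

section \<open>The generalized inverse and a Young inequality\<close>

lemma gen_inverse_nonneg:
  assumes "0 < t\<^sub>1" "ennreal s \<le> h t\<^sub>1"
  shows "0 \<le> gen_inverse h s"
  unfolding gen_inverse_def using assms by (intro cInf_greatest) auto

lemma gen_inverse_le:
  assumes "0 < t" "ennreal s \<le> h t"
  shows "gen_inverse h s \<le> t"
  unfolding gen_inverse_def using assms by (intro cInf_lower) (auto intro!: bdd_belowI[of _ 0])

text \<open>A larger \<open>s\<close> leaves fewer admissible \<open>t\<close>. The witness
  \<open>t\<^sub>1\<close> keeps the set for \<open>x\<close> nonempty; otherwise its real infimum
  would be an arbitrary value.\<close>

lemma gen_inverse_mono:
  assumes "s \<le> x" "0 < t\<^sub>1" "ennreal x \<le> h t\<^sub>1"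
  shows "gen_inverse h s \<le> gen_inverse h x"
  unfolding gen_inverse_def using assms ennreal_leI[OF assms(1)]
  by (intro cInf_superset_mono) (auto intro!: bdd_belowI[of _ 0] intro: order_trans)

text \<open>The regions below the graphs of \<open>h\<close> and of its inverse are disjoint subsets of the rectangle
  with sides \<open>x\<close> and \<open>gen_inverse h x\<close>.\<close>

lemma Young_gen_inverse:
  fixes h :: "real \<Rightarrow> ennreal"
  assumes [measurable]: "h \<in> borel_measurable borel" and t: "0 < t\<^sub>1" "ennreal x \<le> h t\<^sub>1" and "0 \<le> x"
  shows "(\<integral>\<^sup>+s. ennreal (gen_inverse h s) * indicator {0..x} s \<partial>lborel) +
    (\<integral>\<^sup>+t. h t * indicator {0<..<gen_inverse h x} t \<partial>lborel) \<le> ennreal (x * gen_inverse h x)"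
proof -
  let ?g = "gen_inverse h"
  define T where "T = ?g x"
  have T: "0 \<le> T" unfolding T_def by (rule gen_inverse_nonneg[of t\<^sub>1 x h, OF t])
  have below: "h t < ennreal s" if "0 < t" "t < ?g s" for s t
    using gen_inverse_le[of t s h] that by (meson leD leI)
  have "(\<integral>\<^sup>+s. ennreal (?g s) * indicator {0..x} s \<partial>lborel) \<le>
      (\<integral>\<^sup>+s. \<integral>\<^sup>+t. indicator {0<..<T} t * indicator {s. h t < ennreal s \<and> s \<le> x} s \<partial>lborel \<partial>lborel)"
  proof (rule nn_integral_mono)
    fix s :: real
    show "ennreal (?g s) * indicator {0..x} s \<le>
      (\<integral>\<^sup>+t. indicator {0<..<T} t * indicator {s. h t < ennreal s \<and> s \<le> x} s \<partial>lborel)"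
    proof (cases "s \<in> {0..x}")
      case True
      then have s: "s \<le> x" "ennreal s \<le> h t\<^sub>1" using order_trans[OF ennreal_leI t(2), of s] by auto
      have "0 \<le> ?g s" by (rule gen_inverse_nonneg[of t\<^sub>1 s h, OF t(1) s(2)])
      then have "ennreal (?g s) = emeasure lborel {0<..<?g s}" by simp
      also have "\<dots> = (\<integral>\<^sup>+t. indicator {0<..<?g s} t \<partial>lborel)" by simp
      also have "\<dots> \<le> (\<integral>\<^sup>+t. indicator {0<..<T} t * indicator {s. h t < ennreal s \<and> s \<le> x} s \<partial>lborel)"
      proof (rule nn_integral_mono)
        fix t
        show "indicator {0<..<?g s} t \<le>
          (indicator {0<..<T} t * indicator {s. h t < ennreal s \<and> s \<le> x} s :: ennreal)"
          using below[of t s] gen_inverse_mono[of s x t\<^sub>1 h, OF s(1) t] s(1)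
          by (auto simp: indicator_def T_def)
      qed
      finally show ?thesis using True by simp
    qed simp
  qed
  \<comment> \<open>In this order the inner integral is the length of the interval between
    \<open>h t\<close> and \<open>x\<close>, which complements \<open>h t\<close> to
    \<open>x\<close>.\<close>
  also have "\<dots> = (\<integral>\<^sup>+t. \<integral>\<^sup>+s. indicator {0<..<T} t * indicator {s. h t < ennreal s \<and> s \<le> x} s \<partial>lborel \<partial>lborel)"
  proof (rule lborel_pair.Fubini')
    show "(\<lambda>(t, s). indicator {0<..<T} t * indicator {s. h t < ennreal s \<and> s \<le> x} s :: ennreal)
        \<in> borel_measurable (lborel \<Otimes>\<^sub>M lborel)"
      unfolding indicator_def by measurable
  qed
  also have "\<dots> = (\<integral>\<^sup>+t. (ennreal x - h t) * indicator {0<..<T} t \<partial>lborel)"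
  proof (rule nn_integral_cong)
    fix t :: real
    show "(\<integral>\<^sup>+s. indicator {0<..<T} t * indicator {s. h t < ennreal s \<and> s \<le> x} s \<partial>lborel) =
        (ennreal x - h t) * indicator {0<..<T} t"
    proof (cases "t \<in> {0<..<T}")
      case True
      then have "h t < ennreal x" using below[of t x] by (simp add: T_def)
      then obtain r where r: "h t = ennreal r" "0 \<le> r" "r \<le> x"
        by (cases "h t") (auto simp: ennreal_less_iff)
      have "{s. h t < ennreal s \<and> s \<le> x} = {r<..x}" using r by (auto simp: ennreal_less_iff)
      then have "(\<integral>\<^sup>+s. indicator {s. h t < ennreal s \<and> s \<le> x} s \<partial>lborel) = emeasure lborel {r<..x}"
        by (simp add: nn_integral_indicator)
      also have "\<dots> = ennreal x - h t" using r by (simp add: ennreal_minus)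
      finally show ?thesis using True by simp
    qed simp
  qed
  finally have "(\<integral>\<^sup>+s. ennreal (?g s) * indicator {0..x} s \<partial>lborel) +
      (\<integral>\<^sup>+t. h t * indicator {0<..<T} t \<partial>lborel) \<le>
      (\<integral>\<^sup>+t. (ennreal x - h t) * indicator {0<..<T} t \<partial>lborel) + (\<integral>\<^sup>+t. h t * indicator {0<..<T} t \<partial>lborel)"
    by (rule add_right_mono)
  also have "\<dots> = (\<integral>\<^sup>+t. (ennreal x - h t) * indicator {0<..<T} t + h t * indicator {0<..<T} t \<partial>lborel)"
    by (rule nn_integral_add[symmetric]) measurable
  also have "\<dots> = (\<integral>\<^sup>+t. ennreal x * indicator {0<..<T} t \<partial>lborel)"
  proof (rule nn_integral_cong)
    fix t :: real
    show "(ennreal x - h t) * indicator {0<..<T} t + h t * indicator {0<..<T} t =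
        ennreal x * indicator {0<..<T} t"
      using below[of t x] by (auto simp: indicator_def T_def diff_add_cancel_ennreal)
  qed
  also have "\<dots> = ennreal (x * T)"
    using T \<open>0 \<le> x\<close> by (simp add: nn_integral_cmult ennreal_mult)
  finally show ?thesis by (simp only: T_def)
qed

context prob_space
begin

text \<open>Herbst's argument: \<open>cov\<close> bounds the derivative of the logarithm of the
  Laplace transform by the mean plus \<open>h\<close>. Integration up to the inverse of
  \<open>h\<close> at \<open>x\<close> and Markov's inequality give an exponent that
  \<open>Young_gen_inverse\<close> identifies.\<close>

lemma deviation_bound:
  fixes Z :: "'a \<Rightarrow> real" and h :: "real \<Rightarrow> ennreal"
  assumes Z [measurable]: "Z \<in> borel_measurable M" and Z_nonneg: "\<And>\<omega>. 0 \<le> Z \<omega>" and Z_le: "\<And>\<omega>. Z \<omega> \<le> c"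
    and h: "mono h" and t\<^sub>1: "0 < t\<^sub>1" "ennreal x \<le> h t\<^sub>1" and x: "0 \<le> x"
    and cov: "\<And>t. 0 \<le> t \<Longrightarrow> t \<le> t\<^sub>1 \<Longrightarrow>
      ennreal (expectation (\<lambda>\<omega>. Z \<omega> * exp (t * Z \<omega>)) - expectation Z * expectation (\<lambda>\<omega>. exp (t * Z \<omega>)))
        \<le> h t * ennreal (expectation (\<lambda>\<omega>. exp (t * Z \<omega>)))"
  shows "prob {\<omega> \<in> space M. expectation Z + x \<le> Z \<omega>} \<le> exp (- (LBINT s:{0..x}. gen_inverse h s))"
proof -
  define m where "m t = expectation (\<lambda>\<omega>. exp (t * Z \<omega>))" for t
  define m' where "m' t = expectation (\<lambda>\<omega>. Z \<omega> * exp (t * Z \<omega>))" for t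
  have h_meas [measurable]: "h \<in> borel_measurable borel" using h by (rule borel_measurable_mono_ennreal)
  have abs_Z: "\<bar>Z \<omega>\<bar> \<le> c" for \<omega> using Z_nonneg[of \<omega>] Z_le[of \<omega>] by simp
  have c: "0 \<le> c" using order_trans[OF Z_nonneg Z_le] .
  have exp_bound: "exp (t * Z \<omega>) \<le> exp (\<bar>t\<bar> * c)" for t \<omega>
  proof -
    have "t * Z \<omega> \<le> \<bar>t\<bar> * \<bar>Z \<omega>\<bar>" using abs_ge_self[of "t * Z \<omega>"] by (simp add: abs_mult)
    also have "\<dots> \<le> \<bar>t\<bar> * c" by (intro mult_left_mono abs_Z) simp
    finally show ?thesis by simp
  qed
  have int_exp: "integrable M (\<lambda>\<omega>. exp (t * Z \<omega>))" for t
    using exp_bound by (intro integrable_const_bound[where B = "exp (\<bar>t\<bar> * c)"]) auto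
  have int_Zexp: "integrable M (\<lambda>\<omega>. Z \<omega> * exp (t * Z \<omega>))" for t
    using exp_bound Z_nonneg Z_le c
    by (intro integrable_const_bound[where B = "c * exp (\<bar>t\<bar> * c)"]) (auto simp: abs_mult intro!: AE_I2 mult_mono)
  have int_Z: "integrable M Z" using abs_Z by (intro integrable_const_bound[where B = c]) auto
  have Z_mean: "0 \<le> expectation Z" using Z_nonneg by (intro integral_nonneg_AE) simp
  have m_pos: "0 < m t" for t
  proof -
    have "expectation (\<lambda>_. exp (- (\<bar>t\<bar> * c))) \<le> m t"
      unfolding m_def
    proof (intro integral_mono int_exp)
      fix \<omega>
      have "- (t * Z \<omega>) \<le> \<bar>t\<bar> * \<bar>Z \<omega>\<bar>" using abs_ge_minus_self[of "t * Z \<omega>"] by (simp add: abs_mult)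
      also have "\<dots> \<le> \<bar>t\<bar> * c" by (intro mult_left_mono abs_Z) simp
      finally show "exp (- (\<bar>t\<bar> * c)) \<le> exp (t * Z \<omega>)" by simp
    qed simp
    then have "exp (- (\<bar>t\<bar> * c)) \<le> m t" by (simp add: prob_space)
    then show ?thesis by (rule less_le_trans[OF exp_gt_zero])
  qed
  have m'_nonneg: "0 \<le> m' t" for t
    unfolding m'_def using Z_nonneg by (intro integral_nonneg_AE) auto
  have deriv: "DERIV m t :> m' t" for t
  proof (rule DERIV_quadratic_error)
    fix u :: real assume u: "\<bar>u\<bar> \<le> 1"
    have expand: "exp (t * Z \<omega>) * (exp (u * Z \<omega>) - 1 - u * Z \<omega>) =
        exp ((t + u) * Z \<omega>) - exp (t * Z \<omega>) - u * (Z \<omega> * exp (t * Z \<omega>))" for \<omega>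
      by (simp only: distrib_right exp_add) (simp add: right_diff_distrib)
    have "m (t + u) - m t - u * m' t = expectation (\<lambda>\<omega>. exp (t * Z \<omega>) * (exp (u * Z \<omega>) - 1 - u * Z \<omega>))"
      unfolding m_def m'_def expand using int_exp int_Zexp by simp
    also have "\<bar>\<dots>\<bar> \<le> expectation (\<lambda>\<omega>. \<bar>exp (t * Z \<omega>) * (exp (u * Z \<omega>) - 1 - u * Z \<omega>)\<bar>)"
      by (rule integral_abs_bound)
    also have "\<dots> \<le> expectation (\<lambda>\<omega>. exp (t * Z \<omega>) * (u\<^sup>2 * (c\<^sup>2 * exp c)))"
    proof (rule integral_mono)
      show "\<bar>exp (t * Z \<omega>) * (exp (u * Z \<omega>) - 1 - u * Z \<omega>)\<bar> \<le> exp (t * Z \<omega>) * (u\<^sup>2 * (c\<^sup>2 * exp c))" for \<omega>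
        using exp_quadratic_bound[OF abs_Z u] by (simp add: abs_mult)
      have "integrable M (\<lambda>\<omega>. exp ((t + u) * Z \<omega>) - exp (t * Z \<omega>) - u * (Z \<omega> * exp (t * Z \<omega>)))"
        using int_exp int_Zexp by auto
      then show "integrable M (\<lambda>\<omega>. \<bar>exp (t * Z \<omega>) * (exp (u * Z \<omega>) - 1 - u * Z \<omega>)\<bar>)"
        unfolding expand by (rule integrable_abs)
    qed (use int_exp in simp)
    also have "\<dots> = u\<^sup>2 * (m t * (c\<^sup>2 * exp c))" by (simp add: m_def)
    finally show "\<bar>m (t + u) - m t - u * m' t\<bar> \<le> u\<^sup>2 * (m t * (c\<^sup>2 * exp c))" .
  qed
  \<comment> \<open>The optimal parameter in the exponential Markov inequality: the exponent
    \<open>x * t\<close> minus the integral of \<open>h\<close> increases as long as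
    \<open>h\<close> stays below \<open>x\<close>.\<close>
  define T where "T = gen_inverse h x"
  have T: "0 \<le> T" "T \<le> t\<^sub>1"
    unfolding T_def using gen_inverse_nonneg[of t\<^sub>1 x h, OF t\<^sub>1] gen_inverse_le[of t\<^sub>1 x h, OF t\<^sub>1] by auto
  have m'_meas [measurable]: "m' \<in> borel_measurable borel" and m_meas [measurable]: "m \<in> borel_measurable borel"
    unfolding m'_def m_def by measurable
  have log_deriv: "ennreal (m' t / m t) \<le> ennreal (expectation Z) + h t" if "0 \<le> t" "t \<le> t\<^sub>1" for t
  proof (cases "h t")
    case (real r)
    have "ennreal (m' t - expectation Z * m t) \<le> ennreal (r * m t)"
      using cov[OF that] real m_pos[of t] by (simp add: m_def m'_def ennreal_mult)
    then have "m' t - expectation Z * m t \<le> r * m t"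
      using real m_pos[of t] by (subst (asm) ennreal_le_iff) auto
    then have "m' t / m t \<le> expectation Z + r"
      using m_pos[of t] by (simp add: pos_divide_le_eq algebra_simps)
    then show ?thesis using real Z_mean by (simp add: ennreal_plus[symmetric] ennreal_leI del: ennreal_plus)
  qed simp
  define I where "I = (\<integral>\<^sup>+t. h t * indicator {0<..<T} t \<partial>lborel)"
  have "ennreal (ln (m T) - ln (m 0)) = (\<integral>\<^sup>+t. ennreal (m' t / m t) * indicator {0..T} t \<partial>lborel)"
  proof (rule nn_integral_FTC_Icc[symmetric])
    fix t
    show "DERIV (\<lambda>t. ln (m t)) t :> m' t / m t"
      using deriv[of t] m_pos[of t] by (auto intro!: derivative_eq_intros)
    show "0 \<le> m' t / m t" using m_pos[of t] m'_nonneg[of t] by simp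
  qed (use T in auto)
  also have "\<dots> = (\<integral>\<^sup>+t. ennreal (m' t / m t) * indicator {0<..<T} t \<partial>lborel)"
  \<comment> \<open>The endpoints are dropped to match the open interval in
    \<open>Young_gen_inverse\<close>.\<close>
  proof (rule nn_integral_cong_AE)
    have "AE t in lborel. t \<noteq> 0" "AE t in lborel. t \<noteq> T" by (rule AE_lborel_singleton)+
    then show "AE t in lborel. ennreal (m' t / m t) * indicator {0..T} t =
        ennreal (m' t / m t) * indicator {0<..<T} t"
      by eventually_elim (auto simp: indicator_def)
  qed
  also have "\<dots> \<le> (\<integral>\<^sup>+t. ennreal (expectation Z) * indicator {0<..<T} t + h t * indicator {0<..<T} t \<partial>lborel)"
    using log_deriv T by (intro nn_integral_mono) (auto simp: indicator_def)
  also have "\<dots> = (\<integral>\<^sup>+t. ennreal (expectation Z) * indicator {0<..<T} t \<partial>lborel) + I"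
    unfolding I_def by (rule nn_integral_add) measurable
  also have "(\<integral>\<^sup>+t. ennreal (expectation Z) * indicator {0<..<T} t \<partial>lborel) = ennreal (expectation Z * T)"
    using T Z_mean by (simp add: nn_integral_cmult ennreal_mult)
  finally have log_m: "ennreal (ln (m T)) \<le> ennreal (expectation Z * T) + I"
    by (simp add: m_def prob_space)
  define J where "J = (LBINT s:{0..x}. gen_inverse h s)"
  have J: "ennreal J \<le> (\<integral>\<^sup>+s. ennreal (gen_inverse h s) * indicator {0..x} s \<partial>lborel)"
  \<comment> \<open>If integrability failed, the integral \<open>J\<close> would be 0 by convention
    and the bound trivial.\<close>
  proof (cases "integrable lborel (\<lambda>s. indicator {0..x} s *\<^sub>R gen_inverse h s)")
    case True
    have "ennreal J \<le> ennreal (norm J)" by (intro ennreal_leI) simp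
    also have "\<dots> \<le> (\<integral>\<^sup>+s. ennreal (norm (indicator {0..x} s *\<^sub>R gen_inverse h s)) \<partial>lborel)"
      unfolding J_def set_lebesgue_integral_def by (rule integral_norm_bound_ennreal[OF True])
    also have "\<dots> = (\<integral>\<^sup>+s. ennreal (gen_inverse h s) * indicator {0..x} s \<partial>lborel)"
    proof (rule nn_integral_cong)
      fix s :: real
      have "0 \<le> gen_inverse h s" if "s \<in> {0..x}"
        using that by (intro gen_inverse_nonneg[of t\<^sub>1] t\<^sub>1(1) order_trans[OF ennreal_leI t\<^sub>1(2)]) simp
      then show "ennreal (norm (indicator {0..x} s *\<^sub>R gen_inverse h s)) =
          ennreal (gen_inverse h s) * indicator {0..x} s"
        by (auto simp: indicator_def)
    qed
    finally show ?thesis .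
  next
    case False
    then show ?thesis by (simp add: J_def set_lebesgue_integral_def not_integrable_integral_eq)
  qed
  have Young: "ennreal J + I \<le> ennreal (x * T)"
    using Young_gen_inverse[OF h_meas t\<^sub>1 x] add_right_mono[OF J, of I]
    unfolding I_def T_def by (rule order_trans[rotated])
  \<comment> \<open>Finiteness of the integral of \<open>h\<close> up to \<open>T\<close> follows
    from the Young inequality itself.\<close>
  have "I \<noteq> \<top>"
  proof
    assume "I = \<top>"
    with Young show False by (simp add: top_unique)
  qed
  then obtain r where r: "I = ennreal r" "0 \<le> r" by (cases I) auto
  have "J + r \<le> x * T"
  proof (cases "0 \<le> J")
    case True
    then show ?thesis using Young r x T
      by (simp add: ennreal_plus[symmetric] del: ennreal_plus)
  next
    case False
    then have "r \<le> x * T" using Young r x T by (simp add: ennreal_neg)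
    with False show ?thesis by simp
  qed
  moreover have "ln (m T) \<le> expectation Z * T + r"
    using log_m r Z_mean T by (simp add: ennreal_plus[symmetric] ennreal_le_iff del: ennreal_plus)
  ultimately have exponent: "ln (m T) - T * (expectation Z + x) \<le> - J"
    by (simp add: algebra_simps)
  have "prob {\<omega> \<in> space M. expectation Z + x \<le> Z \<omega>} =
      expectation (indicator {\<omega> \<in> space M. expectation Z + x \<le> Z \<omega>})" by simp
  also have "\<dots> \<le> expectation (\<lambda>\<omega>. exp (T * Z \<omega>) * exp (- (T * (expectation Z + x))))"
  proof (rule integral_mono)
    fix \<omega>
    have "0 \<le> T * Z \<omega> - T * (expectation Z + x)" if "expectation Z + x \<le> Z \<omega>"
      using that T by (simp add: right_diff_distrib[symmetric])
    then show "indicator {\<omega> \<in> space M. expectation Z + x \<le> Z \<omega>} \<omega> \<le>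
        exp (T * Z \<omega>) * exp (- (T * (expectation Z + x)))"
      by (auto simp: indicator_def exp_add[symmetric])
  qed (use int_exp in \<open>auto simp: emeasure_eq_measure\<close>)
  also have "\<dots> = m T * exp (- (T * (expectation Z + x)))" by (simp add: m_def)
  also have "\<dots> = exp (ln (m T) - T * (expectation Z + x))"
    using m_pos[of T] by (simp add: exp_diff exp_minus divide_inverse)
  also have "\<dots> \<le> exp (- J)" using exponent by simp
  finally show ?thesis by (simp only: J_def)
qed

end

section \<open>Diffuse Radon measures\<close>

text \<open>The first set of the cover takes its part of \<open>S\<close>; the induction hypothesis
  is applied to the rest, which is why \<open>S\<close> is arbitrary.\<close>

lemma partition_by_small_cover:
  assumes "finite \<U>" "\<And>U. U \<in> \<U> \<Longrightarrow> U \<in> sets N \<and> emeasure N U \<le> e" "S \<in> sets N" "S \<subseteq> \<Union>\<U>"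
  shows "\<exists>\<C>. finite \<C> \<and> disjoint \<C> \<and> \<C> \<subseteq> sets N \<and> \<Union>\<C> = S \<and> (\<forall>C\<in>\<C>. emeasure N C \<le> e)"
  using assms
proof (induction \<U> arbitrary: S rule: finite_induct)
  case empty
  then show ?case by (intro exI[of _ "{}"]) auto
next
  case (insert U \<U>)
  have U: "U \<in> sets N" "emeasure N U \<le> e" using insert.prems(1) by auto
  have "\<exists>\<C>. finite \<C> \<and> disjoint \<C> \<and> \<C> \<subseteq> sets N \<and> \<Union>\<C> = S - U \<and> (\<forall>C\<in>\<C>. emeasure N C \<le> e)"
    using insert.prems U by (intro insert.IH) auto
  then obtain \<C> where \<C>: "finite \<C>" "disjoint \<C>" "\<C> \<subseteq> sets N" "\<Union>\<C> = S - U" "\<forall>C\<in>\<C>. emeasure N C \<le> e"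
    by blast
  have "emeasure N (S \<inter> U) \<le> emeasure N U" using U by (intro emeasure_mono) auto
  then have "emeasure N (S \<inter> U) \<le> e" using U(2) by (rule order_trans)
  moreover have "disjoint (insert (S \<inter> U) \<C>)"
  proof -
    have "S \<inter> U \<inter> C = {}" if "C \<in> \<C>" for C using that \<C>(4) by blast
    with \<C>(2) show ?thesis unfolding disjoint_def by (auto simp: Int_commute)
  qed
  ultimately show ?case
    using \<C> U insert.prems(2) by (intro exI[of _ "insert (S \<inter> U) \<C>"]) auto
qed

lemma radon_measure_sets: "radon_measure N \<Longrightarrow> sets N = sets borel"
  by (simp add: radon_measure_def)

lemma radon_compact_finite:
  assumes "radon_measure N" "compact K"
  shows "emeasure N K < \<infinity>"
proof -
  have N: "sets N = sets borel" using assms(1) by (rule radon_measure_sets)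
  have "\<forall>x. \<exists>U. open U \<and> x \<in> U \<and> emeasure N U < \<infinity>"
    using assms(1) by (simp add: radon_measure_def)
  then obtain U where U: "\<And>x. open (U x)" "\<And>x. x \<in> U x" "\<And>x. emeasure N (U x) < \<infinity>" by metis
  obtain D where D: "D \<subseteq> K" "finite D" "K \<subseteq> (\<Union>x\<in>D. U x)"
    by (rule compactE_image[OF assms(2), of K U]) (use U in auto)
  have "emeasure N K \<le> emeasure N (\<Union>x\<in>D. U x)"
    using D U N by (intro emeasure_mono) auto
  also have "\<dots> \<le> (\<Sum>x\<in>D. emeasure N (U x))"
    using D U N by (intro emeasure_subadditive_finite) auto
  also have "\<dots> < \<infinity>" using D U by (simp add: less_top)
  finally show ?thesis .
qed

text \<open>Balls shrink to a null singleton. Intersecting them with a neighbourhood of finite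
  measure makes continuity from above applicable.\<close>

lemma diffuse_small_neighbourhood:
  fixes N :: "'a::metric_space measure"
  assumes "radon_measure N" "diffuse_measure N" "0 < e"
  shows "\<exists>U. open U \<and> x \<in> U \<and> emeasure N U \<le> e"
proof -
  have N: "sets N = sets borel" using assms(1) by (rule radon_measure_sets)
  obtain U where U: "open U" "x \<in> U" "emeasure N U < \<infinity>"
    using assms(1) unfolding radon_measure_def by blast
  define V where "V k = U \<inter> ball x (1 / real (Suc k))" for k
  have V_sets: "range V \<subseteq> sets N" using U by (auto simp: V_def N)
  have "decseq V"
    unfolding V_def by (intro decseq_SucI Int_mono order_refl subset_ball) (simp add: frac_le)
  have "(\<Inter>k. V k) = {x}"
  proof safe
    fix y assume y: "y \<in> (\<Inter>k. V k)"
    show "y = x"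
    proof (rule ccontr)
      assume "y \<noteq> x"
      then have "0 < dist x y" by simp
      then obtain k where "inverse (real (Suc k)) < dist x y" by (rule reals_Archimedean[THEN exE])
      moreover have "dist x y < 1 / real (Suc k)" using y by (auto simp: V_def)
      ultimately show False by (simp add: inverse_eq_divide)
    qed
  qed (use U in \<open>auto simp: V_def\<close>)
  moreover have "emeasure N {x} = 0"
    using assms(2) sets_eq_imp_space_eq[OF N] by (simp add: diffuse_measure_def)
  moreover have "emeasure N (V k) \<noteq> \<infinity>" for k
  proof -
    have "emeasure N (V k) \<le> emeasure N U" using U by (intro emeasure_mono) (auto simp: V_def N)
    then show ?thesis using U(3) by (auto simp: top_unique)
  qed
  ultimately have "(\<lambda>k. emeasure N (V k)) \<longlonglongrightarrow> 0"
    using Lim_emeasure_decseq[OF V_sets \<open>decseq V\<close>] by simp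
  then have "eventually (\<lambda>k. emeasure N (V k) < e) sequentially"
    using assms(3) by (rule order_tendstoD(2))
  then obtain k where "emeasure N (V k) < e" by (auto simp: eventually_sequentially)
  then show ?thesis using U by (intro exI[of _ "V k"]) (auto simp: V_def)
qed

text \<open>Inner regularity leaves a remainder of measure at most \<open>e\<close> outside of a
  compact set, and small neighbourhoods cover the compact set finitely. The remainder serves as one
  more set of the cover.\<close>

lemma radon_partition:
  fixes N :: "'a::metric_space measure"
  assumes N: "radon_measure N" "diffuse_measure N" and S: "S \<in> sets N" "emeasure N S < \<infinity>" and "0 < e"
  shows "\<exists>\<C>. finite \<C> \<and> disjoint \<C> \<and> \<C> \<subseteq> sets N \<and> \<Union>\<C> = S \<and> (\<forall>C\<in>\<C>. emeasure N C \<le> e)"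
proof (cases "emeasure N S \<le> e")
  case True
  then show ?thesis using S by (intro exI[of _ "{S}"]) (auto simp: disjoint_def)
next
  case False
  have sets_N: "sets N = sets borel" using N(1) by (rule radon_measure_sets)
  have SUP: "emeasure N S = (SUP K\<in>{K. compact K \<and> K \<subseteq> S}. emeasure N K)"
    using N(1) S(1) by (simp add: radon_measure_def)
  \<comment> \<open>A strict inequality is needed to pick a compact set from the supremum; it would
    fail for a null set, which the first case has removed.\<close>
  have "emeasure N S - e < emeasure N S"
    using False S(2) \<open>0 < e\<close> by (intro ennreal_between) auto
  then obtain K where K: "compact K" "K \<subseteq> S" "emeasure N S - e < emeasure N K"
    unfolding SUP less_SUP_iff by blast
  have K_sets: "K \<in> sets N" using K(1) by (simp add: sets_N compact_imp_closed)
  have "\<forall>x. \<exists>U. open U \<and> x \<in> U \<and> emeasure N U \<le> e"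
    using diffuse_small_neighbourhood[OF N \<open>0 < e\<close>] by blast
  then obtain U where U: "\<And>x. open (U x)" "\<And>x. x \<in> U x" "\<And>x. emeasure N (U x) \<le> e" by metis
  obtain D where D: "D \<subseteq> K" "finite D" "K \<subseteq> (\<Union>x\<in>D. U x)"
    by (rule compactE_image[OF K(1), of K U]) (use U in auto)
  have "emeasure N (S - K) = emeasure N S - emeasure N K"
    using K K_sets S radon_compact_finite[OF N(1) K(1)] by (intro emeasure_Diff) auto
  also have "\<dots> \<le> e"
    using less_imp_le[OF K(3)] S(2) by (auto simp: ennreal_minus_le_iff add.commute)
  finally show ?thesis
    using D U S K_sets sets_N by (intro partition_by_small_cover[where \<U> = "insert (S - K) (U ` D)"]) auto
qed

text \<open>A count \<open>j\<close> in \<open>A\<close> forces a count of at most \<open>j\<close>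
  in every subset. For subsets of growing finite measure the Poisson weights of \<open>0..j\<close>
  tend to 0.\<close>

lemma poisson_infinite_count:
  fixes M :: "'a::topological_space measure"
  assumes P: "poisson_measure M P" and A: "A \<in> sets M"
    and large: "\<And>k::nat. \<exists>B\<in>sets M. B \<subseteq> A \<and> emeasure M B < \<infinity> \<and> of_nat k \<le> emeasure M B"
  shows "AE \<omega> in P. num_points A \<omega> = \<infinity>"
proof -
  interpret prob_space P using P by (simp add: poisson_measure_def)
  have sets_P [measurable_cong]: "sets P = sets (config_space M)" using P by (simp add: poisson_measure_def)
  obtain B where B: "\<And>k::nat. B k \<in> sets M" "\<And>k. B k \<subseteq> A" "\<And>k. emeasure M (B k) < \<infinity>"
    "\<And>k. of_nat k \<le> emeasure M (B k)" using large by metis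
  have B_large: "real k \<le> measure M (B k)" for k
  proof -
    have "ennreal (real k) \<le> ennreal (measure M (B k))"
      using B(3,4)[of k] by (simp add: emeasure_eq_ennreal_measure ennreal_of_nat_eq_real_of_nat)
    then show ?thesis by simp
  qed
  have "filterlim (\<lambda>k. measure M (B k)) at_top sequentially"
    by (rule filterlim_at_top_mono[OF filterlim_real_sequentially]) (simp add: B_large)
  then have lim: "(\<lambda>k. measure M (B k) ^ l / fact l * exp (- measure M (B k))) \<longlonglongrightarrow> 0" for l :: nat
  proof -
    have "((\<lambda>x::real. x ^ l / exp x * inverse (fact l)) \<longlongrightarrow> 0 * inverse (fact l)) at_top"
      by (intro tendsto_mult tendsto_power_div_exp_0 tendsto_const)
    from filterlim_compose[OF this \<open>filterlim (\<lambda>k. measure M (B k)) at_top sequentially\<close>]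
    show ?thesis by (simp add: exp_minus divide_inverse mult_ac)
  qed
  have null: "AE \<omega> in P. num_points A \<omega> \<noteq> of_nat j" for j :: nat
  proof -
    have A_set: "{\<omega> \<in> space P. num_points A \<omega> = of_nat j} \<in> sets P" using A by measurable
    have "prob {\<omega> \<in> space P. num_points A \<omega> = of_nat j} \<le>
        (\<Sum>l\<le>j. measure M (B k) ^ l / fact l * exp (- measure M (B k)))" for k
    proof -
      have B_set: "{\<omega> \<in> space P. num_points (B k) \<omega> = of_nat l} \<in> sets P" for l :: nat
        using B(1)[of k] by measurable
      have "{\<omega> \<in> space P. num_points A \<omega> = of_nat j} \<subseteq> (\<Union>l\<le>j. {\<omega> \<in> space P. num_points (B k) \<omega> = of_nat l})"
      proof safe
        fix \<omega> assume "\<omega> \<in> space P" and j: "num_points A \<omega> = of_nat j"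
        have le: "num_points (B k) \<omega> \<le> of_nat j" using num_points_mono[OF B(2), of k \<omega>] j by simp
        show "\<omega> \<in> (\<Union>l\<le>j. {\<omega> \<in> space P. num_points (B k) \<omega> = of_nat l})"
        proof (cases rule: num_points_cases[of "B k" \<omega>])
          case (1 l)
          with le have "l \<le> j" by simp
          with 1 \<open>\<omega> \<in> space P\<close> show ?thesis by auto
        qed (use le in \<open>simp add: top_unique\<close>)
      qed
      then have "prob {\<omega> \<in> space P. num_points A \<omega> = of_nat j} \<le>
          prob (\<Union>l\<le>j. {\<omega> \<in> space P. num_points (B k) \<omega> = of_nat l})"
        by (rule finite_measure_mono) (use B_set in auto)
      also have "\<dots> \<le> (\<Sum>l\<le>j. prob {\<omega> \<in> space P. num_points (B k) \<omega> = of_nat l})"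
        by (rule finite_measure_subadditive_finite) (use B_set in auto)
      also have "\<dots> = (\<Sum>l\<le>j. measure M (B k) ^ l / fact l * exp (- measure M (B k)))"
        using P B by (intro sum.cong) (auto simp: poisson_measure_def)
      finally show ?thesis .
    qed
    moreover have "(\<lambda>k. \<Sum>l\<le>j. measure M (B k) ^ l / fact l * exp (- measure M (B k))) \<longlonglongrightarrow> (\<Sum>l\<le>j. 0)"
      by (intro tendsto_sum lim)
    ultimately have "prob {\<omega> \<in> space P. num_points A \<omega> = of_nat j} \<le> 0"
      by (intro LIMSEQ_le_const[where X = "\<lambda>k. \<Sum>l\<le>j. measure M (B k) ^ l / fact l * exp (- measure M (B k))"]) auto
    then have "prob {\<omega> \<in> space P. num_points A \<omega> = of_nat j} = 0"
      using measure_nonneg by (rule antisym)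
    then have "emeasure P {\<omega> \<in> space P. num_points A \<omega> = of_nat j} = 0"
      by (simp only: emeasure_eq_measure ennreal_0)
    then show ?thesis using A_set by (subst AE_iff_measurable[OF _ refl]) auto
  qed
  have "AE \<omega> in P. \<forall>j::nat. num_points A \<omega> \<noteq> of_nat j"
    unfolding AE_all_countable using null by blast
  then show ?thesis
  proof (rule AE_mp, intro AE_I2 impI)
    fix \<omega> assume "\<forall>j::nat. num_points A \<omega> \<noteq> of_nat j"
    then show "num_points A \<omega> = \<infinity>" by (cases rule: num_points_cases[of A \<omega>]) auto
  qed
qed

section \<open>The product space\<close>

lemma section_measurable:
  fixes \<nu> :: "nat \<Rightarrow> 'y::topological_space measure"
  assumes "A \<in> sets (intensity n \<nu>)" "i \<in> {1..n}"
  shows "{y. (i, y) \<in> A} \<in> sets borel"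
  using sets_Pair1[of A "count_space {1..n}" borel i] assms by (simp add: vimage_def)

lemma slice_measurable:
  fixes \<nu> :: "nat \<Rightarrow> 'y::topological_space measure"
  assumes "C \<in> sets borel" "i \<in> {1..n}"
  shows "{i} \<times> C \<in> sets (intensity n \<nu>)"
  using assms by (simp add: pair_measureI)

lemma emeasure_intensity_slice:
  fixes \<nu> :: "nat \<Rightarrow> 'y::topological_space measure"
  assumes \<nu>: "\<And>i. i \<in> {1..n} \<Longrightarrow> sets (\<nu> i) = sets borel" and C: "C \<in> sets borel" and i: "i \<in> {1..n}"
  shows "emeasure (intensity n \<nu>) ({i} \<times> C) = emeasure (\<nu> i) C"
proof -
  have "emeasure (intensity n \<nu>) ({i} \<times> C) = (\<Sum>j=1..n. emeasure (\<nu> j) {y. (j, y) \<in> {i} \<times> C})"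
    using \<nu> slice_measurable[OF C i] by (rule emeasure_intensity)
  also have "\<dots> = (\<Sum>j=1..n. if j = i then emeasure (\<nu> i) C else 0)"
    by (intro sum.cong) auto
  also have "\<dots> = emeasure (\<nu> i) C" using i by (simp add: sum.delta)
  finally show ?thesis .
qed

text \<open>Some section has infinite measure, and inner regularity supplies compact subsets of it
  with arbitrarily large measure. Compactness keeps these measures finite, even where the intensity
  is not \<sigma>-finite.\<close>

lemma intensity_infinite_count:
  fixes \<nu> :: "nat \<Rightarrow> 'y::t2_space measure"
  assumes \<nu>: "\<And>i. i \<in> {1..n} \<Longrightarrow> radon_measure (\<nu> i)" and P: "poisson_measure (intensity n \<nu>) P"
    and A: "A \<in> sets (intensity n \<nu>)" "emeasure (intensity n \<nu>) A = \<infinity>"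
  shows "AE \<omega> in P. num_points A \<omega> = \<infinity>"
proof (rule poisson_infinite_count[OF P A(1)])
  fix k :: nat
  have sets_\<nu>: "sets (\<nu> i) = sets borel" if "i \<in> {1..n}" for i using \<nu>[OF that] by (rule radon_measure_sets)
  have "(\<Sum>i=1..n. emeasure (\<nu> i) {y. (i, y) \<in> A}) = \<infinity>"
    using emeasure_intensity[of n \<nu> A] sets_\<nu> A by simp
  then obtain i where i: "i \<in> {1..n}" "emeasure (\<nu> i) {y. (i, y) \<in> A} = \<infinity>" by auto
  let ?S = "{y. (i, y) \<in> A}"
  have S: "?S \<in> sets borel" using A(1) i(1) by (rule section_measurable)
  then have "emeasure (\<nu> i) ?S = (SUP K\<in>{K. compact K \<and> K \<subseteq> ?S}. emeasure (\<nu> i) K)"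
    using \<nu>[OF i(1)] sets_\<nu>[OF i(1)] by (simp add: radon_measure_def)
  then have "of_nat k < (SUP K\<in>{K. compact K \<and> K \<subseteq> ?S}. emeasure (\<nu> i) K)"
    using i(2) by (simp add: of_nat_less_top)
  then obtain K where K: "compact K" "K \<subseteq> ?S" "of_nat k < emeasure (\<nu> i) K"
    unfolding less_SUP_iff by blast
  have K_sets: "K \<in> sets borel" using K(1) by (simp add: compact_imp_closed)
  have "emeasure (intensity n \<nu>) ({i} \<times> K) = emeasure (\<nu> i) K"
    using sets_\<nu> K_sets i(1) by (rule emeasure_intensity_slice)
  then show "\<exists>B\<in>sets (intensity n \<nu>). B \<subseteq> A \<and> emeasure (intensity n \<nu>) B < \<infinity> \<and> of_nat k \<le> emeasure (intensity n \<nu>) B"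
    using slice_measurable[OF K_sets i(1), of \<nu>] K radon_compact_finite[OF \<nu>[OF i(1)] K(1)]
    by (intro bexI[of _ "{i} \<times> K"]) auto
qed

lemma intensity_partition:
  fixes \<nu> :: "nat \<Rightarrow> 'y::metric_space measure"
  assumes \<nu>: "\<And>i. i \<in> {1..n} \<Longrightarrow> radon_measure (\<nu> i) \<and> diffuse_measure (\<nu> i)"
    and B: "B \<in> sets (intensity n \<nu>)" "emeasure (intensity n \<nu>) B < \<infinity>" and e: "0 < (e::real)"
  shows "\<exists>\<C>. finite \<C> \<and> disjoint \<C> \<and> \<C> \<subseteq> sets (intensity n \<nu>) \<and> \<Union>\<C> = B \<and>
    (\<forall>C\<in>\<C>. measure (intensity n \<nu>) C \<le> e)"
proof -
  have sets_\<nu>: "sets (\<nu> i) = sets borel" if "i \<in> {1..n}" for i using \<nu>[OF that] radon_measure_sets by blast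
  have "\<exists>\<C>. finite \<C> \<and> disjoint \<C> \<and> \<C> \<subseteq> sets (\<nu> i) \<and> \<Union>\<C> = {y. (i, y) \<in> B} \<and>
      (\<forall>C\<in>\<C>. emeasure (\<nu> i) C \<le> ennreal e)" if i: "i \<in> {1..n}" for i
  proof (rule radon_partition)
    show "{y. (i, y) \<in> B} \<in> sets (\<nu> i)" using section_measurable[OF B(1) i] sets_\<nu>[OF i] by simp
    have "emeasure (\<nu> i) {y. (i, y) \<in> B} \<le> (\<Sum>j=1..n. emeasure (\<nu> j) {y. (j, y) \<in> B})"
      using i by (intro member_le_sum) auto
    also have "\<dots> = emeasure (intensity n \<nu>) B" using emeasure_intensity[of n \<nu> B] sets_\<nu> B(1) by simp
    also have "\<dots> < \<infinity>" by (rule B(2))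
    finally show "emeasure (\<nu> i) {y. (i, y) \<in> B} < \<infinity>" .
  qed (use \<nu>[OF i] e in auto)
  then have "\<forall>i\<in>{1..n}. \<exists>\<C>. finite \<C> \<and> disjoint \<C> \<and> \<C> \<subseteq> sets (\<nu> i) \<and> \<Union>\<C> = {y. (i, y) \<in> B} \<and>
      (\<forall>C\<in>\<C>. emeasure (\<nu> i) C \<le> ennreal e)" by blast
  from bchoice[OF this] obtain \<D> where *: "\<forall>i\<in>{1..n}. finite (\<D> i) \<and> disjoint (\<D> i) \<and>
      \<D> i \<subseteq> sets (\<nu> i) \<and> \<Union>(\<D> i) = {y. (i, y) \<in> B} \<and> (\<forall>C\<in>\<D> i. emeasure (\<nu> i) C \<le> ennreal e)" ..
  have \<D>: "finite (\<D> i)" "disjoint (\<D> i)" "\<D> i \<subseteq> sets (\<nu> i)" "\<Union>(\<D> i) = {y. (i, y) \<in> B}"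
    if "i \<in> {1..n}" for i
    using bspec[OF * that] by simp_all
  have \<D>_small: "emeasure (\<nu> i) C \<le> ennreal e" if "i \<in> {1..n}" "C \<in> \<D> i" for i C
    using bspec[OF * that(1)] that(2) by simp
  define \<C> where "\<C> = (\<Union>i\<in>{1..n}. (\<lambda>C. {i} \<times> C) ` \<D> i)"
  have B_sub: "B \<subseteq> {1..n} \<times> UNIV"
    using sets.sets_into_space[OF B(1)] by simp
  show ?thesis
  proof (intro exI[of _ \<C>] conjI ballI)
    show "finite \<C>" unfolding \<C>_def using \<D>(1) by auto
    show "disjoint \<C>"
      unfolding disjoint_def
    proof (intro ballI impI)
      fix A A' assume "A \<in> \<C>" "A' \<in> \<C>" "A \<noteq> A'"
      then obtain i C j C' where A: "i \<in> {1..n}" "C \<in> \<D> i" "A = {i} \<times> C" "j \<in> {1..n}" "C' \<in> \<D> j" "A' = {j} \<times> C'"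
        unfolding \<C>_def by blast
      show "A \<inter> A' = {}"
      proof (cases "i = j")
        case True
        with A \<open>A \<noteq> A'\<close> have "C \<noteq> C'" by auto
        with True A \<D>(2)[OF A(1)] have "C \<inter> C' = {}" unfolding disjoint_def by blast
        with True A show ?thesis by auto
      qed (use A in auto)
    qed
    show "\<C> \<subseteq> sets (intensity n \<nu>)"
      unfolding \<C>_def using \<D>(3) sets_\<nu> slice_measurable by blast
    show "\<Union>\<C> = B"
    proof (intro equalityI subsetI)
      fix p assume "p \<in> \<Union>\<C>"
      then obtain i C where "i \<in> {1..n}" "C \<in> \<D> i" "p \<in> {i} \<times> C" unfolding \<C>_def by blast
      then show "p \<in> B" using \<D>(4)[of i] by auto
    next
      fix p assume p: "p \<in> B"
      then obtain i y where iy: "p = (i, y)" "i \<in> {1..n}" using B_sub by auto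
      then have "y \<in> \<Union>(\<D> i)" using p \<D>(4)[OF iy(2)] by simp
      then show "p \<in> \<Union>\<C>" using iy unfolding \<C>_def by blast
    qed
    fix A assume "A \<in> \<C>"
    then obtain i C where A: "i \<in> {1..n}" "C \<in> \<D> i" "A = {i} \<times> C" unfolding \<C>_def by blast
    have "C \<in> sets borel" using \<D>(3)[OF A(1)] A(2) sets_\<nu>[OF A(1)] by auto
    then have "emeasure (intensity n \<nu>) A = emeasure (\<nu> i) C"
      unfolding A(3) using sets_\<nu> A(1) by (intro emeasure_intensity_slice)
    also have "\<dots> \<le> ennreal e" by (rule \<D>_small[OF A(1,2)])
    finally show "measure (intensity n \<nu>) A \<le> e"
      using e by (simp add: measure_def enn2real_leI)
  qed
qed

text \<open>Restricting the intensity to one slice and projecting to the second coordinate recovers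
  \<open>\<nu> i\<close>; the claim is the change of variables.\<close>

lemma nn_integral_intensity_slice:
  fixes \<nu> :: "nat \<Rightarrow> 'y::topological_space measure"
  assumes \<nu>: "\<And>i. i \<in> {1..n} \<Longrightarrow> sets (\<nu> i) = sets borel" and i: "i \<in> {1..n}"
    and f [measurable]: "f \<in> borel_measurable borel"
  shows "(\<integral>\<^sup>+p. f (snd p) * indicator ({i} \<times> UNIV) p \<partial>intensity n \<nu>) = (\<integral>\<^sup>+y. f y \<partial>\<nu> i)"
proof -
  let ?M = "intensity n \<nu>"
  let ?S = "{i} \<times> (UNIV :: 'y set)"
  have S: "?S \<in> sets ?M" using i by (intro slice_measurable) auto
  have snd: "snd \<in> measurable ?M borel"
    using measurable_snd[of "count_space {1..n}" "borel :: 'y measure"]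
    by (simp cong: measurable_cong_sets)
  have snd': "snd \<in> measurable (density ?M (indicator ?S)) (\<nu> i)"
    using snd \<nu>[OF i] by (simp cong: measurable_cong_sets)
  have "distr (density ?M (indicator ?S)) (\<nu> i) snd = \<nu> i"
  proof (rule measure_eqI)
    fix A assume "A \<in> sets (distr (density ?M (indicator ?S)) (\<nu> i) snd)"
    then have A: "A \<in> sets borel" using \<nu>[OF i] by simp
    have vA: "snd -` A \<inter> space ?M \<in> sets ?M" using snd A by (rule measurable_sets)
    have "emeasure (distr (density ?M (indicator ?S)) (\<nu> i) snd) A =
        emeasure (density ?M (indicator ?S)) (snd -` A \<inter> space ?M)"
      using snd' A \<nu>[OF i] by (subst emeasure_distr) auto
    also have "\<dots> = emeasure ?M (?S \<inter> (snd -` A \<inter> space ?M))"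
    proof -
      have "emeasure (density ?M (indicator ?S)) (snd -` A \<inter> space ?M) =
          (\<integral>\<^sup>+p. indicator ?S p * indicator (snd -` A \<inter> space ?M) p \<partial>?M)"
        using borel_measurable_indicator[OF S] vA by (rule emeasure_density)
      also have "\<dots> = (\<integral>\<^sup>+p. indicator (?S \<inter> (snd -` A \<inter> space ?M)) p \<partial>?M)"
        by (simp only: indicator_inter_arith)
      also have "\<dots> = emeasure ?M (?S \<inter> (snd -` A \<inter> space ?M))"
        by (rule nn_integral_indicator[OF sets.Int[OF S vA]])
      finally show ?thesis .
    qed
    also have "?S \<inter> (snd -` A \<inter> space ?M) = {i} \<times> A" using i by auto
    also have "emeasure ?M ({i} \<times> A) = emeasure (\<nu> i) A" by (rule emeasure_intensity_slice[OF \<nu> A i])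
    finally show "emeasure (distr (density ?M (indicator ?S)) (\<nu> i) snd) A = emeasure (\<nu> i) A" .
  qed (simp add: \<nu>[OF i])
  then have "(\<integral>\<^sup>+y. f y \<partial>\<nu> i) = (\<integral>\<^sup>+y. f y \<partial>distr (density ?M (indicator ?S)) (\<nu> i) snd)" by simp
  also have "\<dots> = (\<integral>\<^sup>+p. f (snd p) \<partial>density ?M (indicator ?S))"
    using snd' f \<nu>[OF i] by (intro nn_integral_distr) (auto cong: measurable_cong_sets)
  also have "\<dots> = (\<integral>\<^sup>+p. indicator ?S p * f (snd p) \<partial>?M)"
    using borel_measurable_indicator[OF S] measurable_compose[OF snd f] by (rule nn_integral_density)
  finally show ?thesis by (simp add: mult.commute)
qed

section \<open>Components, increments and the left limit\<close>

lemma component_in_configurations: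
  fixes \<omega> :: "(nat \<times> 'y::topological_space) set"
  assumes \<omega>: "\<omega> \<in> configurations ({1..n} \<times> UNIV)" and i: "i \<in> {1..n}"
  shows "component i \<omega> \<in> configurations UNIV"
  unfolding configurations_def
proof safe
  fix y :: 'y
  have "(i, y) \<in> {1..n} \<times> UNIV" using i by simp
  then obtain U where U: "open U" "(i, y) \<in> U" "finite (\<omega> \<inter> U)"
    using \<omega> unfolding configurations_def by blast
  have "open (Pair i -` U)"
    using U(1) by (intro open_vimage continuous_intros) auto
  moreover have "finite (component i \<omega> \<inter> Pair i -` U)"
  proof (rule finite_imageD)
    show "finite (Pair i ` (component i \<omega> \<inter> Pair i -` U))"
      by (rule finite_subset[OF _ U(3)]) (auto simp: component_def)
  qed (simp add: inj_on_def)
  ultimately show "\<exists>U. open U \<and> y \<in> U \<and> finite (component i \<omega> \<inter> U)"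
    using U(2) by (intro exI[of _ "Pair i -` U"]) auto
qed simp

lemma num_points_component: "num_points A (component i \<omega>) = num_points ({i} \<times> A) \<omega>"
proof -
  have eq: "\<omega> \<inter> {i} \<times> A = Pair i ` (component i \<omega> \<inter> A)" by (auto simp: component_def)
  have "emeasure (count_space UNIV) (Pair i ` (component i \<omega> \<inter> A)) =
      emeasure (count_space UNIV) (component i \<omega> \<inter> A)"
  proof (cases "finite (component i \<omega> \<inter> A)")
    case True
    then show ?thesis by (simp add: card_image inj_on_def)
  next
    case False
    moreover have "infinite (Pair i ` (component i \<omega> \<inter> A))"
      using False finite_imageD[of "Pair i" "component i \<omega> \<inter> A"] by (auto simp: inj_on_def)
    ultimately show ?thesis by simp
  qed
  then show ?thesis by (simp add: num_points_def eq)
qed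

lemma measurable_component:
  fixes \<nu> :: "nat \<Rightarrow> 'y::topological_space measure"
  assumes i: "i \<in> {1..n}"
  shows "component i \<in> measurable (config_space (intensity n \<nu>)) (config_space (borel :: 'y measure))"
proof (rule measurable_config_spaceI)
  fix A :: "'y set" assume "A \<in> sets borel"
  then have "num_points ({i} \<times> A) \<in> borel_measurable (config_space (intensity n \<nu>))"
    by (intro measurable_num_points slice_measurable i)
  then show "(\<lambda>\<omega>. num_points A (component i \<omega>)) \<in> borel_measurable (config_space (intensity n \<nu>))"
    by (simp add: num_points_component)
qed (use i in \<open>simp add: component_in_configurations\<close>)

text \<open>Here \<open>a\<close> and \<open>a'\<close> are the norms before and after a point is
  added to component \<open>i\<close>, \<open>f\<close> is the old value of \<open>F i\<close> and
  \<open>d\<close> its increment. The norm itself moves by at most \<open>\<bar>d\<bar>\<close>; the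
  finer second bound comes from comparing squared norms.\<close>

lemma clamp_increment:
  fixes a a' f d e c :: real
  assumes a: "0 \<le> a" "0 \<le> a'" and sq: "a'\<^sup>2 = a\<^sup>2 + 2 * f * d + d\<^sup>2" and f: "\<bar>f\<bar> \<le> a" "\<bar>f + d\<bar> \<le> a'"
    and e: "0 < e"
  shows "\<bar>min (max a' e) c - min (max a e) c\<bar> \<le> \<bar>d\<bar>"
    and "(min (max a' e) c - min (max a e) c)\<^sup>2 \<le> 8 * d\<^sup>2 * (f\<^sup>2 / a\<^sup>2) + 2 * d ^ 4 / e\<^sup>2"
proof -
  have fd: "\<bar>f * d\<bar> \<le> a * \<bar>d\<bar>" "\<bar>(f + d) * d\<bar> \<le> a' * \<bar>d\<bar>"
    using mult_right_mono[OF f(1), of "\<bar>d\<bar>"] mult_right_mono[OF f(2), of "\<bar>d\<bar>"]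
    by (simp_all only: abs_mult abs_ge_zero)
  have "(a + \<bar>d\<bar>)\<^sup>2 = a\<^sup>2 + d\<^sup>2 + 2 * (a * \<bar>d\<bar>)" by (simp add: power2_sum)
  moreover have "f * d \<le> a * \<bar>d\<bar>" using fd(1) by linarith
  ultimately have "a'\<^sup>2 \<le> (a + \<bar>d\<bar>)\<^sup>2" unfolding sq by linarith
  then have 1: "a' \<le> a + \<bar>d\<bar>" by (rule power2_le_imp_le) (use a in simp)
  have "a\<^sup>2 = a'\<^sup>2 - 2 * ((f + d) * d) + d\<^sup>2" unfolding sq by (simp add: power2_eq_square algebra_simps)
  also have "\<dots> \<le> a'\<^sup>2 + d\<^sup>2 + 2 * (a' * \<bar>d\<bar>)" using fd(2) by linarith
  also have "\<dots> = (a' + \<bar>d\<bar>)\<^sup>2" by (simp add: power2_sum)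
  finally have 2: "a \<le> a' + \<bar>d\<bar>" by (rule power2_le_imp_le) (use a in simp)
  show "\<bar>min (max a' e) c - min (max a e) c\<bar> \<le> \<bar>d\<bar>" using 1 2 by (auto simp: min_def max_def)
  define v where "v = max a e"
  define v' where "v' = max a' e"
  have v: "0 < v" "a \<le> v" "e \<le> v" "0 < v'" using e by (auto simp: v_def v'_def)
  have clamp: "\<bar>min (max a' e) c - min (max a e) c\<bar> \<le> \<bar>v' - v\<bar>" by (auto simp: v_def v'_def min_def)
  have sq_max: "(max b e)\<^sup>2 = max (b\<^sup>2) (e\<^sup>2)" if "0 \<le> b" for b
    using that e power_mono[of b e 2] power_mono[of e b 2] by (auto simp: max_def)
  \<comment> \<open>This leads to a difference of squares. Truncation at \<open>e\<close> commutes
    with squaring, and it does not enlarge differences.\<close>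
  have "\<bar>v' - v\<bar> * v \<le> \<bar>v' - v\<bar> * (v' + v)" using v by (intro mult_left_mono) auto
  also have "\<dots> = \<bar>(v' - v) * (v' + v)\<bar>" using v by (simp add: abs_mult)
  also have "\<dots> = \<bar>v'\<^sup>2 - v\<^sup>2\<bar>" by (simp add: power2_eq_square algebra_simps)
  also have "\<dots> \<le> \<bar>a'\<^sup>2 - a\<^sup>2\<bar>" unfolding v_def v'_def sq_max[OF a(1)] sq_max[OF a(2)] by (auto simp: max_def)
  also have "\<dots> = \<bar>2 * f * d + d\<^sup>2\<bar>" unfolding sq by simp
  finally have "(\<bar>v' - v\<bar> * v)\<^sup>2 \<le> \<bar>2 * f * d + d\<^sup>2\<bar>\<^sup>2" using v by (intro power_mono) auto
  then have "(v' - v)\<^sup>2 * v\<^sup>2 \<le> (2 * f * d + d\<^sup>2)\<^sup>2" by (simp add: power_mult_distrib)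
  \<comment> \<open>The constants 8 and 2 in \<open>dev_fun\<close> originate here: the cross term
    has coefficient 2, and the square of a sum costs another factor 2.\<close>
  also have "\<dots> \<le> 2 * (2 * f * d)\<^sup>2 + 2 * (d\<^sup>2)\<^sup>2"
    using sum_squares_bound[of "2 * f * d" "d\<^sup>2"] by (simp add: power2_sum)
  also have "\<dots> = 8 * d\<^sup>2 * f\<^sup>2 + 2 * d ^ 4" by (simp add: power_mult_distrib)
  finally have "(v' - v)\<^sup>2 \<le> (8 * d\<^sup>2 * f\<^sup>2 + 2 * d ^ 4) / v\<^sup>2" using v(1) by (simp add: pos_le_divide_eq)
  also have "\<dots> = 8 * d\<^sup>2 * (f\<^sup>2 / v\<^sup>2) + 2 * d ^ 4 / v\<^sup>2" by (simp add: add_divide_distrib)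
  also have "\<dots> \<le> 8 * d\<^sup>2 * (f\<^sup>2 / a\<^sup>2) + 2 * d ^ 4 / e\<^sup>2"
  proof -
    have "f\<^sup>2 / v\<^sup>2 \<le> f\<^sup>2 / a\<^sup>2"
    \<comment> \<open>If \<open>a = 0\<close> then \<open>f = 0\<close>, and both quotients are
      0.\<close>
    proof (cases "a = 0")
      case False
      then have "0 < a" using a by simp
      then show ?thesis using v by (intro divide_left_mono power_mono mult_pos_pos zero_less_power) auto
    qed (use f in simp)
    moreover have "2 * d ^ 4 / v\<^sup>2 \<le> 2 * d ^ 4 / e\<^sup>2"
      using e v by (intro divide_left_mono power_mono mult_pos_pos zero_less_power) auto
    ultimately show ?thesis by (intro add_mono mult_left_mono) simp_all
  qed
  finally have "(v' - v)\<^sup>2 \<le> 8 * d\<^sup>2 * (f\<^sup>2 / a\<^sup>2) + 2 * d ^ 4 / e\<^sup>2" .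
  moreover have "(min (max a' e) c - min (max a e) c)\<^sup>2 \<le> (v' - v)\<^sup>2"
    using clamp by (simp add: abs_le_square_iff)
  ultimately show "(min (max a' e) c - min (max a e) c)\<^sup>2 \<le> 8 * d\<^sup>2 * (f\<^sup>2 / a\<^sup>2) + 2 * d ^ 4 / e\<^sup>2"
    by (rule order_trans[rotated])
qed

text \<open>By convexity the exponential lies below its chord over \<open>[0, t * K]\<close>. For
  \<open>K = 0\<close> both sides vanish.\<close>

lemma exp_increment:
  fixes \<delta> K t :: real
  assumes "\<bar>\<delta>\<bar> \<le> K" "0 \<le> t"
  shows "\<bar>exp (t * \<delta>) - 1\<bar> \<le> (exp (t * K) - 1) / K * \<bar>\<delta>\<bar>"
proof (cases "K = 0")
  case False
  with assms have K: "0 < K" by linarith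
  let ?u = "\<bar>\<delta>\<bar> / K"
  have "exp ((1 - ?u) *\<^sub>R 0 + ?u *\<^sub>R (t * K)) \<le> (1 - ?u) * exp 0 + ?u * exp (t * K)"
    using K assms by (intro convex_onD[OF exp_convex]) (auto simp: divide_le_eq)
  also have "(1 - ?u) *\<^sub>R 0 + ?u *\<^sub>R (t * K) = t * \<bar>\<delta>\<bar>" using K by simp
  finally have "exp (t * \<bar>\<delta>\<bar>) - 1 \<le> ?u * (exp (t * K) - 1)" by (simp add: right_diff_distrib)
  also have "?u * (exp (t * K) - 1) = (exp (t * K) - 1) / K * \<bar>\<delta>\<bar>" by simp
  finally have "exp (t * \<bar>\<delta>\<bar>) - 1 \<le> (exp (t * K) - 1) / K * \<bar>\<delta>\<bar>" .
  moreover have "\<bar>exp (t * \<delta>) - 1\<bar> \<le> exp (t * \<bar>\<delta>\<bar>) - 1"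
  proof (cases "0 \<le> \<delta>")
    case True
    then show ?thesis using assms(2) by simp
  next
    \<comment> \<open>A decrease is dominated by the increase of the same size, through
      \<open>1 - exp (- u) \<le> u \<le> exp u - 1\<close>.\<close>
    case neg: False
    then have "t * \<delta> \<le> 0" using assms(2) by (simp add: mult_nonneg_nonpos)
    then have "\<bar>exp (t * \<delta>) - 1\<bar> = 1 - exp (t * \<delta>)" by simp
    also have "\<dots> \<le> - (t * \<delta>)" using exp_ge_add_one_self[of "t * \<delta>"] by linarith
    also have "\<dots> \<le> exp (- (t * \<delta>)) - 1" using exp_ge_add_one_self[of "- (t * \<delta>)"] by linarith
    finally show ?thesis using neg by simp
  qed
  ultimately show ?thesis by (rule order_trans[rotated])
qed (use assms in simp)

lemma dev_fun_mono:
  assumes "1 \<le> n" "\<And>i. i \<in> {1..n} \<Longrightarrow> 0 \<le> \<beta> i"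
  shows "mono (dev_fun n \<nu> \<beta> E)"
proof (rule monoI)
  fix s t :: real assume st: "s \<le> t"
  have e: "exp (s * \<beta> i * norm y) - 1 \<le> exp (t * \<beta> i * norm y) - 1" if "i \<in> {1..n}" for i and y :: 'a
    using st assms(2)[OF that] by (simp add: mult_right_mono)
  have ne: "finite ((\<lambda>i. g i) ` {1..n})" "(\<lambda>i. g i) ` {1..n} \<noteq> {}" for g :: "nat \<Rightarrow> ennreal"
    using assms(1) by auto
  have Max_mono_fun: "(MAX i\<in>{1..n}. f i) \<le> (MAX i\<in>{1..n}. g i)"
    if "\<And>i. i \<in> {1..n} \<Longrightarrow> f i \<le> g i" for f g :: "nat \<Rightarrow> ennreal"
  proof (rule Max.boundedI[OF ne(1) ne(2)])
    fix a assume "a \<in> f ` {1..n}"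
    then obtain i where i: "i \<in> {1..n}" "a = f i" by blast
    have "f i \<le> g i" using that[OF i(1)] .
    also have "\<dots> \<le> (MAX i\<in>{1..n}. g i)" using i(1) ne(1) by (intro Max_ge) auto
    finally show "a \<le> (MAX i\<in>{1..n}. g i)" using i(2) by simp
  qed
  show "dev_fun n \<nu> \<beta> E s \<le> dev_fun n \<nu> \<beta> E t"
    unfolding dev_fun_def
    by (intro add_mono mult_left_mono Max_mono_fun nn_integral_mono ennreal_leI e) auto
qed

text \<open>For a monotone function the left limit is the supremum over smaller arguments. The
  neighbourhoods are taken in \<open>ereal\<close>, so that an infinite \<open>t\<^sub>0\<close>
  needs no separate argument.\<close>

lemma left_limit_lessE:
  assumes mono: "mono h" and t\<^sub>0: "0 < t\<^sub>0" and x: "a < left_limit h t\<^sub>0"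
  obtains t where "0 < t" "ereal t < t\<^sub>0" "a < h t"
proof -
  define l where "l = (SUP t\<in>{t. 0 < t \<and> ereal t < t\<^sub>0}. h t)"
  have real: "\<exists>r. s = ereal r" if "0 < s" "s < t\<^sub>0" for s
    using that by (cases s) auto
  have lim: "((\<lambda>t. h (real_of_ereal t)) \<longlongrightarrow> l) (at_left t\<^sub>0)"
  proof (rule order_tendstoI)
    fix b assume "b < l"
    then obtain t where t: "0 < t" "ereal t < t\<^sub>0" "b < h t" unfolding l_def less_SUP_iff by blast
    show "eventually (\<lambda>s. b < h (real_of_ereal s)) (at_left t\<^sub>0)"
      unfolding eventually_at_left[OF t\<^sub>0]
    proof (intro exI[of _ "ereal t"] conjI allI impI t(2))
      fix s assume s: "ereal t < s" "s < t\<^sub>0"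
      have "0 < s" using t(1) by (intro less_trans[OF _ s(1)]) simp
      then obtain r where r: "s = ereal r" using real s(2) by blast
      then have "h t \<le> h r" using s(1) by (intro monoD[OF mono]) simp
      with t(3) show "b < h (real_of_ereal s)" using r by simp
    qed
  next
    fix b assume "l < b"
    show "eventually (\<lambda>s. h (real_of_ereal s) < b) (at_left t\<^sub>0)"
      unfolding eventually_at_left[OF t\<^sub>0]
    proof (intro exI[of _ 0] conjI allI impI t\<^sub>0)
      fix s assume s: "0 < s" "s < t\<^sub>0"
      then obtain r where r: "s = ereal r" using real by blast
      then have "h r \<le> l" unfolding l_def using s by (intro SUP_upper) auto
      with \<open>l < b\<close> show "h (real_of_ereal s) < b" using r by simp
    qed
  qed
  have "at_left t\<^sub>0 \<noteq> bot"
  proof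
    assume "at_left t\<^sub>0 = bot"
    then have "eventually (\<lambda>_. False) (at_left t\<^sub>0)" by simp
    then obtain b where b: "b < t\<^sub>0" "\<forall>s>b. s < t\<^sub>0 \<longrightarrow> False" unfolding eventually_at_left[OF t\<^sub>0] by blast
    from dense[OF b(1)] b(2) show False by blast
  qed
  from tendsto_Lim[OF this lim] have "left_limit h t\<^sub>0 = l" by (simp add: left_limit_def)
  with x have "a < l" by simp
  then show ?thesis unfolding l_def less_SUP_iff using that by blast
qed

text \<open>The common consequence of both readings of the supremum. The exceptional null set may
  depend on \<open>y\<close>, since the essential supremum is taken for each \<open>y\<close>
  separately.\<close>

lemma lipschitz_AE:
  fixes F :: "nat \<Rightarrow> 'y::real_normed_vector set \<Rightarrow> real"
  assumes P: "space P = configurations ({1..n} \<times> UNIV)"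
    and \<beta>: "0 \<le> \<beta> i" "ennreal (\<beta> i) = lip_sup n F i \<or> ennreal (\<beta> i) = lip_esssup P F i"
    and y: "y \<noteq> 0"
  shows "AE \<omega> in P. \<bar>diff_op y (F i) (component i \<omega>)\<bar> \<le> \<beta> i * norm y"
proof -
  let ?q = "\<lambda>\<omega>. \<bar>diff_op y (F i) (component i \<omega>)\<bar> / norm y"
  have "AE \<omega> in P. ennreal (?q \<omega>) \<le> ennreal (\<beta> i)"
    using \<beta>(2)
  proof
    assume "ennreal (\<beta> i) = lip_sup n F i"
    then show ?thesis
      unfolding lip_sup_def using y
      by (intro AE_I2) (auto simp: P intro!: SUP_upper2[where i = y] SUP_upper)
  next
    assume *: "ennreal (\<beta> i) = lip_esssup P F i"
    have le: "esssup P (\<lambda>\<omega>. ennreal (?q \<omega>)) \<le> ennreal (\<beta> i)"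
      unfolding * lip_esssup_def using y by (intro SUP_upper) auto
    have "AE \<omega> in P. ennreal (?q \<omega>) \<le> esssup P (\<lambda>\<omega>. ennreal (?q \<omega>))" by (rule esssup_AE)
    then show ?thesis by (rule eventually_mono) (rule order_trans[OF _ le])
  qed
  then show ?thesis
  proof (rule AE_mp, intro AE_I2 impI)
    fix \<omega> assume "ennreal (?q \<omega>) \<le> ennreal (\<beta> i)"
    then have "?q \<omega> \<le> \<beta> i" using \<beta>(1) by simp
    then show "\<bar>diff_op y (F i) (component i \<omega>)\<bar> \<le> \<beta> i * norm y" using y by (simp add: pos_divide_le_eq)
  qed
qed

lemma L2_set_update:
  assumes I: "finite I" "i \<in> I" and eq: "\<And>j. j \<in> I \<Longrightarrow> j \<noteq> i \<Longrightarrow> g j = f j" and gi: "g i = f i + d"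
  shows "(L2_set g I)\<^sup>2 = (L2_set f I)\<^sup>2 + 2 * f i * d + d\<^sup>2"
proof -
  have "(\<Sum>j\<in>I - {i}. (g j)\<^sup>2) = (\<Sum>j\<in>I - {i}. (f j)\<^sup>2)" by (intro sum.cong) (auto simp: eq)
  moreover have "(L2_set h I)\<^sup>2 = (\<Sum>j\<in>I. (h j)\<^sup>2)" for h
    by (simp add: L2_set_def sum_nonneg)
  ultimately show ?thesis
    by (simp add: sum.remove[OF I] gi power2_sum)
qed

lemma component_insert:
  "component i (insert (i, y) \<omega>) = component i \<omega> \<union> {y}"
  "j \<noteq> i \<Longrightarrow> component j (insert (i, y) \<omega>) = component j \<omega>"
  by (auto simp: component_def)

theorem proposition3p2:
  fixes n :: nat
    and \<nu> :: "nat \<Rightarrow> 'y::real_normed_vector measure"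
    and P :: "(nat \<times> 'y) set measure"
    and F :: "nat \<Rightarrow> 'y set \<Rightarrow> real"
    and \<beta> :: "nat \<Rightarrow> real"
    and normF :: "(nat \<times> 'y) set \<Rightarrow> real"
    and E :: ennreal
    and h :: "real \<Rightarrow> ennreal"
    and t\<^sub>0 :: ereal
    and x :: real
  assumes "1 \<le> n"
    and "\<And>i. i \<in> {1..n} \<Longrightarrow> radon_measure (\<nu> i) \<and> diffuse_measure (\<nu> i)"
    and "poisson_measure (intensity n \<nu>) P"
    and "\<And>i. i \<in> {1..n} \<Longrightarrow> F i \<in> borel_measurable (config_space (borel :: 'y measure))"
    and "\<And>i. i \<in> {1..n} \<Longrightarrow> 0 \<le> \<beta> i"
    and "(\<forall>i\<in>{1..n}. ennreal (\<beta> i) = lip_sup n F i) \<or>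
         (\<forall>i\<in>{1..n}. ennreal (\<beta> i) = lip_esssup P F i)"
    and "\<And>\<omega>. normF \<omega> = L2_set (\<lambda>i. F i (component i \<omega>)) {1..n}"
    and "E = (\<integral>\<^sup>+ \<omega>. ennreal (normF \<omega>) \<partial>P)"
    and "h = dev_fun n \<nu> \<beta> E"
    and "0 < t\<^sub>0"
    and "\<And>t. 0 \<le> t \<Longrightarrow> ereal t < t\<^sub>0 \<Longrightarrow> h t < \<infinity>"
    and "0 < x"
    and "ennreal x < left_limit h t\<^sub>0"
  shows "measure P {\<omega> \<in> space P. ennreal (normF \<omega>) \<ge> 2 * E + ennreal x}
           \<le> exp (- (LBINT s:{0..x}. gen_inverse h s))"
proof -
  let ?M = "intensity n \<nu>"
  note n = assms(1) and F = assms(4) and \<beta> = assms(5) and normF = assms(7) and E = assms(8)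
    and h = assms(9) and x = assms(12)
  have \<nu>: "radon_measure (\<nu> i)" "diffuse_measure (\<nu> i)" "sets (\<nu> i) = sets borel" if "i \<in> {1..n}" for i
    using assms(2)[OF that] radon_measure_sets by auto
  have "prob_space P" using assms(3) by (simp add: poisson_measure_def)
  then interpret prob: prob_space P .
  interpret poisson_process P ?M
  proof
    show "AE \<omega> in P. num_points A \<omega> = \<infinity>" if "A \<in> sets ?M" "emeasure ?M A = \<infinity>" for A
      using \<nu>(1) assms(3) that by (rule intensity_infinite_count)
  qed (rule assms(3))
  have space_P': "space P = configurations ({1..n} \<times> UNIV)" by (simp add: space_P)
  have F_meas: "(\<lambda>\<omega>. F i (component i \<omega>)) \<in> borel_measurable (config_space ?M)" if "i \<in> {1..n}" for i
    using measurable_compose[OF measurable_component[OF that] F[OF that]] .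
  have normF_meas [measurable]: "normF \<in> borel_measurable (config_space ?M)"
  proof -
    have "(\<lambda>\<omega>. sqrt (\<Sum>i\<in>{1..n}. (F i (component i \<omega>))\<^sup>2)) \<in> borel_measurable (config_space ?M)"
      by (rule measurable_compose[OF _ borel_measurable_sqrt])
        (intro borel_measurable_sum borel_measurable_power F_meas)
    then show ?thesis by (simp add: normF[abs_def] L2_set_def)
  qed
  have normF_nonneg: "0 \<le> normF \<omega>" for \<omega> by (simp add: normF)
  have lip: "AE \<omega> in P. \<bar>diff_op y (F i) (component i \<omega>)\<bar> \<le> \<beta> i * norm y" if "i \<in> {1..n}" "y \<noteq> 0" for i y
    using assms(6) that by (intro lipschitz_AE[OF space_P' \<beta>]) auto
  \<comment> \<open>The truncation level must be finite and positive. For an infinite mean the event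
    is empty; for mean 0 the norm vanishes almost surely and cannot reach \<open>x\<close>.\<close>
  consider "E = \<infinity>" | "E = 0" | e where "E = ennreal e" "0 < e"
    by (cases E) (auto simp: less_le)
  then show ?thesis
  proof cases
    case 1
    then have "{\<omega> \<in> space P. ennreal (normF \<omega>) \<ge> 2 * E + ennreal x} = {}"
      by (auto simp: ennreal_mult_top top_unique)
    then show ?thesis by (simp only: measure_empty) simp
  next
    case 2
    then have "(\<integral>\<^sup>+ \<omega>. ennreal (normF \<omega>) \<partial>P) = 0" using E by simp
    moreover have "(\<lambda>\<omega>. ennreal (normF \<omega>)) \<in> borel_measurable P" by measurable
    ultimately have "AE \<omega> in P. ennreal (normF \<omega>) = 0" by (simp only: nn_integral_0_iff_AE)
    then have "AE \<omega> in P. \<omega> \<notin> {\<omega> \<in> space P. ennreal (normF \<omega>) \<ge> 2 * E + ennreal x}"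
      by (rule eventually_mono) (use x 2 in auto)
    moreover have "{\<omega> \<in> space P. ennreal (normF \<omega>) \<ge> 2 * E + ennreal x} \<in> sets P" by measurable
    ultimately have "measure P {\<omega> \<in> space P. ennreal (normF \<omega>) \<ge> 2 * E + ennreal x} = 0"
      using prob.prob_eq_0 by blast
    then show ?thesis by simp
  next
    case 3
    have mono_h: "mono h" unfolding h using n \<beta> by (rule dev_fun_mono)
    \<comment> \<open>The point \<open>t\<^sub>1\<close> makes the set defining the inverse at
      \<open>x\<close> nonempty, and \<open>h\<close> is finite on
      \<open>[0, t\<^sub>1]\<close>.\<close>
    obtain t\<^sub>1 where t\<^sub>1: "0 < t\<^sub>1" "ereal t\<^sub>1 < t\<^sub>0" "ennreal x < h t\<^sub>1"
      using mono_h assms(10,13) by (rule left_limit_lessE)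
    \<comment> \<open>This is the threshold of the event itself, so truncating there loses
      nothing.\<close>
    define c where "c = 2 * e + x"
    define Z where "Z \<omega> = min (max (normF \<omega>) e) c" for \<omega>
    define K where "K p = \<beta> (fst p) * norm (snd p)" for p :: "nat \<times> 'y"
    define r where "r i \<omega> = (F i (component i \<omega>))\<^sup>2 / (normF \<omega>)\<^sup>2" for i \<omega>
    \<comment> \<open>The constants \<beta> say nothing about adding the origin; diffuseness makes
      these points a null set.\<close>
    define N\<^sub>0 where "N\<^sub>0 = {1..n} \<times> {0 :: 'y}"
    have c: "0 < c" "e \<le> c" using 3(2) x by (auto simp: c_def)
    have Z_bounds: "0 \<le> Z \<omega>" "Z \<omega> \<le> c" for \<omega> using c 3(2) by (auto simp: Z_def)
    have Z_meas [measurable]: "Z \<in> borel_measurable (config_space ?M)" unfolding Z_def by measurable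
    have r_meas: "r i \<in> borel_measurable (config_space ?M)" if "i \<in> {1..n}" for i
      unfolding r_def by (intro borel_measurable_divide borel_measurable_power F_meas that normF_meas)
    have r_nonneg: "0 \<le> r i \<omega>" for i \<omega> by (simp add: r_def)
    have r_sum: "(\<Sum>i=1..n. r i \<omega>) \<le> 1" for \<omega>
    proof -
      have "(\<Sum>i=1..n. r i \<omega>) = (normF \<omega>)\<^sup>2 / (normF \<omega>)\<^sup>2"
        unfolding r_def sum_divide_distrib[symmetric] by (simp add: normF L2_set_def sum_nonneg)
      \<comment> \<open>The quotient is 1, or 0 when the norm vanishes.\<close>
      then show ?thesis by simp
    qed
    have N\<^sub>0: "N\<^sub>0 \<in> null_sets ?M"
    proof
      have "N\<^sub>0 = (\<Union>i\<in>{1..n}. {i} \<times> {0})" by (auto simp: N\<^sub>0_def)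
      also have "\<dots> \<in> sets ?M" by (intro sets.finite_UN slice_measurable) auto
      finally show sets: "N\<^sub>0 \<in> sets ?M" .
      have "emeasure ?M N\<^sub>0 = (\<Sum>i=1..n. emeasure (\<nu> i) {y. (i, y) \<in> N\<^sub>0})"
        using \<nu>(3) sets by (rule emeasure_intensity)
      also have "\<dots> = (\<Sum>i=1..n. 0)"
      proof (rule sum.cong[OF refl])
        fix i assume i: "i \<in> {1..n}"
        then have "{y. (i, y) \<in> N\<^sub>0} = {0}" by (auto simp: N\<^sub>0_def)
        moreover have "space (\<nu> i) = UNIV" using sets_eq_imp_space_eq[OF \<nu>(3)[OF i]] by simp
        ultimately show "emeasure (\<nu> i) {y. (i, y) \<in> N\<^sub>0} = 0"
          using \<nu>(2)[OF i] by (simp add: diffuse_measure_def)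
      qed
      finally show "emeasure ?M N\<^sub>0 = 0" by simp
    qed
    have increments: "AE \<omega> in P. \<bar>Z (insert p \<omega>) - Z \<omega>\<bar> \<le> K p \<and>
        (Z (insert p \<omega>) - Z \<omega>)\<^sup>2 \<le> r (fst p) \<omega> * (8 * (K p)\<^sup>2) + 2 * K p ^ 4 / e\<^sup>2"
      if p: "p \<in> space ?M - N\<^sub>0" for p
    proof -
      define i y where "i = fst p" and "y = snd p"
      then have iy: "p = (i, y)" "i \<in> {1..n}" "y \<noteq> 0" using p by (cases p; auto simp: N\<^sub>0_def)+
      from lip[OF iy(2,3)] show ?thesis
      proof (rule eventually_mono)
        fix \<omega>
        let ?f = "\<lambda>j \<omega>. F j (component j \<omega>)"
        define d where "d = diff_op y (F i) (component i \<omega>)"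
        assume "\<bar>diff_op y (F i) (component i \<omega>)\<bar> \<le> \<beta> i * norm y"
        then have d: "\<bar>d\<bar> \<le> K p" by (simp add: d_def K_def iy(1))
        have fi: "?f i (insert p \<omega>) = ?f i \<omega> + d"
          by (simp add: d_def diff_op_def iy(1) component_insert)
        have sq: "(normF (insert p \<omega>))\<^sup>2 = (normF \<omega>)\<^sup>2 + 2 * ?f i \<omega> * d + d\<^sup>2"
          unfolding normF using iy(2) fi by (intro L2_set_update) (auto simp: iy(1) component_insert)
        have le: "\<bar>?f i \<omega>\<bar> \<le> normF \<omega>" for \<omega>
        proof -
          have "\<bar>?f i \<omega>\<bar> \<le> L2_set (\<lambda>j. \<bar>?f j \<omega>\<bar>) {1..n}" using iy(2) by (intro member_le_L2_set) auto
          then show ?thesis by (simp add: normF L2_set_def)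
        qed
        note inc = clamp_increment[OF normF_nonneg normF_nonneg sq le le[of "insert p \<omega>", unfolded fi] 3(2), of c]
        have "(Z (insert p \<omega>) - Z \<omega>)\<^sup>2 \<le> 8 * d\<^sup>2 * r i \<omega> + 2 * d ^ 4 / e\<^sup>2"
          using inc(2) by (simp add: Z_def r_def)
        also have "\<dots> \<le> 8 * (K p)\<^sup>2 * r i \<omega> + 2 * K p ^ 4 / e\<^sup>2"
        proof (intro add_mono mult_right_mono mult_left_mono divide_right_mono r_nonneg)
          show "d\<^sup>2 \<le> (K p)\<^sup>2" using power_mono[OF d, of 2] by simp
          show "d ^ 4 \<le> K p ^ 4" using power_mono[OF d, of 4] by simp
        qed auto
        finally show "\<bar>Z (insert p \<omega>) - Z \<omega>\<bar> \<le> K p \<and>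
            (Z (insert p \<omega>) - Z \<omega>)\<^sup>2 \<le> r (fst p) \<omega> * (8 * (K p)\<^sup>2) + 2 * K p ^ 4 / e\<^sup>2"
          using inc(1) d by (simp add: Z_def iy(1) mult.commute)
      qed
    qed
    have cov: "ennreal (prob.expectation (\<lambda>\<omega>. Z \<omega> * exp (t * Z \<omega>)) -
        prob.expectation Z * prob.expectation (\<lambda>\<omega>. exp (t * Z \<omega>)))
        \<le> h t * ennreal (prob.expectation (\<lambda>\<omega>. exp (t * Z \<omega>)))" if t: "0 \<le> t" "t \<le> t\<^sub>1" for t
    proof -
      \<comment> \<open>The slope of the chord in \<open>exp_increment\<close>. Multiplying the
        bound on the squared increment by \<open>w\<close> cancels one factor \<open>K\<close> in
        each summand, which produces the integrands \<open>a\<close> and \<open>b\<close> of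
        \<open>dev_fun\<close>.\<close>
      define w where "w p = (exp (t * K p) - 1) / K p" for p
      define a where "a i y = 8 * (\<beta> i * norm y * (exp (t * \<beta> i * norm y) - 1))" for i and y :: 'y
      define b where "b i y = 2 / e\<^sup>2 * (\<beta> i ^ 3 * norm y ^ 3 * (exp (t * \<beta> i * norm y) - 1))" for i and y :: 'y
      \<comment> \<open>Only the term of the component of \<open>p\<close> is nonzero. The sum over
        slices gives measurability and lets the integral be computed one \<open>\<nu> i\<close> at a
        time.\<close>
      define \<rho> where "\<rho> \<omega> p = (\<Sum>i=1..n. ennreal (r i \<omega> * a i (snd p) + b i (snd p)) *
          indicator ({i} \<times> UNIV) p)" for \<omega> and p :: "nat \<times> 'y"
      have ab_nonneg: "0 \<le> a i y" "0 \<le> b i y" if "i \<in> {1..n}" for i and y :: 'y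
        using \<beta>[OF that] t by (auto simp: a_def b_def)
      have norm_meas: "(norm :: 'y \<Rightarrow> real) \<in> borel_measurable borel"
        by (intro borel_measurable_continuous_onI continuous_intros)
      note [measurable] = norm_meas
      have a_meas: "a i \<in> borel_measurable borel" and b_meas: "b i \<in> borel_measurable borel" for i
        unfolding a_def b_def by measurable
      have snd_meas: "snd \<in> measurable ?M borel"
        using measurable_snd[of "count_space {1..n}" "borel :: 'y measure"]
        by (simp cong: measurable_cong_sets)
      have \<rho>_meas: "(\<lambda>q. \<rho> (fst q) (snd q)) \<in> borel_measurable (P \<Otimes>\<^sub>M ?M)"
        unfolding \<rho>_def
      proof (intro borel_measurable_sum borel_measurable_times_ennreal measurable_compose[OF _ measurable_ennreal]
          borel_measurable_add borel_measurable_times)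
        fix i assume i: "i \<in> {1..n}"
        have "r i \<in> borel_measurable P" using r_meas[OF i] by (simp add: measurable_cong_sets[OF sets_P refl])
        then show "(\<lambda>q. r i (fst q)) \<in> borel_measurable (P \<Otimes>\<^sub>M ?M)" by (rule measurable_compose[OF measurable_fst])
        show "(\<lambda>q. a i (snd (snd q))) \<in> borel_measurable (P \<Otimes>\<^sub>M ?M)"
          "(\<lambda>q. b i (snd (snd q))) \<in> borel_measurable (P \<Otimes>\<^sub>M ?M)"
          by (rule measurable_compose[OF measurable_snd measurable_compose[OF snd_meas]], rule a_meas b_meas)+
        have "indicator ({i} \<times> UNIV) \<in> borel_measurable ?M"
          using i by (intro borel_measurable_indicator slice_measurable) auto
        then show "(\<lambda>q. indicator ({i} \<times> UNIV) (snd q) :: ennreal) \<in> borel_measurable (P \<Otimes>\<^sub>M ?M)"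
          by (rule measurable_compose[OF measurable_snd])
      qed
      have \<rho>_point: "\<rho> \<omega> p = ennreal (r (fst p) \<omega> * a (fst p) (snd p) + b (fst p) (snd p))"
        if "p \<in> space ?M" for \<omega> p
      proof -
        have "\<rho> \<omega> p = (\<Sum>i=1..n. if i = fst p
            then ennreal (r (fst p) \<omega> * a (fst p) (snd p) + b (fst p) (snd p)) else 0)"
          unfolding \<rho>_def by (cases p, intro sum.cong refl) (auto simp: indicator_def)
        then show ?thesis using that by (auto simp: sum.delta)
      qed
      have \<rho>_int: "(\<integral>\<^sup>+p. \<rho> \<omega> p \<partial>?M) \<le> h t" for \<omega>
      proof -
        define A where "A i = ennreal (\<beta> i) * (\<integral>\<^sup>+y. ennreal (norm y * (exp (t * \<beta> i * norm y) - 1)) \<partial>\<nu> i)" for i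
        define B where "B i = ennreal (\<beta> i ^ 3) * (\<integral>\<^sup>+y. ennreal (norm y ^ 3 * (exp (t * \<beta> i * norm y) - 1)) \<partial>\<nu> i)" for i
        have slice: "(\<integral>\<^sup>+y. ennreal (r i \<omega> * a i y + b i y) \<partial>\<nu> i) =
            ennreal (r i \<omega>) * (8 * A i) + ennreal (2 / e\<^sup>2) * B i" if i: "i \<in> {1..n}" for i
        proof -
          note [measurable_cong] = \<nu>(3)[OF i]
          have "(\<integral>\<^sup>+y. ennreal (r i \<omega> * a i y + b i y) \<partial>\<nu> i) =
              (\<integral>\<^sup>+y. ennreal (r i \<omega>) * (8 * (ennreal (\<beta> i) * ennreal (norm y * (exp (t * \<beta> i * norm y) - 1)))) +
                ennreal (2 / e\<^sup>2) * (ennreal (\<beta> i ^ 3) * ennreal (norm y ^ 3 * (exp (t * \<beta> i * norm y) - 1))) \<partial>\<nu> i)"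
          proof (rule nn_integral_cong)
            fix y :: 'y
            have e: "0 \<le> exp (t * \<beta> i * norm y) - 1" using \<beta>[OF i] t by simp
            show "ennreal (r i \<omega> * a i y + b i y) =
                ennreal (r i \<omega>) * (8 * (ennreal (\<beta> i) * ennreal (norm y * (exp (t * \<beta> i * norm y) - 1)))) +
                ennreal (2 / e\<^sup>2) * (ennreal (\<beta> i ^ 3) * ennreal (norm y ^ 3 * (exp (t * \<beta> i * norm y) - 1)))"
              using e r_nonneg[of i \<omega>] \<beta>[OF i] ab_nonneg[OF i]
              by (simp add: a_def b_def ennreal_plus ennreal_mult[symmetric] ennreal_numeral[symmetric] mult.assoc
                  del: ennreal_numeral)
          qed
          also have "\<dots> = ennreal (r i \<omega>) * (8 * A i) + ennreal (2 / e\<^sup>2) * B i"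
            unfolding A_def B_def by (simp add: nn_integral_add nn_integral_cmult)
          finally show ?thesis .
        qed
        have "(\<integral>\<^sup>+p. \<rho> \<omega> p \<partial>?M) = (\<Sum>i=1..n. \<integral>\<^sup>+p. ennreal (r i \<omega> * a i (snd p) + b i (snd p)) *
            indicator ({i} \<times> UNIV) p \<partial>?M)"
          unfolding \<rho>_def
        proof (rule nn_integral_sum)
          fix i assume i: "i \<in> {1..n}"
          have "(\<lambda>y. ennreal (r i \<omega> * a i y + b i y)) \<in> borel_measurable borel"
            using a_meas b_meas by measurable
          from measurable_compose[OF snd_meas this]
          show "(\<lambda>p. ennreal (r i \<omega> * a i (snd p) + b i (snd p)) * indicator ({i} \<times> UNIV) p) \<in> borel_measurable ?M"
            using i by (intro borel_measurable_times_ennreal borel_measurable_indicator slice_measurable) auto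
        qed
        also have "\<dots> = (\<Sum>i=1..n. ennreal (r i \<omega>) * (8 * A i) + ennreal (2 / e\<^sup>2) * B i)"
        proof (rule sum.cong[OF refl])
          fix i assume i: "i \<in> {1..n}"
          have "(\<lambda>y. ennreal (r i \<omega> * a i y + b i y)) \<in> borel_measurable borel"
            using a_meas b_meas by measurable
          from nn_integral_intensity_slice[OF \<nu>(3) i this] slice[OF i]
          show "(\<integral>\<^sup>+p. ennreal (r i \<omega> * a i (snd p) + b i (snd p)) * indicator ({i} \<times> UNIV) p \<partial>?M) =
              ennreal (r i \<omega>) * (8 * A i) + ennreal (2 / e\<^sup>2) * B i" by simp
        qed
        \<comment> \<open>The first maximum is weighted by shares of total at most 1. The second has
          no such weights and is counted \<open>n\<close> times, which explains the factor
          \<open>n\<close> in \<open>dev_fun\<close>.\<close>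
        also have "\<dots> \<le> (\<Sum>i=1..n. ennreal (r i \<omega>) * (8 * (MAX i\<in>{1..n}. A i)) + ennreal (2 / e\<^sup>2) * (MAX i\<in>{1..n}. B i))"
          by (intro sum_mono add_mono mult_left_mono Max_ge) auto
        also have "\<dots> = (\<Sum>i=1..n. ennreal (r i \<omega>)) * (8 * (MAX i\<in>{1..n}. A i)) +
            of_nat n * ennreal (2 / e\<^sup>2) * (MAX i\<in>{1..n}. B i)"
          by (simp add: sum.distrib sum_distrib_right mult.assoc)
        also have "\<dots> \<le> 1 * (8 * (MAX i\<in>{1..n}. A i)) + of_nat n * ennreal (2 / e\<^sup>2) * (MAX i\<in>{1..n}. B i)"
        proof (intro add_right_mono mult_right_mono)
          have "(\<Sum>i=1..n. ennreal (r i \<omega>)) = ennreal (\<Sum>i=1..n. r i \<omega>)" by (intro sum_ennreal r_nonneg)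
          also have "\<dots> \<le> 1" using r_sum[of \<omega>] by simp
          finally show "(\<Sum>i=1..n. ennreal (r i \<omega>)) \<le> 1" .
        qed simp
        also have "of_nat n * ennreal (2 / e\<^sup>2) = 2 * of_nat n / E\<^sup>2"
        proof -
          have "2 * of_nat n / E\<^sup>2 = ennreal (2 * real n) / ennreal (e\<^sup>2)"
            using 3 by (simp add: ennreal_mult ennreal_power ennreal_of_nat_eq_real_of_nat)
          also have "\<dots> = ennreal (real n * (2 / e\<^sup>2))" using 3(2) by (simp add: divide_ennreal mult.commute)
          also have "\<dots> = of_nat n * ennreal (2 / e\<^sup>2)"
            by (subst ennreal_mult) (simp_all add: ennreal_of_nat_eq_real_of_nat)
          finally show ?thesis ..
        qed
        finally show ?thesis by (simp add: h dev_fun_def A_def B_def)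
      qed
      have "h t < \<infinity>" using t t\<^sub>1(2) by (intro assms(11)) (auto intro: le_less_trans[of _ "ereal t\<^sub>1"])
      then obtain \<kappa> where \<kappa>: "h t = ennreal \<kappa>" "0 \<le> \<kappa>" by (cases "h t") auto
      interpret poisson_covariance P ?M Z "\<lambda>\<omega>. exp (t * Z \<omega>)" c "exp (t * c)" w \<rho> N\<^sub>0
      proof
        show "(\<lambda>\<omega>. exp (t * Z \<omega>)) \<in> borel_measurable (config_space ?M)" by measurable
        show "exp (t * Z \<omega>) \<le> exp (t * c)" for \<omega> using t Z_bounds by (simp add: mult_left_mono)
        \<comment> \<open>The locale asks for all \<open>p\<close>, also with an index outside
          \<open>{1..n}\<close>, where \<beta> may be negative; then numerator and denominator are
          both nonpositive.\<close>
        show "0 \<le> w p" for p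
          using t by (cases "0 \<le> K p") (auto simp: w_def mult_nonneg_nonpos intro!: divide_nonpos_nonpos)
        fix p assume p: "p \<in> space ?M - N\<^sub>0"
        have i: "fst p \<in> {1..n}" using p by auto
        show "AE \<omega> in P. \<bar>exp (t * Z (insert p \<omega>)) - exp (t * Z \<omega>)\<bar> \<le>
            w p * exp (t * Z \<omega>) * \<bar>Z (insert p \<omega>) - Z \<omega>\<bar>"
          using increments[OF p]
        proof (rule eventually_mono)
          fix \<omega> assume *: "\<bar>Z (insert p \<omega>) - Z \<omega>\<bar> \<le> K p \<and>
            (Z (insert p \<omega>) - Z \<omega>)\<^sup>2 \<le> r (fst p) \<omega> * (8 * (K p)\<^sup>2) + 2 * K p ^ 4 / e\<^sup>2"
          have "exp (t * Z (insert p \<omega>)) - exp (t * Z \<omega>) =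
              exp (t * Z \<omega>) * (exp (t * (Z (insert p \<omega>) - Z \<omega>)) - 1)"
            by (simp add: right_diff_distrib exp_diff)
          then have "\<bar>exp (t * Z (insert p \<omega>)) - exp (t * Z \<omega>)\<bar> =
              exp (t * Z \<omega>) * \<bar>exp (t * (Z (insert p \<omega>) - Z \<omega>)) - 1\<bar>" by (simp add: abs_mult)
          also have "\<dots> \<le> exp (t * Z \<omega>) * (w p * \<bar>Z (insert p \<omega>) - Z \<omega>\<bar>)"
            unfolding w_def using * t(1) by (intro mult_left_mono exp_increment) auto
          finally show "\<bar>exp (t * Z (insert p \<omega>)) - exp (t * Z \<omega>)\<bar> \<le>
            w p * exp (t * Z \<omega>) * \<bar>Z (insert p \<omega>) - Z \<omega>\<bar>" by (simp add: mult_ac)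
        qed
        show "AE \<omega> in P. ennreal (w p * (Z (insert p \<omega>) - Z \<omega>)\<^sup>2) \<le> \<rho> \<omega> p"
          using increments[OF p]
        proof (rule eventually_mono)
          fix \<omega> assume *: "\<bar>Z (insert p \<omega>) - Z \<omega>\<bar> \<le> K p \<and>
            (Z (insert p \<omega>) - Z \<omega>)\<^sup>2 \<le> r (fst p) \<omega> * (8 * (K p)\<^sup>2) + 2 * K p ^ 4 / e\<^sup>2"
          have K: "0 \<le> K p" using \<beta>[OF i] by (simp add: K_def)
          then have "0 \<le> w p" using t by (simp add: w_def)
          then have "w p * (Z (insert p \<omega>) - Z \<omega>)\<^sup>2 \<le>
              w p * (r (fst p) \<omega> * (8 * (K p)\<^sup>2) + 2 * K p ^ 4 / e\<^sup>2)"
            using * by (intro mult_left_mono) auto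
          also have "\<dots> = r (fst p) \<omega> * (8 * (w p * K p * K p)) + 2 / e\<^sup>2 * (w p * K p * K p ^ 3)"
            by (simp add: power2_eq_square power3_eq_cube power4_eq_xxxx algebra_simps)
          \<comment> \<open>This remains valid for \<open>K p = 0\<close>, where both sides are
            0.\<close>
          also have "w p * K p = exp (t * K p) - 1" by (simp add: w_def)
          also have "r (fst p) \<omega> * (8 * ((exp (t * K p) - 1) * K p)) + 2 / e\<^sup>2 * ((exp (t * K p) - 1) * K p ^ 3) =
              r (fst p) \<omega> * a (fst p) (snd p) + b (fst p) (snd p)"
            by (simp add: a_def b_def K_def power_mult_distrib mult_ac)
          finally show "ennreal (w p * (Z (insert p \<omega>) - Z \<omega>)\<^sup>2) \<le> \<rho> \<omega> p"
            using p by (subst \<rho>_point) (auto intro: ennreal_leI)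
        qed
      qed (use Z_bounds \<rho>_meas N\<^sub>0 in auto)
      have "(\<integral>\<omega>. Z \<omega> * exp (t * Z \<omega>) \<partial>P) - (\<integral>\<omega>. Z \<omega> \<partial>P) * (\<integral>\<omega>. exp (t * Z \<omega>) \<partial>P)
          \<le> \<kappa> * (\<integral>\<omega>. exp (t * Z \<omega>) \<partial>P)"
        using \<rho>_int \<kappa> intensity_partition[OF assms(2)] by (intro covariance_le) auto
      then have "ennreal ((\<integral>\<omega>. Z \<omega> * exp (t * Z \<omega>) \<partial>P) - (\<integral>\<omega>. Z \<omega> \<partial>P) * (\<integral>\<omega>. exp (t * Z \<omega>) \<partial>P))
          \<le> ennreal (\<kappa> * (\<integral>\<omega>. exp (t * Z \<omega>) \<partial>P))" by (rule ennreal_leI)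
      then show ?thesis using \<kappa> by (simp add: ennreal_mult)
    qed
    have Z_P: "Z \<in> borel_measurable P" using Z_meas by (simp add: measurable_cong_sets[OF sets_P refl])
    have "prob.prob {\<omega> \<in> space P. prob.expectation Z + x \<le> Z \<omega>} \<le> exp (- (LBINT s:{0..x}. gen_inverse h s))"
      using prob.deviation_bound[OF Z_P Z_bounds mono_h t\<^sub>1(1) less_imp_le[OF t\<^sub>1(3)] less_imp_le[OF x] cov] .
    moreover have "prob.expectation Z \<le> 2 * e"
    proof -
      have "ennreal (prob.expectation Z) = (\<integral>\<^sup>+\<omega>. ennreal (Z \<omega>) \<partial>P)"
        using Z_P Z_bounds by (intro nn_integral_eq_integral[symmetric] prob.integrable_const_bound[where B = c]) auto
      also have "\<dots> \<le> (\<integral>\<^sup>+\<omega>. ennreal (normF \<omega>) + ennreal e \<partial>P)"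
      proof (rule nn_integral_mono)
        fix \<omega>
        have "Z \<omega> \<le> normF \<omega> + e" using normF_nonneg[of \<omega>] 3(2) by (simp add: Z_def min_le_iff_disj)
        then show "ennreal (Z \<omega>) \<le> ennreal (normF \<omega>) + ennreal e"
          using normF_nonneg[of \<omega>] 3(2) by (simp add: ennreal_plus[symmetric] ennreal_leI del: ennreal_plus)
      qed
      also have "\<dots> = E + ennreal e"
        by (subst nn_integral_add) (auto simp: E prob.emeasure_space_1)
      also have "\<dots> = ennreal (2 * e)" using 3 by (simp add: ennreal_plus[symmetric] del: ennreal_plus)
      finally show ?thesis using 3(2) by simp
    qed
    \<comment> \<open>On this event \<open>Z\<close> attains its cap \<open>c\<close>, which is at
      least the mean of \<open>Z\<close> plus \<open>x\<close>.\<close>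
    moreover have "prob.prob {\<omega> \<in> space P. ennreal (normF \<omega>) \<ge> 2 * E + ennreal x} \<le>
        prob.prob {\<omega> \<in> space P. prob.expectation Z + x \<le> Z \<omega>}"
    proof (rule prob.finite_measure_mono)
      show "{\<omega> \<in> space P. ennreal (normF \<omega>) \<ge> 2 * E + ennreal x} \<subseteq>
          {\<omega> \<in> space P. prob.expectation Z + x \<le> Z \<omega>}"
      proof safe
        fix \<omega> assume "ennreal (normF \<omega>) \<ge> 2 * E + ennreal x"
        moreover have "2 * E + ennreal x = ennreal c"
          using 3 x by (simp add: c_def ennreal_plus ennreal_mult)
        ultimately have "c \<le> normF \<omega>" using normF_nonneg by simp
        then have "Z \<omega> = c" using c by (simp add: Z_def)
        then show "prob.expectation Z + x \<le> Z \<omega>" using \<open>prob.expectation Z \<le> 2 * e\<close> by (simp add: c_def)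
      qed
      show "{\<omega> \<in> space P. prob.expectation Z + x \<le> Z \<omega>} \<in> sets P" using Z_P by measurable
    qed
    ultimately show ?thesis by linarith
  qed
qed

end
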